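(* Let $\{\mu_{nk}:n\in\mathbb{N},1\le k\le k_n\}\subset\mathcal{M}_{\mathbb{T}}^{\times}$ be an infinitesimal array, let $\{\lambda_n\}_{n=1}^\infty\subset\mathbb{T}$, and put $$\mu_n=\delta_{\lambda_n}\uplus_\times\mu_{n1}\uplus_\times\cdots\uplus_\times\mu_{nk_n},\qquad \nu_n=\delta_{\lambda_n}\circledast\mu_{n1}\circledast\cdots\circledast\mu_{nk_n},\qquad n\in\mathbb{N}.$$ The sequence $\mu_n$ converges weakly on $\mathbb{T}$ to a $\uplus_\times$-normal distribution if and only if the sequence $\nu_n$ converges weakly on $\mathbb{T}$ to a normal distribution.
   Context: $\mathbb{T}$ is the unit circle, $\mathbb{D}$ the open unit disk; $\mathcal{M}_{\mathbb{T}}^{\times}$ is the set of Borel probability measures $\mu$ on $\mathbb{T}$ with $\int_{\mathbb{T}}\zeta\,d\mu(\zeta)\ne0$; $\delta_\lambda$ is the point mass at $\lambda$. $\{k_n\}$ is a sequence of natural numbers. An array $\{\mu_{nk}\}_{n\in\mathbb{N},1\le k\le k_n}$ of probability measures on $\mathbb{T}$ is infinitesimal if $\lim_{n\to\infty}\max_{1\le k\le k_n}\mu_{nk}(\{\zeta\in\mathbb{T}:|\zeta-1|\ge\varepsilon\})=0$ for every $\varepsilon>0$. For a probability measure $\mu$ on $\mathbb{T}$ put $\psi_\mu(z)=\int_{\mathbb{T}}\frac{\zeta z}{1-\zeta z}\,d\mu(\zeta)$ and $B_\mu(z)=\frac1z\frac{\psi_\mu(z)}{1+\psi_\mu(z)}$,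 $z\in\mathbb{D}$ (with the singularity at $0$ removed). The map $\mu\mapsto B_\mu$ is a bijection from probability measures on $\mathbb{T}$ to analytic functions $\mathbb{D}\to\overline{\mathbb{D}}$. The multiplicative boolean convolution $\mu_1\uplus_\times\mu_2$ is the probability measure determined by $B_{\mu_1\uplus_\times\mu_2}(z)=B_{\mu_1}(z)B_{\mu_2}(z)$, $z\in\mathbb{D}$. A probability measure $\nu$ on $\mathbb{T}$ is $\uplus_\times$-infinitely divisible if for each $n\in\mathbb{N}$ it is the $n$-fold $\uplus_\times$-convolution of some probability measure on $\mathbb{T}$ with itself. For $\gamma\in\mathbb{T}$ and a finite positive Borel measure $\sigma$ on $\mathbb{T}$, $\nu_{\uplus_\times}^{\gamma,\sigma}$ is the ($\uplus_\times$-infinitely divisible) probability measure $\nu$ on $\mathbb{T}$ with $B_\nu(z)=\gamma\exp\left(-\int_{\mathbb{T}}\frac{1+\zeta z}{1-\zeta z}\,d\sigma(\zeta)\right)$, $z\in\mathbb{D}$. A $\uplus_\times$-infinitely divisible measure $\nu_{\uplus_\times}^{\gamma,\sigma}\in\mathcal{M}_{\mathbb{T}}^{\times}$ is called $\uplus_\times$-normal if the measure $\sigma$ is concentrated in the point $1$, i.e. $\sigma=\sigma(\mathbb{T})\delta_1$. $\circledast$ is the classical convolution of probability measures on the group $\mathbb{T}$ (law of a product of independent $\mathbb{T}$-valued random variables). A probability measure on $\mathbb{T}$ is called a normal distribution if it is the push-forward, under the map $x\mapsto e^{ix}$ from $\mathbb{R}$ to $\mathbb{T}$, of a Gaussian law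 $N(a,t)$ on $\mathbb{R}$ with mean $a\in\mathbb{R}$ and variance $t>0$.
   Formalization: In the definition of ⊎×-normal the measure σ is required to be nonzero, σ(T) > 0; with σ = 0 allowed the claim fails (μ_nk = δ_1, λ_n = 1 gives the limit δ_1 on both sides, which is not a normal distribution with t > 0). *)

theory Defs
  imports "HOL-Probability.Probability" "HOL-Complex_Analysis.Complex_Analysis"
begin

abbreviation circle :: "complex set" where
  "circle \<equiv> sphere 0 1"

definition circle_borel :: "complex measure" where
  "circle_borel = restrict_space borel circle"

definition circle_prob :: "complex measure \<Rightarrow> bool" where
  "circle_prob M \<longleftrightarrow> prob_space M \<and> sets M = sets circle_borel"

definition circle_prob_nonzero_mean :: "complex measure \<Rightarrow> bool" where
  "circle_prob_nonzero_mean M \<longleftrightarrow> circle_prob M \<and> (LINT \<zeta>|M. \<zeta>) \<noteq> 0"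

definition point_mass :: "complex \<Rightarrow> complex measure" where
  "point_mass l = return circle_borel l"

definition infinitesimal_array :: "(nat \<Rightarrow> nat) \<Rightarrow> (nat \<Rightarrow> nat \<Rightarrow> complex measure) \<Rightarrow> bool" where
  "infinitesimal_array k \<mu> \<longleftrightarrow>
     (\<forall>\<epsilon>>0. (\<lambda>n. Max ((\<lambda>j. measure (\<mu> n j) {\<zeta>\<in>circle. cmod (\<zeta> - 1) \<ge> \<epsilon>}) ` {1..k n}))
               \<longlonglongrightarrow> 0)"

text \<open>Test functions are automatically bounded, since the circle is compact.\<close>

definition weak_conv_circle :: "(nat \<Rightarrow> complex measure) \<Rightarrow> complex measure \<Rightarrow> bool" where
  "weak_conv_circle M N \<longleftrightarrow>
     (\<forall>f :: complex \<Rightarrow> real. continuous_on circle f \<longrightarrow>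
        (\<lambda>n. LINT \<zeta>|M n. f \<zeta>) \<longlonglongrightarrow> (LINT \<zeta>|N. f \<zeta>))"

definition psi_transform :: "complex measure \<Rightarrow> complex \<Rightarrow> complex" where
  "psi_transform M z = (LINT \<zeta>|M. \<zeta> * z / (1 - \<zeta> * z))"

text \<open>Only the values on the open unit disk are meaningful. There the only singularity is the one
  at \<open>0\<close>, because the real part of \<open>psi_transform M z\<close> exceeds \<open>- 1/2\<close>.\<close>

definition B_transform :: "complex measure \<Rightarrow> complex \<Rightarrow> complex" where
  "B_transform M =
     remove_sings (\<lambda>z. 1 / z * (psi_transform M z / (1 + psi_transform M z)))"

text \<open>The description operators below are well defined because \<open>M \<mapsto> B_transform M\<close> is a bijection
  from the probability measures on the circle onto the analytic functions from the open unit disk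
  to the closed one.\<close>

definition boolean_conv :: "complex measure \<Rightarrow> complex measure \<Rightarrow> complex measure" where
  "boolean_conv M N =
     (THE P. circle_prob P \<and>
        (\<forall>z\<in>ball 0 1. B_transform P z = B_transform M z * B_transform N z))"

definition boolean_inf_divisible :: "complex measure \<Rightarrow> bool" where
  "boolean_inf_divisible N \<longleftrightarrow>
     circle_prob N \<and>
     (\<forall>n\<ge>1. \<exists>P. circle_prob P \<and> N = (boolean_conv P ^^ (n - 1)) P)"

definition boolean_law :: "complex \<Rightarrow> complex measure \<Rightarrow> complex measure" where
  "boolean_law \<gamma> \<sigma> =
     (THE N. circle_prob N \<and>
        (\<forall>z\<in>ball 0 1. B_transform N z =
           \<gamma> * exp (- (LINT \<zeta>|\<sigma>. (1 + \<zeta> * z) / (1 - \<zeta> * z)))))"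

text \<open>The measure \<open>\<sigma>\<close> has to charge the point \<open>1\<close>: for \<open>\<sigma> = 0\<close> the law is the point mass at
  \<open>\<gamma>\<close>, which is degenerate and hence excluded here, just as variance zero is excluded from
  \<open>circle_normal\<close> below.\<close>

definition boolean_normal :: "complex measure \<Rightarrow> bool" where
  "boolean_normal N \<longleftrightarrow>
     boolean_inf_divisible N \<and> circle_prob_nonzero_mean N \<and>
     (\<exists>\<gamma> \<sigma>. \<gamma> \<in> circle \<and> finite_measure \<sigma> \<and> sets \<sigma> = sets circle_borel \<and>
        N = boolean_law \<gamma> \<sigma> \<and>
        \<sigma> = scale_measure (emeasure \<sigma> circle) (point_mass 1) \<and> emeasure \<sigma> circle > 0)"

definition circle_conv :: "complex measure \<Rightarrow> complex measure \<Rightarrow> complex measure" where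
  "circle_conv M N = distr (M \<Otimes>\<^sub>M N) circle_borel (\<lambda>(x, y). x * y)"

text \<open>\<open>normal_density\<close> takes the standard deviation as its second argument; \<open>t\<close> is the variance.\<close>

definition circle_normal :: "complex measure \<Rightarrow> bool" where
  "circle_normal N \<longleftrightarrow>
     (\<exists>a t. t > 0 \<and> N = distr (density lborel (normal_density a (sqrt t))) circle_borel cis)"

text \<open>For a binary operation \<open>\<star>\<close>, this is \<open>(\<dots>((point_mass l \<star> M 1) \<star> M 2) \<dots>) \<star> M k\<close>.\<close>

definition row_conv ::
  "(complex measure \<Rightarrow> complex measure \<Rightarrow> complex measure) \<Rightarrow>
     complex \<Rightarrow> (nat \<Rightarrow> complex measure) \<Rightarrow> nat \<Rightarrow> complex measure" where
  "row_conv cnv l M k = foldl cnv (point_mass l) (map M [1..<Suc k])"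

end

theory Submission
  imports Defs
begin

text \<open>
  Why the equivalence holds. Let \<open>m\<^sub>j\<close> be the mean of the \<open>j\<close>-th measure of a row, \<open>r\<^sub>j\<close> its modulus, and divide the
  measure by the phase of its mean, so that a \<open>\<zeta>\<close> with real mean \<open>r\<^sub>j\<close> results. Put \<open>a\<^sub>j = E (1 - Re \<zeta>) = 1 - r\<^sub>j\<close> and
  \<open>d\<^sub>j = E (1 - Re \<zeta>)\<^sup>2\<close>. Both kinds of convergence turn out to be equivalent to one condition:

  \<^item> the numbers \<open>l * (\<Prod>j. m\<^sub>j)\<close> converge to a limit \<open>m\<close> with \<open>0 < norm m < 1\<close>, and \<open>(\<Sum>j. d\<^sub>j)\<close> tends to \<open>0\<close>.

  The product of the means is the mean of both convolutions of a row, so its convergence is necessary on either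
  side, and by taking logarithms it implies that \<open>(\<Sum>j. a\<^sub>j)\<close> tends to \<open>A = - ln (norm m)\<close>.

  That the \<open>d\<^sub>j\<close> are negligible follows from second moments alone, as an extremality statement: since
  \<open>Re (E \<zeta>\<^sup>2) = 1 - 4 * a\<^sub>j + 2 * d\<^sub>j\<close>, the defects \<open>d\<^sub>j \<ge> 0\<close> can only push a row away from the values of a normal law.
  In the boolean case one reads this off the logarithmic derivative of the B-transform at \<open>0\<close>, which is
  \<open>(E \<zeta>\<^sup>2 - (E \<zeta>)\<^sup>2) / E \<zeta>\<close> and additive (\<open>square_defect_tendsto_if_B_log_derivative\<close>); in the classical case off
  the modulus of the second moment, which is multiplicative (\<open>square_defect_tendsto_if_second_moments\<close>).

  Conversely, if \<open>(\<Sum>j. a\<^sub>j)\<close> is bounded and \<open>(\<Sum>j. d\<^sub>j)\<close> tends to \<open>0\<close>, then \<open>(\<Sum>j. E (norm (\<zeta> - 1) ^ 3))\<close> tends to \<open>0\<close>, and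
  expansions in powers of \<open>\<zeta> - 1\<close> determine every moment and every value of the B-transform up to summable
  errors (\<open>circle_moment_approx\<close>, \<open>B_transform_approx\<close>):
  \<open>E \<zeta>\<^sup>p\<close> is close to \<open>1 - p\<^sup>2 * a\<^sub>j\<close>, and the B-transform at \<open>z\<close> to \<open>1 - a\<^sub>j * (1 + z) / (1 - z)\<close>.
  The products over a row therefore converge to the moments of a wrapped Gaussian law and to the B-transform of
  a boolean one (\<open>row_convs_tendsto\<close>).

  Weak convergence is translated into convergence of moments by Stone--Weierstrass, and into convergence of
  B-transforms because these determine the moments. That the boolean convolution and the boolean Gaussian laws exist
  rests on the fact that every analytic map of the open disk into the closed one is a B-transform, a form of
  Herglotz' theorem that is obtained from Helly's selection theorem.
\<close>

section \<open>Moments and weak convergence on the circle\<close>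

definition circle_moment :: "complex measure \<Rightarrow> nat \<Rightarrow> complex" where
  "circle_moment M p = (LINT \<zeta>|M. \<zeta> ^ p)"

lemma sets_circle_prob: "circle_prob M \<Longrightarrow> sets M = sets (restrict_space borel circle)"
  by (simp add: circle_prob_def circle_borel_def)

lemma space_circle_borel [simp]: "space circle_borel = circle"
  by (simp add: circle_borel_def space_restrict_space)

lemma space_circle_prob: "circle_prob M \<Longrightarrow> space M = circle"
  using sets_eq_imp_space_eq[OF sets_circle_prob[of M]] by (simp add: space_restrict_space)

lemma prob_space_circle_prob: "circle_prob M \<Longrightarrow> prob_space M"
  by (simp add: circle_prob_def)

lemma continuous_imp_measurable_circle_borel:
  fixes f :: "complex \<Rightarrow> 'b::topological_space"
  assumes "continuous_on circle f"
  shows "f \<in> measurable circle_borel borel"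
  unfolding circle_borel_def using assms by (rule borel_measurable_continuous_on_restrict)

lemma continuous_imp_measurable_circle:
  fixes f :: "complex \<Rightarrow> 'b::topological_space"
  assumes "circle_prob M" "continuous_on circle f"
  shows "f \<in> borel_measurable M"
  using borel_measurable_continuous_on_restrict[OF assms(2)]
    measurable_cong_sets[OF sets_circle_prob[OF assms(1)] refl] by blast

lemma continuous_imp_integrable_circle:
  fixes f :: "complex \<Rightarrow> 'b::{banach, second_countable_topology}"
  assumes M: "circle_prob M" and f: "continuous_on circle f"
  shows "integrable M f"
proof -
  interpret prob_space M using M by (rule prob_space_circle_prob)
  have "compact (f ` circle)" using f by (intro compact_continuous_image) auto
  then obtain B where B: "\<And>\<zeta>. \<zeta> \<in> circle \<Longrightarrow> norm (f \<zeta>) \<le> B"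
    using compact_imp_bounded bounded_iff by (metis imageI)
  show ?thesis
    by (rule integrable_const_bound[where B = B])
      (use B M f in \<open>auto simp: space_circle_prob intro!: continuous_imp_measurable_circle AE_I2\<close>)
qed

lemma norm_integral_circle_le:
  fixes f :: "complex \<Rightarrow> 'b::{banach, second_countable_topology}"
  assumes M: "circle_prob M" and f: "continuous_on circle f"
    and B: "\<And>\<zeta>. \<zeta> \<in> circle \<Longrightarrow> norm (f \<zeta>) \<le> B"
  shows "norm (LINT \<zeta>|M. f \<zeta>) \<le> B"
proof -
  interpret prob_space M using M by (rule prob_space_circle_prob)
  have int: "integrable M f" by (rule continuous_imp_integrable_circle[OF M f])
  have "norm (LINT \<zeta>|M. f \<zeta>) \<le> (LINT \<zeta>|M. norm (f \<zeta>))" by (rule integral_norm_bound)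
  also have "\<dots> \<le> (LINT \<zeta>|M. B)"
    by (rule integral_mono) (use int B M in \<open>auto simp: space_circle_prob\<close>)
  finally show ?thesis by (simp add: prob_space)
qed

lemma norm_circle_moment_le_1: "circle_prob M \<Longrightarrow> norm (circle_moment M p) \<le> 1"
  unfolding circle_moment_def
  by (rule norm_integral_circle_le) (auto intro!: continuous_intros simp: norm_power)

lemma circle_moment_0 [simp]: "circle_prob M \<Longrightarrow> circle_moment M 0 = 1"
  using prob_space.prob_space[OF prob_space_circle_prob, of M] by (simp add: circle_moment_def)

lemma circle_integral_cnj_power:
  assumes "circle_prob M"
  shows "(LINT \<zeta>|M. cnj \<zeta> ^ p) = cnj (circle_moment M p)"
proof -
  have "(LINT \<zeta>|M. cnj \<zeta> ^ p) = (LINT \<zeta>|M. cnj (\<zeta> ^ p))" by simp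
  also have "\<dots> = cnj (LINT \<zeta>|M. \<zeta> ^ p)"
    by (rule Bochner_Integration.integral_cnj)
  finally show ?thesis by (simp add: circle_moment_def)
qed

text \<open>Closed under multiplication by \<open>\<zeta>\<close> and \<open>cnj \<zeta>\<close> because \<open>cnj \<zeta> * \<zeta> = 1\<close> on the circle. The last rule
  identifies functions that agree there, since values off the circle are irrelevant.\<close>

inductive trig_polynomial :: "(complex \<Rightarrow> complex) \<Rightarrow> bool" where
  pos: "trig_polynomial (\<lambda>\<zeta>. c * \<zeta> ^ p)"
| neg: "trig_polynomial (\<lambda>\<zeta>. c * cnj \<zeta> ^ p)"
| add: "trig_polynomial f \<Longrightarrow> trig_polynomial g \<Longrightarrow> trig_polynomial (\<lambda>\<zeta>. f \<zeta> + g \<zeta>)"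
| cong: "trig_polynomial f \<Longrightarrow> (\<And>\<zeta>. \<zeta> \<in> circle \<Longrightarrow> f \<zeta> = g \<zeta>) \<Longrightarrow> trig_polynomial g"

lemma circle_cnj_mult: "\<zeta> \<in> circle \<Longrightarrow> cnj \<zeta> * \<zeta> = 1"
  using complex_norm_square[of \<zeta>] by (simp add: mult.commute)

lemma trig_polynomial_cmult: "trig_polynomial f \<Longrightarrow> trig_polynomial (\<lambda>\<zeta>. c * f \<zeta>)"
proof (induction rule: trig_polynomial.induct)
  case (pos d p)
  show ?case by (rule trig_polynomial.cong[OF trig_polynomial.pos[of "c * d" p]]) (simp add: mult.assoc)
next
  case (neg d p)
  show ?case by (rule trig_polynomial.cong[OF trig_polynomial.neg[of "c * d" p]]) (simp add: mult.assoc)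
next
  case (add f g)
  show ?case
    by (rule trig_polynomial.cong[OF trig_polynomial.add[OF add.IH]]) (simp add: algebra_simps)
next
  case (cong f g)
  show ?case by (rule trig_polynomial.cong[OF cong.IH]) (use cong.hyps in auto)
qed

lemma trig_polynomial_shift:
  "trig_polynomial f \<Longrightarrow> trig_polynomial (\<lambda>\<zeta>. \<zeta> * f \<zeta>) \<and> trig_polynomial (\<lambda>\<zeta>. cnj \<zeta> * f \<zeta>)"
proof (induction rule: trig_polynomial.induct)
  case (pos c p)
  have 1: "trig_polynomial (\<lambda>\<zeta>. \<zeta> * (c * \<zeta> ^ p))"
    by (rule trig_polynomial.cong[OF trig_polynomial.pos[of c "Suc p"]]) simp
  have 2: "trig_polynomial (\<lambda>\<zeta>. cnj \<zeta> * (c * \<zeta> ^ p))"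
  proof (cases p)
    case 0
    then show ?thesis
      by (intro trig_polynomial.cong[OF trig_polynomial.neg[of c 1]]) simp
  next
    case (Suc q)
    show ?thesis
    proof (rule trig_polynomial.cong[OF trig_polynomial.pos[of c q]])
      fix \<zeta> assume "\<zeta> \<in> circle"
      then have "cnj \<zeta> * \<zeta> * (c * \<zeta> ^ q) = c * \<zeta> ^ q" using circle_cnj_mult by simp
      then show "c * \<zeta> ^ q = cnj \<zeta> * (c * \<zeta> ^ p)" using Suc by (simp add: algebra_simps)
    qed
  qed
  show ?case using 1 2 by blast
next
  case (neg c p)
  have 1: "trig_polynomial (\<lambda>\<zeta>. cnj \<zeta> * (c * cnj \<zeta> ^ p))"
    by (rule trig_polynomial.cong[OF trig_polynomial.neg[of c "Suc p"]]) simp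
  have 2: "trig_polynomial (\<lambda>\<zeta>. \<zeta> * (c * cnj \<zeta> ^ p))"
  proof (cases p)
    case 0
    then show ?thesis
      by (intro trig_polynomial.cong[OF trig_polynomial.pos[of c 1]]) simp
  next
    case (Suc q)
    show ?thesis
    proof (rule trig_polynomial.cong[OF trig_polynomial.neg[of c q]])
      fix \<zeta> assume "\<zeta> \<in> circle"
      then have "cnj \<zeta> * \<zeta> * (c * cnj \<zeta> ^ q) = c * cnj \<zeta> ^ q" using circle_cnj_mult by simp
      then show "c * cnj \<zeta> ^ q = \<zeta> * (c * cnj \<zeta> ^ p)" using Suc by (simp add: algebra_simps)
    qed
  qed
  show ?case using 1 2 by blast
next
  case (add f g)
  then show ?case by (simp add: distrib_left trig_polynomial.add)
next
  case (cong f g)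
  then show ?case by (auto intro: trig_polynomial.cong)
qed

text \<open>Every polynomial in \<open>Re \<zeta>\<close> and \<open>Im \<zeta>\<close> is a trigonometric polynomial on the circle. The extra factor
  \<open>f\<close> makes the statement stable under products, so that the induction goes through.\<close>

lemma trig_polynomial_mult_real_polynomial:
  fixes P :: "complex \<Rightarrow> real"
  shows "real_polynomial_function P \<Longrightarrow> trig_polynomial f \<Longrightarrow> trig_polynomial (\<lambda>\<zeta>. of_real (P \<zeta>) * f \<zeta>)"
proof (induction arbitrary: f rule: real_polynomial_function.induct)
  case (linear L)
  interpret bounded_linear L by fact
  have L: "L \<zeta> = Re \<zeta> * L 1 + Im \<zeta> * L \<i>" for \<zeta>
  proof -
    have "\<zeta> = Re \<zeta> *\<^sub>R 1 + Im \<zeta> *\<^sub>R \<i>" by (simp add: complex_eq_iff)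
    then have "L \<zeta> = L (Re \<zeta> *\<^sub>R 1 + Im \<zeta> *\<^sub>R \<i>)" by simp
    then show ?thesis by (simp only: add scaleR real_scaleR_def)
  qed
  define u where "u = of_real (L 1 / 2) - \<i> * of_real (L \<i> / 2)"
  define v where "v = of_real (L 1 / 2) + \<i> * of_real (L \<i> / 2)"
  have eq: "of_real (L \<zeta>) = u * \<zeta> + v * cnj \<zeta>" for \<zeta>
    unfolding L[of \<zeta>] u_def v_def by (simp add: complex_eq_iff algebra_simps)
  have "trig_polynomial (\<lambda>\<zeta>. u * (\<zeta> * f \<zeta>) + v * (cnj \<zeta> * f \<zeta>))"
    using trig_polynomial_shift[OF linear.prems]
    by (intro trig_polynomial.add trig_polynomial_cmult) auto
  then show ?case
    by (rule trig_polynomial.cong) (simp add: eq algebra_simps)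
next
  case (const c)
  then show ?case by (rule trig_polynomial_cmult)
next
  case (add P Q)
  then show ?case by (simp add: distrib_right trig_polynomial.add)
next
  case (mult P Q)
  then show ?case by (simp add: mult.assoc)
qed

lemma trig_polynomial_continuous: "trig_polynomial f \<Longrightarrow> continuous_on circle f"
  by (induction rule: trig_polynomial.induct)
    (auto intro!: continuous_intros intro: continuous_on_eq)

lemma trig_polynomial_integral_tendsto:
  assumes M: "\<And>n. circle_prob (M n)" and N: "circle_prob N"
    and conv: "\<And>p. (\<lambda>n. circle_moment (M n) p) \<longlonglongrightarrow> circle_moment N p"
    and f: "trig_polynomial f"
  shows "(\<lambda>n. LINT \<zeta>|M n. f \<zeta>) \<longlonglongrightarrow> (LINT \<zeta>|N. f \<zeta>)"
  using f
proof (induction rule: trig_polynomial.induct)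
  case (pos c p)
  show ?case
    using tendsto_mult_left[OF conv[of p], of c] by (simp add: circle_moment_def)
next
  case (neg c p)
  show ?case
    using tendsto_mult_left[OF tendsto_cnj[OF conv[of p]], of c]
    by (simp add: circle_integral_cnj_power M N)
next
  case (add f g)
  have int: "integrable L f" "integrable L g" if "circle_prob L" for L
    using that add.hyps by (auto intro: continuous_imp_integrable_circle trig_polynomial_continuous)
  show ?case using tendsto_add[OF add.IH] by (simp add: int M N)
next
  case (cong f g)
  have "(LINT \<zeta>|L. f \<zeta>) = (LINT \<zeta>|L. g \<zeta>)" if "circle_prob L" for L
    by (rule Bochner_Integration.integral_cong) (use that cong.hyps in \<open>auto simp: space_circle_prob\<close>)
  then show ?case using cong.IH M N by simp
qed

text \<open>By Stone--Weierstrass a continuous function on the circle is uniformly close to a polynomial in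
  \<open>Re \<zeta>\<close> and \<open>Im \<zeta>\<close>, whose integral is a finite linear combination of moments and their conjugates.\<close>

lemma weak_conv_circle_if_moments:
  assumes M: "\<And>n. circle_prob (M n)" and N: "circle_prob N"
    and conv: "\<And>p. p \<ge> 1 \<Longrightarrow> (\<lambda>n. circle_moment (M n) p) \<longlonglongrightarrow> circle_moment N p"
  shows "weak_conv_circle M N"
  unfolding weak_conv_circle_def
proof (intro allI impI)
  fix f :: "complex \<Rightarrow> real" assume f: "continuous_on circle f"
  have conv': "(\<lambda>n. circle_moment (M n) p) \<longlonglongrightarrow> circle_moment N p" for p
    using conv[of p] M N by (cases "p = 0") auto
  show "(\<lambda>n. LINT \<zeta>|M n. f \<zeta>) \<longlonglongrightarrow> (LINT \<zeta>|N. f \<zeta>)"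
  proof (rule LIMSEQ_I)
    fix e :: real assume e: "e > 0"
    obtain P where P: "real_polynomial_function P" "\<And>\<zeta>. \<zeta> \<in> circle \<Longrightarrow> \<bar>f \<zeta> - P \<zeta>\<bar> < e / 3"
      using Stone_Weierstrass_real_polynomial_function[of circle f "e / 3"] f e by auto
    have "trig_polynomial (\<lambda>\<zeta>. of_real (P \<zeta>))"
      using trig_polynomial_mult_real_polynomial[OF P(1) trig_polynomial.pos[of 1 0]] by simp
    from tendsto_Re[OF trig_polynomial_integral_tendsto[OF M N conv' this]]
    have "(\<lambda>n. LINT \<zeta>|M n. P \<zeta>) \<longlonglongrightarrow> (LINT \<zeta>|N. P \<zeta>)" by simp
    then obtain n0 where n0: "\<And>n. n \<ge> n0 \<Longrightarrow> \<bar>(LINT \<zeta>|M n. P \<zeta>) - (LINT \<zeta>|N. P \<zeta>)\<bar> < e / 3"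
      using LIMSEQ_D[of _ _ "e / 3"] e by (metis divide_pos_pos real_norm_def zero_less_numeral)
    have Pc: "continuous_on circle P"
      by (rule continuous_on_polymonial_function) (use P(1) in \<open>simp add: real_polynomial_function_eq\<close>)
    have close: "\<bar>(LINT \<zeta>|L. f \<zeta>) - (LINT \<zeta>|L. P \<zeta>)\<bar> \<le> e / 3" if L: "circle_prob L" for L
    proof -
      have "(LINT \<zeta>|L. f \<zeta>) - (LINT \<zeta>|L. P \<zeta>) = (LINT \<zeta>|L. f \<zeta> - P \<zeta>)"
        by (rule Bochner_Integration.integral_diff[symmetric])
          (use L f Pc in \<open>auto intro: continuous_imp_integrable_circle\<close>)
      also have "norm \<dots> \<le> e / 3"
        by (rule norm_integral_circle_le[OF L]) (use f Pc P(2) less_imp_le in \<open>auto intro!: continuous_intros\<close>)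
      finally show ?thesis by simp
    qed
    have "norm ((LINT \<zeta>|M n. f \<zeta>) - (LINT \<zeta>|N. f \<zeta>)) < e" if "n \<ge> n0" for n
      using n0[OF that] close[OF M[of n]] close[OF N] unfolding real_norm_def by linarith
    then show "\<exists>n0. \<forall>n\<ge>n0. norm ((LINT \<zeta>|M n. f \<zeta>) - (LINT \<zeta>|N. f \<zeta>)) < e" by blast
  qed
qed

lemma moments_tendsto_if_weak_conv_circle:
  assumes M: "\<And>n. circle_prob (M n)" and N: "circle_prob N" and conv: "weak_conv_circle M N"
  shows "(\<lambda>n. circle_moment (M n) p) \<longlonglongrightarrow> circle_moment N p"
proof -
  have int: "integrable L (\<lambda>\<zeta>. \<zeta> ^ p)" if "circle_prob L" for L
    by (rule continuous_imp_integrable_circle[OF that]) (intro continuous_intros)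
  have "(\<lambda>n. LINT \<zeta>|M n. Re (\<zeta> ^ p)) \<longlonglongrightarrow> (LINT \<zeta>|N. Re (\<zeta> ^ p))"
       "(\<lambda>n. LINT \<zeta>|M n. Im (\<zeta> ^ p)) \<longlonglongrightarrow> (LINT \<zeta>|N. Im (\<zeta> ^ p))"
    by (rule conv[unfolded weak_conv_circle_def, rule_format], intro continuous_intros)+
  then show ?thesis
    by (simp add: tendsto_complex_iff circle_moment_def int M N)
qed

text \<open>Equal moments give equal integrals of continuous functions, in particular of the functions
  \<open>max 0 (1 - n * infdist \<zeta> C)\<close>, which decrease to the indicator of a closed set \<open>C\<close>. Closed sets generate
  the Borel sets and are stable under intersection.\<close>

lemma circle_prob_eqI:
  assumes M: "circle_prob M" and N: "circle_prob N"
    and eq: "\<And>p. p \<ge> 1 \<Longrightarrow> circle_moment M p = circle_moment N p"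
  shows "M = N"
proof (rule measure_eqI_generator_eq)
  interpret M: prob_space M using M by (rule prob_space_circle_prob)
  interpret N: prob_space N using N by (rule prob_space_circle_prob)
  have int_eq: "(LINT \<zeta>|M. f \<zeta>) = (LINT \<zeta>|N. f \<zeta>)" if "continuous_on circle f" for f :: "complex \<Rightarrow> real"
  proof -
    have "weak_conv_circle (\<lambda>_. M) N"
      by (rule weak_conv_circle_if_moments) (use M N eq in auto)
    then show ?thesis using that by (simp add: weak_conv_circle_def LIMSEQ_const_iff)
  qed
  define E where "E = {C. closed C \<and> C \<subseteq> circle}"
  show "Int_stable E" by (auto simp: E_def Int_stable_def)
  show "E \<subseteq> Pow circle" by (auto simp: E_def)
  have "sets (restrict_space borel circle) = sigma_sets circle E"
  proof -
    have "sets (restrict_space borel circle) = (\<inter>) circle ` sigma_sets UNIV (Collect closed)"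
      by (simp add: sets_restrict_space borel_eq_closed)
    also have "\<dots> = sigma_sets circle ((\<inter>) circle ` Collect closed)"
      by (rule sigma_sets_Int) (auto intro: sigma_sets.Basic)
    also have "(\<inter>) circle ` Collect closed = E"
      by (auto simp: E_def intro!: image_eqI)
    finally show ?thesis .
  qed
  then show "sets M = sigma_sets circle E" "sets N = sigma_sets circle E"
    using M N by (auto simp: sets_circle_prob)
  show "range (\<lambda>_::nat. circle) \<subseteq> E" by (auto simp: E_def)
  show "(\<Union>i::nat. circle) = circle" by simp
  show "emeasure M circle \<noteq> \<infinity>" for i :: nat by simp
  fix C assume C: "C \<in> E"
  show "emeasure M C = emeasure N C"
  proof (cases "C = {}")
    case False
    define f where "f = (\<lambda>(n::nat) \<zeta>. max 0 (1 - real n * infdist \<zeta> C))"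
    have fc: "continuous_on circle (f n)" for n
      unfolding f_def by (intro continuous_intros)
    have lim: "(\<lambda>n. LINT \<zeta>|L. f n \<zeta>) \<longlonglongrightarrow> measure L C" if L: "circle_prob L" for L
    proof -
      interpret L: prob_space L using L by (rule prob_space_circle_prob)
      have CL: "C \<in> sets L" using C \<open>sets (restrict_space borel circle) = sigma_sets circle E\<close> L
        by (auto simp: sets_circle_prob)
      have "(\<lambda>n. LINT \<zeta>|L. f n \<zeta>) \<longlonglongrightarrow> (LINT \<zeta>|L. indicator C \<zeta>)"
      proof (rule integral_dominated_convergence[where w = "\<lambda>_. 1"])
        show "AE \<zeta> in L. (\<lambda>n. f n \<zeta>) \<longlonglongrightarrow> indicator C \<zeta>"
        proof (rule AE_I2)
          fix \<zeta>
          show "(\<lambda>n. f n \<zeta>) \<longlonglongrightarrow> indicator C \<zeta>"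
          proof (cases "\<zeta> \<in> C")
            case True
            then show ?thesis by (simp add: f_def)
          next
            case notin: False
            have pos: "infdist \<zeta> C > 0"
              using C False notin by (simp add: E_def infdist_pos_not_in_closed)
            obtain n0 :: nat where "1 / infdist \<zeta> C < n0" using reals_Archimedean2 by blast
            then have "1 < real n * infdist \<zeta> C" if "n \<ge> n0" for n
            proof -
              have "1 < real n0 * infdist \<zeta> C"
                using \<open>1 / infdist \<zeta> C < n0\<close> pos by (simp add: field_simps)
              also have "\<dots> \<le> real n * infdist \<zeta> C" using that pos by (intro mult_right_mono) auto
              finally show ?thesis .
            qed
            then have "\<forall>\<^sub>F n in sequentially. f n \<zeta> = 0"
              unfolding f_def eventually_sequentially by (intro exI[of _ n0]) (auto simp: less_imp_le)
            then show ?thesis using notin by (simp add: tendsto_eventually)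
          qed
        qed
      qed (use L fc CL in \<open>auto intro!: continuous_imp_measurable_circle simp: f_def infdist_nonneg\<close>)
      then show ?thesis using CL by simp
    qed
    have "measure M C = measure N C"
      using lim[OF M] lim[OF N] int_eq[OF fc] by (simp add: LIMSEQ_unique)
    then show ?thesis by (simp add: M.emeasure_eq_measure N.emeasure_eq_measure)
  qed simp
qed

section \<open>The B-transform\<close>

text \<open>Up to the factor \<open>z\<close> this is \<open>psi_transform\<close>; it has no singularity at \<open>0\<close>, and
  \<open>B_transform M z = circle_cauchy M z / (1 + z * circle_cauchy M z)\<close> on the whole disk.\<close>

definition circle_cauchy :: "complex measure \<Rightarrow> complex \<Rightarrow> complex" where
  "circle_cauchy M z = (LINT \<zeta>|M. \<zeta> / (1 - \<zeta> * z))"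

lemma norm_one_minus_mult_ge:
  assumes "\<zeta> \<in> circle"
  shows "norm (1 - \<zeta> * z) \<ge> 1 - norm z"
  using norm_triangle_ineq2[of 1 "\<zeta> * z"] assms by (simp add: norm_mult)

lemma one_minus_mult_neq_0:
  assumes "\<zeta> \<in> circle" "norm z < 1"
  shows "1 - \<zeta> * z \<noteq> 0"
  using norm_one_minus_mult_ge[OF assms(1), of z] assms(2) by auto

text \<open>Integrating the geometric series; the remainder after \<open>n\<close> terms is at most
  \<open>norm z ^ n / (1 - norm z)\<close>, uniformly on the circle.\<close>

lemma circle_cauchy_sums:
  assumes M: "circle_prob M" and z: "norm z < 1"
  shows "(\<lambda>p. circle_moment M (Suc p) * z ^ p) sums circle_cauchy M z"
proof -
  have int: "integrable M (\<lambda>\<zeta>. \<zeta> ^ Suc p * z ^ p)" for p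
    by (rule continuous_imp_integrable_circle[OF M]) (intro continuous_intros)
  have cont: "continuous_on circle (\<lambda>\<zeta>. \<zeta> * (\<zeta> * z) ^ n / (1 - \<zeta> * z))" for n
    by (intro continuous_intros ballI one_minus_mult_neq_0 z)
  have partial: "circle_cauchy M z - (\<Sum>p<n. circle_moment M (Suc p) * z ^ p)
      = (LINT \<zeta>|M. \<zeta> * (\<zeta> * z) ^ n / (1 - \<zeta> * z))" for n
  proof -
    have "(\<Sum>p<n. circle_moment M (Suc p) * z ^ p) = (LINT \<zeta>|M. (\<Sum>p<n. \<zeta> ^ Suc p * z ^ p))"
      by (simp only: circle_moment_def integral_mult_left_zero Bochner_Integration.integral_sum int)
    also have "circle_cauchy M z - \<dots> = (LINT \<zeta>|M. \<zeta> / (1 - \<zeta> * z) - (\<Sum>p<n. \<zeta> ^ Suc p * z ^ p))"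
      unfolding circle_cauchy_def
      by (rule Bochner_Integration.integral_diff[symmetric])
        (use int continuous_imp_integrable_circle[OF M cont[of 0]] in simp_all)
    also have "\<dots> = (LINT \<zeta>|M. \<zeta> * (\<zeta> * z) ^ n / (1 - \<zeta> * z))"
    proof (rule Bochner_Integration.integral_cong[OF refl])
      fix \<zeta> assume "\<zeta> \<in> space M"
      then have nz: "1 - \<zeta> * z \<noteq> 0"
        by (intro one_minus_mult_neq_0 z) (simp add: space_circle_prob[OF M])
      have "(\<Sum>p<n. \<zeta> ^ Suc p * z ^ p) = \<zeta> * (\<Sum>p<n. (\<zeta> * z) ^ p)"
        by (simp add: sum_distrib_left power_mult_distrib mult.assoc)
      also have "(\<Sum>p<n. (\<zeta> * z) ^ p) = (1 - (\<zeta> * z) ^ n) / (1 - \<zeta> * z)"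
        using nz by (simp add: sum_gp_strict)
      finally show "\<zeta> / (1 - \<zeta> * z) - (\<Sum>p<n. \<zeta> ^ Suc p * z ^ p) = \<zeta> * (\<zeta> * z) ^ n / (1 - \<zeta> * z)"
        by (simp add: field_simps diff_divide_distrib)
    qed
    finally show ?thesis .
  qed
  have bound: "norm (circle_cauchy M z - (\<Sum>p<n. circle_moment M (Suc p) * z ^ p)) \<le> norm z ^ n / (1 - norm z)" for n
    unfolding partial
  proof (rule norm_integral_circle_le[OF M cont])
    fix \<zeta> assume \<zeta>: "\<zeta> \<in> circle"
    then show "norm (\<zeta> * (\<zeta> * z) ^ n / (1 - \<zeta> * z)) \<le> norm z ^ n / (1 - norm z)"
      using norm_one_minus_mult_ge[OF \<zeta>, of z] z
      by (auto simp: norm_divide norm_mult norm_power intro!: frac_le)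
  qed
  have "(\<lambda>n. norm z ^ n / (1 - norm z)) \<longlonglongrightarrow> 0"
    using tendsto_divide[OF LIMSEQ_realpow_zero[of "norm z"] tendsto_const[of "1 - norm z"]] z by simp
  then have "(\<lambda>n. circle_cauchy M z - (\<Sum>p<n. circle_moment M (Suc p) * z ^ p)) \<longlonglongrightarrow> 0"
    by (rule Lim_null_comparison[rotated]) (use bound in auto)
  then have "(\<lambda>n. circle_cauchy M z - (circle_cauchy M z - (\<Sum>p<n. circle_moment M (Suc p) * z ^ p)))
      \<longlonglongrightarrow> circle_cauchy M z - 0"
    by (intro tendsto_intros)
  then show ?thesis by (simp add: sums_def)
qed

lemma circle_cauchy_0: "circle_cauchy M 0 = circle_moment M 1"
  by (simp add: circle_cauchy_def circle_moment_def)

lemma circle_cauchy_holomorphic: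
  assumes "circle_prob M"
  shows "circle_cauchy M holomorphic_on ball 0 1"
  by (rule power_series_holomorphic[where a = "\<lambda>p. circle_moment M (Suc p)"])
    (use circle_cauchy_sums[OF assms] in auto)

lemma circle_cauchy_has_field_derivative_0:
  assumes M: "circle_prob M"
  shows "(circle_cauchy M has_field_derivative circle_moment M 2) (at 0)"
proof -
  define c where "c = (\<lambda>p. circle_moment M (Suc p))"
  have "summable (\<lambda>n. c n * (1/2) ^ n)"
    using circle_cauchy_sums[OF M, of "1/2"] by (auto simp: c_def sums_iff norm_divide)
  from termdiffs_strong[OF this, of 0]
  have "((\<lambda>z. \<Sum>n. c n * z ^ n) has_field_derivative (\<Sum>n. diffs c n * 0 ^ n)) (at 0)"
    by (simp add: norm_divide)
  also have "(\<Sum>n. diffs c n * 0 ^ n) = circle_moment M 2"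
    by (simp add: diffs_def c_def numeral_2_eq_2)
  finally show ?thesis
    by (rule DERIV_cong_ev[THEN iffD1, rotated 3])
      (use circle_cauchy_sums[OF M] in \<open>auto simp: c_def sums_iff eventually_nhds intro!: exI[of _ "ball 0 1"]\<close>)
qed

lemma psi_transform_eq: "psi_transform M z = z * circle_cauchy M z"
  unfolding psi_transform_def circle_cauchy_def
  by (subst integral_mult_right_zero[symmetric]) (simp add: mult.commute)

lemma norm_less_norm_one_plus:
  fixes w :: complex
  assumes "Re w > -1/2"
  shows "norm w < norm (1 + w)"
proof -
  have "(norm w)\<^sup>2 < (norm (1 + w))\<^sup>2"
    using assms unfolding cmod_power2 by (simp add: power2_eq_square algebra_simps)
  then show ?thesis by (rule power2_less_imp_less) simp
qed

text \<open>Since \<open>1 / (1 - w) = 1 + w / (1 - w)\<close>, it suffices that \<open>Re (1 / (1 - w)) \<ge> 1 / (1 + norm w) > 1/2\<close> for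
  \<open>w = \<zeta> * z\<close>, with a bound that does not depend on \<open>\<zeta>\<close>.\<close>

lemma Re_psi_transform_gt:
  assumes M: "circle_prob M" and z: "norm z < 1"
  shows "Re (psi_transform M z) > -1/2"
proof -
  define b where "b = 1 / (1 + norm z) - 1"
  interpret prob_space M using M by (rule prob_space_circle_prob)
  have b: "b > -1/2" using z by (simp add: b_def field_simps add_pos_nonneg)
  have int: "integrable M (\<lambda>\<zeta>. \<zeta> * z / (1 - \<zeta> * z))"
    by (rule continuous_imp_integrable_circle[OF M]) (intro continuous_intros ballI one_minus_mult_neq_0 z)
  have "Re (psi_transform M z) = (LINT \<zeta>|M. Re (\<zeta> * z / (1 - \<zeta> * z)))"
    by (simp add: psi_transform_def int)
  moreover have "(LINT \<zeta>|M. Re (\<zeta> * z / (1 - \<zeta> * z))) \<ge> (LINT \<zeta>|M. - norm z / (1 + norm z))"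
  proof (rule integral_mono)
    fix \<zeta> assume "\<zeta> \<in> space M"
    then have \<zeta>: "\<zeta> \<in> circle" using M by (simp add: space_circle_prob)
    define w where "w = \<zeta> * z"
    have w: "norm w = norm z" using \<zeta> by (simp add: w_def norm_mult)
    have nz: "1 - w \<noteq> 0" using one_minus_mult_neq_0[OF \<zeta> z] by (simp add: w_def)
    have "1 / (1 - w) = 1 + w / (1 - w)" using nz by (simp add: field_simps)
    moreover have "Re (1 / (1 - w)) \<ge> 1 / (1 + norm w)"
    proof -
      define x where "x = Re w"
      define r where "r = norm w"
      have x: "\<bar>x\<bar> \<le> r" using abs_Re_le_cmod by (simp add: x_def r_def)
      have r: "r < 1" "r \<ge> 0" using z by (auto simp: r_def w)
      have n2: "(norm (1 - w))\<^sup>2 = 1 - 2 * x + r\<^sup>2"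
        unfolding r_def x_def cmod_power2 by (simp add: power2_eq_square algebra_simps)
      have pos: "1 - 2 * x + r\<^sup>2 > 0" using nz n2 by (metis zero_less_power2 norm_eq_zero)
      have "Re (1 / (1 - w)) = (1 - x) / (1 - 2 * x + r\<^sup>2)"
        using n2 by (simp add: Re_divide cmod_power2 x_def)
      moreover have "1 / (1 + r) \<le> (1 - x) / (1 - 2 * x + r\<^sup>2)"
      proof -
        have "(1 - x) * (1 + r) - (1 - 2 * x + r\<^sup>2) = (1 - r) * (r + x)"
          by (simp add: power2_eq_square algebra_simps)
        moreover have "(1 - r) * (r + x) \<ge> 0" using x r by (intro mult_nonneg_nonneg) auto
        ultimately have "1 - 2 * x + r\<^sup>2 \<le> (1 - x) * (1 + r)" by linarith
        then show ?thesis
          using r by (simp only: pos_le_divide_eq[OF pos] times_divide_eq_left pos_divide_le_eq mult_1 add_pos_nonneg zero_less_one)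
      qed
      ultimately show ?thesis by (simp add: r_def)
    qed
    moreover have "1 / (1 + norm z) = 1 - norm z / (1 + norm z)"
      using norm_ge_zero[of z] by (simp add: field_simps add_nonneg_eq_0_iff)
    ultimately show "- norm z / (1 + norm z) \<le> Re (\<zeta> * z / (1 - \<zeta> * z))"
      using w by (simp add: w_def)
  qed (use int in auto)
  moreover have "- norm z / (1 + norm z) > -1/2" using z by (simp add: field_simps add_pos_nonneg)
  ultimately show ?thesis by (simp add: prob_space)
qed

lemma one_plus_circle_cauchy_neq_0:
  assumes "circle_prob M" "norm z < 1"
  shows "1 + z * circle_cauchy M z \<noteq> 0"
  using norm_less_norm_one_plus[OF Re_psi_transform_gt[OF assms]] by (auto simp: psi_transform_eq)

lemma cauchy_quotient_holomorphic:
  assumes M: "circle_prob M"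
  shows "(\<lambda>z. circle_cauchy M z / (1 + z * circle_cauchy M z)) holomorphic_on ball 0 1"
  by (intro holomorphic_intros circle_cauchy_holomorphic[OF M])
    (use one_plus_circle_cauchy_neq_0[OF M] in auto)

lemma B_transform_eq:
  assumes M: "circle_prob M" and z: "norm z < 1"
  shows "B_transform M z = circle_cauchy M z / (1 + z * circle_cauchy M z)"
  unfolding B_transform_def
proof (rule remove_sings_eqI)
  let ?g = "\<lambda>z. circle_cauchy M z / (1 + z * circle_cauchy M z)"
  have "isCont ?g z"
    using holomorphic_on_imp_continuous_on[OF cauchy_quotient_holomorphic[OF M]] z
    by (simp add: continuous_on_eq_continuous_at)
  then have "?g \<midarrow>z\<rightarrow> ?g z" by (simp add: isCont_def)
  then show "(\<lambda>z. 1 / z * (psi_transform M z / (1 + psi_transform M z))) \<midarrow>z\<rightarrow> ?g z"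
  proof (rule Lim_transform_eventually)
    have "\<forall>\<^sub>F w in at z. w \<noteq> 0"
    proof (cases "z = 0")
      case True
      then show ?thesis by (simp add: eventually_at_filter)
    next
      case False
      then show ?thesis using eventually_at_in_open'[of "-{0}" z] by (auto simp: open_Compl)
    qed
    then show "\<forall>\<^sub>F w in at z. ?g w = 1 / w * (psi_transform M w / (1 + psi_transform M w))"
      by eventually_elim (simp add: psi_transform_eq)
  qed
qed

lemma B_transform_holomorphic:
  assumes M: "circle_prob M"
  shows "B_transform M holomorphic_on ball 0 1"
  by (rule holomorphic_transform[OF cauchy_quotient_holomorphic[OF M]])
    (simp add: B_transform_eq[OF M])

lemma B_transform_0:
  assumes "circle_prob M"
  shows "B_transform M 0 = circle_moment M 1"
  using B_transform_eq[OF assms, of 0] by (simp add: circle_cauchy_0)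

lemma norm_mult_B_transform_less_1:
  assumes "circle_prob M" "norm z < 1"
  shows "norm (z * B_transform M z) < 1"
  using norm_less_norm_one_plus[OF Re_psi_transform_gt[OF assms]] one_plus_circle_cauchy_neq_0[OF assms]
  by (simp add: B_transform_eq[OF assms] psi_transform_eq norm_mult norm_divide divide_simps)

text \<open>Schwarz lemma for \<open>z * B_transform M z = \<psi> / (1 + \<psi>)\<close>, which maps the disk into itself because
  \<open>Re \<psi> > -1/2\<close>.\<close>

lemma norm_B_transform_le_1:
  assumes M: "circle_prob M" and z: "norm z < 1"
  shows "norm (B_transform M z) \<le> 1"
proof (cases "z = 0")
  case True
  then show ?thesis using norm_circle_moment_le_1[OF M] by (simp add: B_transform_0[OF M])
next
  case False
  have "norm (z * B_transform M z) \<le> norm z"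
    by (rule Schwarz_Lemma(1)[of "\<lambda>z. z * B_transform M z"])
      (use z norm_mult_B_transform_less_1[OF M] in \<open>auto intro!: holomorphic_intros B_transform_holomorphic[OF M]\<close>)
  then show ?thesis using False by (simp add: norm_mult)
qed

lemma one_minus_mult_B_transform:
  assumes "circle_prob M" "norm z < 1"
  shows "(1 - z * B_transform M z) * (1 + z * circle_cauchy M z) = 1"
    and "circle_cauchy M z * (1 - z * B_transform M z) = B_transform M z"
    and "1 - z * B_transform M z \<noteq> 0"
proof -
  show "(1 - z * B_transform M z) * (1 + z * circle_cauchy M z) = 1"
    using one_plus_circle_cauchy_neq_0[OF assms] by (simp add: B_transform_eq[OF assms] field_simps)
  then show "1 - z * B_transform M z \<noteq> 0" by auto
  show "circle_cauchy M z * (1 - z * B_transform M z) = B_transform M z"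
    using one_plus_circle_cauchy_neq_0[OF assms] by (simp add: B_transform_eq[OF assms] field_simps)
qed

lemma B_transform_has_field_derivative_0:
  assumes M: "circle_prob M"
  shows "(B_transform M has_field_derivative circle_moment M 2 - (circle_moment M 1)\<^sup>2) (at 0)"
proof -
  have "((\<lambda>z. circle_cauchy M z / (1 + z * circle_cauchy M z)) has_field_derivative
      circle_moment M 2 - (circle_moment M 1)\<^sup>2) (at 0)"
    by (rule derivative_eq_intros circle_cauchy_has_field_derivative_0[OF M] refl | simp)+
      (simp add: circle_cauchy_0 power2_eq_square)
  then show ?thesis
    by (rule DERIV_cong_ev[THEN iffD1, rotated 3])
      (use B_transform_eq[OF M] in \<open>auto simp: eventually_nhds intro!: exI[of _ "ball 0 1"]\<close>)
qed

text \<open>Bounded coefficients make the contribution of all higher terms \<open>O(norm z)\<close>, uniformly in \<open>n\<close>. The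
  point \<open>0\<close> is left out of the hypotheses so that the lemma can be iterated by dividing by \<open>z\<close>.\<close>

lemma power_series_coeff_0_tendsto:
  fixes a :: "nat \<Rightarrow> nat \<Rightarrow> complex"
  assumes bound: "\<And>n p. norm (a n p) \<le> C" "\<And>p. norm (b p) \<le> C"
    and sums: "\<And>n z. 0 < norm z \<Longrightarrow> norm z < 1 \<Longrightarrow> (\<lambda>p. a n p * z ^ p) sums f n z"
      "\<And>z. 0 < norm z \<Longrightarrow> norm z < 1 \<Longrightarrow> (\<lambda>p. b p * z ^ p) sums g z"
    and lim: "\<And>z. 0 < norm z \<Longrightarrow> norm z < 1 \<Longrightarrow> (\<lambda>n. f n z) \<longlonglongrightarrow> g z"
  shows "(\<lambda>n. a n 0) \<longlonglongrightarrow> b 0"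
proof -
  have C: "C \<ge> 0" using bound(2)[of 0] norm_ge_zero order_trans by blast
  have key: "norm (a n 0 - b 0) \<le> norm (f n z - g z) + 4 * C * norm z"
    if z: "0 < norm z" "norm z < 1/2" for n z
  proof -
    have "(\<lambda>p. (a n p - b p) * z ^ p) sums (f n z - g z)"
      using sums_diff[OF sums(1)[of z n] sums(2)[of z]] z by (simp add: left_diff_distrib)
    from sums_split_initial_segment[OF this, of 1]
    have s: "(\<lambda>p. (a n (Suc p) - b (Suc p)) * z ^ Suc p) sums (f n z - g z - (a n 0 - b 0))" by simp
    have g: "(\<lambda>p. 2 * C * norm z * norm z ^ p) sums (2 * C * norm z * (1 / (1 - norm z)))"
      using z by (intro sums_mult geometric_sums) auto
    have "norm (f n z - g z - (a n 0 - b 0)) \<le> 2 * C * norm z * (1 / (1 - norm z))"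
    proof (rule norm_sums_le[OF s g])
      fix p
      have "norm (a n (Suc p) - b (Suc p)) \<le> 2 * C"
        using norm_triangle_ineq4[of "a n (Suc p)" "b (Suc p)"] bound(1)[of n "Suc p"] bound(2)[of "Suc p"] by linarith
      then have "norm (a n (Suc p) - b (Suc p)) * (norm z * norm z ^ p) \<le> 2 * C * (norm z * norm z ^ p)"
        by (intro mult_right_mono) auto
      then show "norm ((a n (Suc p) - b (Suc p)) * z ^ Suc p) \<le> 2 * C * norm z * norm z ^ p"
        by (simp add: norm_mult norm_power mult.assoc)
    qed
    also have "\<dots> \<le> 2 * C * norm z * 2"
      using z C by (intro mult_left_mono) (auto simp: field_simps)
    finally show ?thesis
      using norm_triangle_ineq4[of "f n z - g z" "f n z - g z - (a n 0 - b 0)"] by simp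
  qed
  show ?thesis
  proof (rule LIMSEQ_I)
    fix e :: real assume e: "e > 0"
    \<comment> \<open>small enough that the tail bound \<open>4 * C * norm z\<close> is at most \<open>e / 2\<close>; \<open>C + 1\<close> instead of \<open>C\<close> avoids division by zero\<close>
    define z :: complex where "z = of_real (min (1/4) (e / (8 * C + 8)))"
    have nz: "norm z = min (1/4) (e / (8 * C + 8))" using e C by (simp add: z_def)
    then have z: "0 < norm z" "norm z < 1/2" using e C by auto
    have "norm z \<le> e / (8 * C + 8)" using nz by simp
    then have "4 * C * norm z \<le> 4 * C * (e / (8 * C + 8))" using C by (intro mult_left_mono) auto
    also have "\<dots> \<le> e / 2" using C e by (simp add: field_simps)
    finally have small: "4 * C * norm z \<le> e / 2" .
    obtain n0 where n0: "\<And>n. n \<ge> n0 \<Longrightarrow> norm (f n z - g z) < e / 2"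
      using LIMSEQ_D[OF lim[of z], of "e / 2"] z e by auto
    show "\<exists>n0. \<forall>n\<ge>n0. norm (a n 0 - b 0) < e"
    proof (intro exI[of _ n0] allI impI)
      fix n assume "n \<ge> n0"
      then show "norm (a n 0 - b 0) < e" using n0[of n] key[OF z, of n] small by linarith
    qed
  qed
qed

lemma power_series_coeffs_tendsto:
  fixes a :: "nat \<Rightarrow> nat \<Rightarrow> complex"
  assumes bound: "\<And>n p. norm (a n p) \<le> C" "\<And>p. norm (b p) \<le> C"
    and sums: "\<And>n z. 0 < norm z \<Longrightarrow> norm z < 1 \<Longrightarrow> (\<lambda>p. a n p * z ^ p) sums f n z"
      "\<And>z. 0 < norm z \<Longrightarrow> norm z < 1 \<Longrightarrow> (\<lambda>p. b p * z ^ p) sums g z"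
    and lim: "\<And>z. 0 < norm z \<Longrightarrow> norm z < 1 \<Longrightarrow> (\<lambda>n. f n z) \<longlonglongrightarrow> g z"
  shows "(\<lambda>n. a n p) \<longlonglongrightarrow> b p"
  using assms
proof (induction p arbitrary: a b f g)
  case 0
  then show ?case by (rule power_series_coeff_0_tendsto)
next
  case (Suc p)
  have a0: "(\<lambda>n. a n 0) \<longlonglongrightarrow> b 0" by (rule power_series_coeff_0_tendsto[OF Suc.prems])
  have shift: "(\<lambda>p. c (Suc p) * z ^ p) sums ((s - c 0) / z)"
    if "(\<lambda>p. c p * z ^ p) sums s" "z \<noteq> 0" for c :: "nat \<Rightarrow> complex" and s z
  proof -
    have "(\<lambda>p. c (Suc p) * z ^ Suc p) sums (s - c 0)"
      using sums_split_initial_segment[OF that(1), of 1] by simp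
    from sums_divide[OF this, of z] show ?thesis using that(2) by (simp add: field_simps)
  qed
  show ?case
  proof (rule Suc.IH[of "\<lambda>n p. a n (Suc p)" "\<lambda>p. b (Suc p)"
        "\<lambda>n z. (f n z - a n 0) / z" "\<lambda>z. (g z - b 0) / z"])
    fix z :: complex assume z: "0 < norm z" "norm z < 1"
    show "(\<lambda>p. a n (Suc p) * z ^ p) sums ((f n z - a n 0) / z)" for n
      using shift[OF Suc.prems(3)[OF z]] z by auto
    show "(\<lambda>p. b (Suc p) * z ^ p) sums ((g z - b 0) / z)"
      using shift[OF Suc.prems(4)[OF z]] z by auto
    show "(\<lambda>n. (f n z - a n 0) / z) \<longlonglongrightarrow> (g z - b 0) / z"
      using Suc.prems(5)[OF z] a0 z by (intro tendsto_intros) auto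
  qed (use Suc.prems(1,2) in auto)
qed

text \<open>The B-transform determines \<open>circle_cauchy\<close> continuously, and its Taylor coefficients are the moments.\<close>

lemma weak_conv_circle_if_B_transforms:
  assumes M: "\<And>n. circle_prob (M n)" and N: "circle_prob N"
    and conv: "\<And>z. norm z < 1 \<Longrightarrow> (\<lambda>n. B_transform (M n) z) \<longlonglongrightarrow> B_transform N z"
  shows "weak_conv_circle M N"
proof (rule weak_conv_circle_if_moments[OF M N])
  fix p :: nat assume "p \<ge> 1"
  then obtain q where q: "p = Suc q" by (cases p) auto
  show "(\<lambda>n. circle_moment (M n) p) \<longlonglongrightarrow> circle_moment N p"
    unfolding q
  proof (rule power_series_coeffs_tendsto[where C = 1 and a = "\<lambda>n p. circle_moment (M n) (Suc p)"
        and b = "\<lambda>p. circle_moment N (Suc p)"])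
    fix z :: complex assume z: "norm z < 1"
    have eq: "circle_cauchy L z = B_transform L z / (1 - z * B_transform L z)" if "circle_prob L" for L
      using one_minus_mult_B_transform(2,3)[OF that z] by (simp add: field_simps)
    show "(\<lambda>n. circle_cauchy (M n) z) \<longlonglongrightarrow> circle_cauchy N z"
      unfolding eq[OF M] eq[OF N]
      by (intro tendsto_intros conv z one_minus_mult_B_transform(3)[OF N z])
  qed (use M N circle_cauchy_sums norm_circle_moment_le_1 in auto)
qed

lemma circle_prob_eqI_B_transform:
  assumes M: "circle_prob M" and N: "circle_prob N"
    and eq: "\<And>z. norm z < 1 \<Longrightarrow> B_transform M z = B_transform N z"
  shows "M = N"
proof (rule circle_prob_eqI[OF M N])
  fix p
  have "weak_conv_circle (\<lambda>_. M) N"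
    by (rule weak_conv_circle_if_B_transforms) (use M N eq in auto)
  from moments_tendsto_if_weak_conv_circle[OF M N this, of p]
  show "circle_moment M p = circle_moment N p" by (simp add: LIMSEQ_const_iff)
qed

section \<open>Functions on the disk as B-transforms\<close>

lemma circlepath_0_eq: "circlepath 0 r = (\<lambda>t. of_real r * cis (2 * pi * t))"
  by (simp add: circlepath cis_conv_exp mult_ac fun_eq_iff)

lemma has_contour_integral_circlepath_0_iff:
  "(f has_contour_integral I) (circlepath 0 r) \<longleftrightarrow>
   ((\<lambda>t. f (of_real r * cis (2 * pi * t)) * (2 * pi * \<i> * (of_real r * cis (2 * pi * t)))) has_integral I) {0..1}"
proof -
  have "f (circlepath 0 r t) * vector_derivative (circlepath 0 r) (at t within {0..1})
      = f (of_real r * cis (2 * pi * t)) * (2 * pi * \<i> * (of_real r * cis (2 * pi * t)))"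
    if "t \<in> {0..1}" for t
  proof -
    have "vector_derivative (circlepath 0 r) (at t within {0..1}) = 2 * pi * \<i> * r * exp (2 * pi * \<i> * t)"
      using that by (subst vector_derivative_circlepath01) auto
    then show ?thesis by (simp add: circlepath_0_eq cis_conv_exp mult_ac)
  qed
  then show ?thesis
    unfolding has_contour_integral_def by (intro has_integral_cong) auto
qed

text \<open>\<open>2 * Re H = H + cnj H\<close>: the first summand contributes the Taylor coefficient by the integral formula
  for derivatives, the second one contributes only to the mean, by Cauchy's theorem.\<close>

lemma fourier_coefficient_Re_holomorphic:
  fixes H :: "complex \<Rightarrow> complex"
  assumes H: "H holomorphic_on ball 0 1" and r: "0 < r" "r < 1"
  shows "((\<lambda>t. of_real (2 * Re (H (of_real r * cis (2 * pi * t)))) * cis (- (2 * pi * t)) ^ p) has_integral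
      (if p = 0 then of_real (2 * Re (H 0)) else of_real r ^ p * ((deriv ^^ p) H 0 / fact p))) {0..1}"
proof -
  define g where "g = (\<lambda>t. of_real r * cis (2 * pi * t))"
  have g0: "g t \<noteq> 0" for t using r by (simp add: g_def)
  have gp: "cis (- (2 * pi * t)) ^ p = of_real r ^ p / g t ^ p" for t
  proof -
    have "cis (- (2 * pi * t)) ^ p * cis (2 * pi * t) ^ p = 1"
      by (simp add: power_mult_distrib[symmetric] cis_mult)
    then show ?thesis using r by (simp add: g_def power_mult_distrib field_simps)
  qed
  have cball: "cball 0 r \<subseteq> ball (0::complex) 1" using r by auto
  have cont: "continuous_on (cball 0 r) H"
    using holomorphic_on_imp_continuous_on[OF H] continuous_on_subset cball by blast
  define K :: complex where "K = 2 * pi * \<i>"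
  have K: "K \<noteq> 0" by (simp add: K_def)
  have "((\<lambda>u. H u / (u - 0) ^ Suc p) has_contour_integral (K / fact p * (deriv ^^ p) H 0)) (circlepath 0 r)"
    unfolding K_def by (rule Cauchy_has_contour_integral_higher_derivative_circlepath[OF cont])
      (use H r in \<open>auto intro: holomorphic_on_subset\<close>)
  then have "((\<lambda>t. H (g t) / g t ^ Suc p * (K * g t)) has_integral (K / fact p * (deriv ^^ p) H 0)) {0..1}"
    unfolding has_contour_integral_circlepath_0_iff by (simp add: g_def K_def)
  from has_integral_mult_right[OF this, of "of_real r ^ p / K"]
  have 1: "((\<lambda>t. H (g t) * cis (- (2 * pi * t)) ^ p) has_integral of_real r ^ p * ((deriv ^^ p) H 0 / fact p)) {0..1}"
    by (rule has_integral_eq_rhs[OF has_integral_eq[rotated]]) (simp_all add: gp g0 K)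
  have 2: "((\<lambda>t. H (g t) * cis (2 * pi * t) ^ p) has_integral (if p = 0 then H 0 else 0)) {0..1}"
  proof (cases p)
    case 0
    then show ?thesis using 1 by simp
  next
    case (Suc q)
    have "((\<lambda>u. H u * u ^ q) has_contour_integral 0) (circlepath 0 r)"
      by (rule Cauchy_theorem_disc_simple[of _ 0 1]) (use H r in \<open>auto intro!: holomorphic_intros\<close>)
    then have "((\<lambda>t. H (g t) * g t ^ q * (K * g t)) has_integral 0) {0..1}"
      unfolding has_contour_integral_circlepath_0_iff by (simp add: g_def K_def)
    from has_integral_mult_right[OF this, of "1 / (of_real r ^ p * K)"] show ?thesis
      by (rule has_integral_eq_rhs[OF has_integral_eq[rotated]])
        (use r K in \<open>simp_all add: g_def Suc power_mult_distrib\<close>)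
  qed
  have 3: "((\<lambda>t. cnj (H (g t)) * cis (- (2 * pi * t)) ^ p) has_integral (if p = 0 then cnj (H 0) else 0)) {0..1}"
    using has_integral_cnj[THEN iffD2, OF 2] by (cases "p = 0") (simp_all add: o_def cis_cnj)
  have "((\<lambda>t. of_real (2 * Re (H (g t))) * cis (- (2 * pi * t)) ^ p) has_integral
      (of_real r ^ p * ((deriv ^^ p) H 0 / fact p) + (if p = 0 then cnj (H 0) else 0))) {0..1}"
    using has_integral_add[OF 1 3]
    by (simp add: complex_add_cnj distrib_right[symmetric] del: of_real_mult)
  then show ?thesis
    by (cases "p = 0") (simp_all add: g_def complex_add_cnj del: of_real_mult)
qed

text \<open>The measure has density \<open>Re (H (r * cis (2 * pi * t)))\<close> on \<open>[0, 1]\<close>; its total mass is \<open>Re (H 0)\<close>. The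
  probability of \<open>{-1<..1}\<close> is what the tightness criterion asks for.\<close>

lemma ex_poisson_measure:
  fixes H :: "complex \<Rightarrow> complex"
  assumes H: "H holomorphic_on ball 0 1" and H0: "H 0 = 1"
    and pos: "\<And>z. norm z < 1 \<Longrightarrow> Re (H z) \<ge> 0" and r: "0 < r" "r < 1"
  obtains M :: "real measure" where "real_distribution M" "measure M {-1<..1} = 1"
    "\<And>p. p \<ge> 1 \<Longrightarrow> (LINT t|M. cis (- (2 * pi * t)) ^ p) = of_real r ^ p * ((deriv ^^ p) H 0 / fact p) / 2"
proof -
  define u where "u = (\<lambda>t. Re (H (of_real r * cis (2 * pi * t))))"
  have in_ball: "norm (of_real r * cis t) < 1" for t using r by (simp add: norm_mult)
  have u_nonneg: "u t \<ge> 0" for t unfolding u_def by (rule pos[OF in_ball])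
  have u_cont: "continuous_on A u" for A
  proof -
    have "continuous_on A (\<lambda>t. H (of_real r * cis (2 * pi * t)))"
      by (rule continuous_on_compose2[OF holomorphic_on_imp_continuous_on[OF H]])
        (use in_ball in \<open>auto intro!: continuous_intros simp: norm_mult\<close>)
    then show ?thesis unfolding u_def by (intro continuous_intros)
  qed
  define d where "d = (\<lambda>t. indicator {0..1} t * u t)"
  have d_nonneg: "d t \<ge> 0" for t using u_nonneg by (simp add: d_def)
  have [measurable]: "u \<in> borel_measurable borel" by (rule borel_measurable_continuous_onI[OF u_cont])
  have [measurable]: "d \<in> borel_measurable borel" unfolding d_def by measurable
  define M where "M = density lborel (\<lambda>t. ennreal (d t))"
  have integral: "(LINT t|M. cis (- (2 * pi * t)) ^ p)
      = (if p = 0 then 1 else of_real r ^ p * ((deriv ^^ p) H 0 / fact p) / 2)" for p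
  proof -
    have m: "(\<lambda>t. cis (- (2 * pi * t)) ^ p) \<in> borel_measurable lborel"
    proof -
      have "(\<lambda>t. cis (- (2 * pi * t)) ^ p) \<in> borel_measurable borel"
        by (rule borel_measurable_continuous_onI) (intro continuous_intros)
      then show ?thesis by simp
    qed
    have "(LINT t|M. cis (- (2 * pi * t)) ^ p) = (LINT t|lborel. d t *\<^sub>R cis (- (2 * pi * t)) ^ p)"
      unfolding M_def by (rule integral_density) (use m d_nonneg in auto)
    also have "\<dots> = (LINT t:{0..1}|lborel. u t *\<^sub>R cis (- (2 * pi * t)) ^ p)"
      by (simp add: set_lebesgue_integral_def d_def)
    also have "\<dots> = integral {0..1} (\<lambda>t. u t *\<^sub>R cis (- (2 * pi * t)) ^ p)"
      by (rule set_borel_integral_eq_integral(2), rule borel_integrable_atLeastAtMost')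
        (intro continuous_intros u_cont)
    also have "\<dots> = (if p = 0 then 1 else of_real r ^ p * ((deriv ^^ p) H 0 / fact p) / 2)"
    proof (rule integral_unique)
      have "((\<lambda>t. of_real (2 * u t) * cis (- (2 * pi * t)) ^ p) has_integral
          (if p = 0 then 2 else of_real r ^ p * ((deriv ^^ p) H 0 / fact p))) {0..1}"
        using fourier_coefficient_Re_holomorphic[OF H r, of p] by (simp add: u_def H0 cong: if_cong)
      from has_integral_divide[OF this, of 2]
      show "((\<lambda>t. u t *\<^sub>R cis (- (2 * pi * t)) ^ p) has_integral
          (if p = 0 then 1 else of_real r ^ p * ((deriv ^^ p) H 0 / fact p) / 2)) {0..1}"
        by (rule has_integral_eq_rhs[OF has_integral_eq[rotated]]) (simp_all add: scaleR_conv_of_real)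
    qed
    finally show ?thesis .
  qed
  have d_int: "integrable lborel d"
    using borel_integrable_atLeastAtMost'[OF u_cont, of 0 1] by (simp add: d_def set_integrable_def)
  have "(LINT t|M. (1::complex)) = 1" using integral[of 0] by simp
  moreover have "(LINT t|M. (1::complex)) = of_real (LINT t|lborel. d t)"
  proof -
    have "(LINT t|M. (1::complex)) = (LINT t|lborel. d t *\<^sub>R 1)"
      unfolding M_def by (rule integral_density) (use d_nonneg in auto)
    also have "\<dots> = of_real (LINT t|lborel. d t)" by (simp add: scaleR_conv_of_real)
    finally show ?thesis .
  qed
  ultimately have d1: "(LINT t|lborel. d t) = 1" by (metis of_real_eq_1_iff)
  have em: "emeasure M A = 1" if "{0..1} \<subseteq> A" "A \<in> sets borel" for A
  proof -
    have "emeasure M A = (\<integral>\<^sup>+t. ennreal (d t) * indicator A t \<partial>lborel)"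
      unfolding M_def using that by (simp add: emeasure_density)
    also have "\<dots> = (\<integral>\<^sup>+t. ennreal (d t) \<partial>lborel)"
      by (rule nn_integral_cong) (use that in \<open>auto simp: d_def indicator_def\<close>)
    also have "\<dots> = ennreal (LINT t|lborel. d t)"
      by (rule nn_integral_eq_integral[OF d_int]) (simp add: d_nonneg)
    finally show ?thesis by (simp add: d1)
  qed
  have "prob_space M"
    by (rule prob_spaceI) (use em[of UNIV] in \<open>simp add: M_def\<close>)
  then have "real_distribution M"
    by (simp add: real_distribution_def real_distribution_axioms_def M_def)
  moreover have "measure M {-1<..1} = 1" using em[of "{-1<..1}"] by (simp add: measure_def atLeastAtMost_def greaterThanAtMost_def subset_iff)
  ultimately show ?thesis using that integral by auto
qed

text \<open>Herglotz' theorem in terms of moments: the density measures for radii \<open>r\<close> tending to \<open>1\<close> live on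
  \<open>[0, 1]\<close>, so Helly's selection theorem gives a weak limit, which is then wrapped around the circle.\<close>

lemma Herglotz_moments:
  fixes H :: "complex \<Rightarrow> complex"
  assumes H: "H holomorphic_on ball 0 1" and H0: "H 0 = 1"
    and pos: "\<And>z. norm z < 1 \<Longrightarrow> Re (H z) \<ge> 0"
  obtains P where "circle_prob P" "\<And>p. p \<ge> 1 \<Longrightarrow> circle_moment P p = (deriv ^^ p) H 0 / fact p / 2"
proof -
  define r :: "nat \<Rightarrow> real" where "r n = 1 - 1 / (real n + 2)" for n
  have r: "0 < r n" "r n < 1" for n by (auto simp: r_def)
  have r_lim: "r \<longlonglongrightarrow> 1" unfolding r_def by real_asymp
  have "\<exists>M. real_distribution M \<and> measure M {-1<..1} = 1 \<and>
    (\<forall>p\<ge>1. (LINT t|M. cis (- (2 * pi * t)) ^ p) = of_real (r n) ^ p * ((deriv ^^ p) H 0 / fact p) / 2)" for n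
    using ex_poisson_measure[OF H H0 pos r[of n]] by metis
  then obtain M where M: "\<And>n. real_distribution (M n)" "\<And>n. measure (M n) {-1<..1} = 1"
    "\<And>n p. p \<ge> 1 \<Longrightarrow> (LINT t|M n. cis (- (2 * pi * t)) ^ p) = of_real (r n) ^ p * ((deriv ^^ p) H 0 / fact p) / 2"
    by metis
  have "tight M"
    unfolding tight_def
  proof (intro conjI allI impI M(1))
    fix \<epsilon> :: real assume "\<epsilon> > 0"
    then show "\<exists>a b. a < b \<and> (\<forall>n. 1 - \<epsilon> < measure (M n) {a<..b})"
      by (intro exI[of _ "-1"] exI[of _ 1]) (simp add: M(2))
  qed
  from tight_imp_convergent_subsubsequence[OF this strict_mono_id]
  obtain s L where s: "strict_mono s" and L: "real_distribution L" and "weak_conv_m (M \<circ> id \<circ> s) L"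
    by blast
  then have conv: "weak_conv_m (M \<circ> s) L" by simp
  interpret L: real_distribution L by fact
  define P where "P = distr L circle_borel (\<lambda>t. cis (- (2 * pi * t)))"
  have meas: "(\<lambda>t. cis (- (2 * pi * t))) \<in> measurable L circle_borel"
    unfolding circle_borel_def
    by (intro measurable_restrict_space2)
      (auto intro!: borel_measurable_continuous_onI continuous_intros cong: measurable_cong_sets simp: L.events_eq_borel)
  have "circle_prob P"
    unfolding circle_prob_def P_def using L.prob_space_distr[OF meas] by simp
  moreover have "circle_moment P p = (deriv ^^ p) H 0 / fact p / 2" if p: "p \<ge> 1" for p
  proof -
    have cont: "continuous_on UNIV (\<lambda>t. cis (- (2 * pi * t)) ^ p)" by (intro continuous_intros)
    have eq: "circle_moment P p = (LINT t|L. cis (- (2 * pi * t)) ^ p)"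
      unfolding circle_moment_def P_def
      by (rule integral_distr[OF meas]) (intro continuous_imp_measurable_circle_borel continuous_intros)
    have lim: "(\<lambda>n. LINT t|(M \<circ> s) n. cis (- (2 * pi * t)) ^ p) \<longlonglongrightarrow> (LINT t|L. cis (- (2 * pi * t)) ^ p)"
      by (rule weak_conv_imp_integral_bdd_continuous_conv[OF _ L conv, where B = 1])
        (use M(1) cont in \<open>auto simp: norm_power continuous_on_eq_continuous_at\<close>)
    have lim':  "(\<lambda>n. LINT t|(M \<circ> s) n. cis (- (2 * pi * t)) ^ p)
        \<longlonglongrightarrow> of_real 1 ^ p * ((deriv ^^ p) H 0 / fact p) / 2"
      unfolding o_def M(3)[OF p]
      by (intro tendsto_intros LIMSEQ_subseq_LIMSEQ[OF r_lim s, unfolded o_def]) simp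
    show ?thesis unfolding eq using LIMSEQ_unique[OF lim lim'] by simp
  qed
  ultimately show ?thesis by (rule that)
qed

text \<open>The Cayley transform turns \<open>z * f z\<close>, which maps the disk into itself, into a function
  \<open>H = (1 + z * f z) / (1 - z * f z)\<close> with non-negative real part and \<open>H 0 = 1\<close>. For the measure that represents \<open>H\<close>
  one has \<open>H = 1 + 2 * psi_transform P\<close>, and this is solved for \<open>f\<close>.\<close>

lemma ex_circle_prob_B_transform:
  assumes f: "f holomorphic_on ball 0 1" and le: "\<And>z. norm z < 1 \<Longrightarrow> norm (f z) \<le> 1"
  obtains P where "circle_prob P" "\<And>z. norm z < 1 \<Longrightarrow> B_transform P z = f z"
proof -
  define H where "H = (\<lambda>z. (1 + z * f z) / (1 - z * f z))"
  have less: "norm (z * f z) < 1" if "norm z < 1" for z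
    using mult_left_le[OF le[OF that] norm_ge_zero[of z]] that by (simp add: norm_mult)
  then have nz: "1 - z * f z \<noteq> 0" if "norm z < 1" for z using that by fastforce
  have H: "H holomorphic_on ball 0 1"
    unfolding H_def by (intro holomorphic_intros f) (use nz in auto)
  have pos: "Re (H z) \<ge> 0" if z: "norm z < 1" for z
  proof -
    define w where "w = z * f z"
    have "(Re w)\<^sup>2 + (Im w)\<^sup>2 \<le> 1"
      using less[OF z] by (simp add: w_def[symmetric] cmod_def real_sqrt_less_iff)
    then have "0 \<le> (1 + Re w) * (1 - Re w) - Im w * Im w"
      by (simp add: power2_eq_square algebra_simps)
    then show ?thesis unfolding H_def w_def[symmetric] by (simp add: Re_divide)
  qed
  obtain P where P: "circle_prob P" and mom: "\<And>p. p \<ge> 1 \<Longrightarrow> circle_moment P p = (deriv ^^ p) H 0 / fact p / 2"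
    using Herglotz_moments[OF H _ pos] by (auto simp: H_def)
  have H_eq: "H z = 1 + 2 * (z * circle_cauchy P z)" if z: "norm z < 1" for z
  proof -
    have "(\<lambda>n. (deriv ^^ n) H 0 / fact n * (z - 0) ^ n) sums H z"
      by (rule holomorphic_power_series[OF H]) (use z in simp)
    from sums_split_initial_segment[OF this, of 1]
    have "(\<lambda>n. (deriv ^^ Suc n) H 0 / fact (Suc n) * z ^ Suc n) sums (H z - 1)"
      by (simp add: H_def del: funpow.simps fact_Suc)
    moreover have "(\<lambda>n. 2 * z * (circle_moment P (Suc n) * z ^ n)) sums (2 * z * circle_cauchy P z)"
      by (intro sums_mult circle_cauchy_sums P z)
    moreover have "2 * z * (circle_moment P (Suc n) * z ^ n) = (deriv ^^ Suc n) H 0 / fact (Suc n) * z ^ Suc n" for n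
      by (subst mom) (simp_all del: funpow.simps fact_Suc)
    ultimately have "H z - 1 = 2 * z * circle_cauchy P z" by (simp only: sums_unique2)
    then show ?thesis by (simp add: algebra_simps)
  qed
  have eq: "B_transform P z = f z" if z: "norm z < 1" "z \<noteq> 0" for z
  proof -
    have c: "z * circle_cauchy P z = z * f z / (1 - z * f z)"
    proof -
      have "2 * (z * circle_cauchy P z) = H z - 1" using H_eq[OF z(1)] by simp
      also have "\<dots> = 2 * (z * f z / (1 - z * f z))" unfolding H_def using nz[OF z(1)] by (simp add: field_simps)
      finally show ?thesis by (metis mult_cancel_left zero_neq_numeral)
    qed
    have "z * B_transform P z = z * circle_cauchy P z / (1 + z * circle_cauchy P z)"
      by (simp add: B_transform_eq[OF P z(1)])
    also have "\<dots> = z * f z" unfolding c using nz[OF z(1)] by (simp add: field_simps)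
    finally show ?thesis using z by simp
  qed
  have "B_transform P 0 = f 0"
  proof (rule tendsto_unique[of "at (0::complex)"])
    have cont: "isCont g 0" if "g holomorphic_on ball 0 1" for g :: "complex \<Rightarrow> complex"
      using holomorphic_on_imp_continuous_on[OF that] by (simp add: continuous_on_eq_continuous_at)
    show "f \<midarrow>0\<rightarrow> f 0" using cont[OF f] by (simp add: isCont_def)
    have "B_transform P \<midarrow>0\<rightarrow> B_transform P 0"
      using cont[OF B_transform_holomorphic[OF P]] by (simp add: isCont_def)
    then show "f \<midarrow>0\<rightarrow> B_transform P 0"
      by (rule Lim_transform_within_open[of _ _ _ _ "ball 0 1"]) (use eq in auto)
  qed simp
  with eq have "B_transform P z = f z" if "norm z < 1" for z using that by (cases "z = 0") auto
  then show ?thesis using P that by blast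
qed

section \<open>Boolean convolution and boolean Gaussian laws\<close>

text \<open>This is what makes the description operator in \<open>boolean_conv\<close> meaningful.\<close>

lemma boolean_conv_unique:
  assumes M: "circle_prob M" and N: "circle_prob N"
  shows "\<exists>!P. circle_prob P \<and> (\<forall>z\<in>ball 0 1. B_transform P z = B_transform M z * B_transform N z)"
proof -
  obtain P where "circle_prob P" "\<And>z. norm z < 1 \<Longrightarrow> B_transform P z = B_transform M z * B_transform N z"
  proof (rule ex_circle_prob_B_transform[of "\<lambda>z. B_transform M z * B_transform N z"])
    show "norm (B_transform M z * B_transform N z) \<le> 1" if "norm z < 1" for z
      using norm_B_transform_le_1[OF M that] norm_B_transform_le_1[OF N that]
      by (simp add: norm_mult mult_le_one)
  qed (intro holomorphic_intros B_transform_holomorphic M N, blast)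
  then show ?thesis by (auto intro: circle_prob_eqI_B_transform)
qed

lemma
  assumes M: "circle_prob M" and N: "circle_prob N"
  shows circle_prob_boolean_conv: "circle_prob (boolean_conv M N)"
    and B_transform_boolean_conv:
      "norm z < 1 \<Longrightarrow> B_transform (boolean_conv M N) z = B_transform M z * B_transform N z"
  using theI'[OF boolean_conv_unique[OF M N]] unfolding boolean_conv_def by auto

lemma
  assumes l: "l \<in> circle"
  shows circle_prob_point_mass: "circle_prob (point_mass l)"
    and circle_moment_point_mass: "circle_moment (point_mass l) p = l ^ p"
    and B_transform_point_mass: "norm z < 1 \<Longrightarrow> B_transform (point_mass l) z = l"
proof -
  have int: "(LINT \<zeta>|point_mass l. f \<zeta>) = f l" if "continuous_on circle f" for f :: "complex \<Rightarrow> complex"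
    unfolding point_mass_def
    by (rule integral_return) (use l that in \<open>auto intro: continuous_imp_measurable_circle_borel\<close>)
  show prob: "circle_prob (point_mass l)"
    unfolding circle_prob_def point_mass_def using l by (auto intro: prob_space_return)
  show "circle_moment (point_mass l) p = l ^ p"
    unfolding circle_moment_def by (rule int) (intro continuous_intros)
  assume z: "norm z < 1"
  have nz: "1 - l * z \<noteq> 0" by (rule one_minus_mult_neq_0[OF l z])
  have c: "circle_cauchy (point_mass l) z = l / (1 - l * z)"
    unfolding circle_cauchy_def by (rule int) (intro continuous_intros ballI one_minus_mult_neq_0 z)
  have "1 + z * (l / (1 - l * z)) = 1 / (1 - l * z)" using nz by (simp add: field_simps)
  then show "B_transform (point_mass l) z = l"
    using nz by (simp add: B_transform_eq[OF prob z] c)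
qed

lemma row_conv_0: "row_conv cnv l M 0 = point_mass l"
  by (simp add: row_conv_def)

lemma row_conv_Suc: "row_conv cnv l M (Suc k) = cnv (row_conv cnv l M k) (M (Suc k))"
  by (simp add: row_conv_def)

lemma
  assumes "\<And>j. 1 \<le> j \<Longrightarrow> j \<le> k \<Longrightarrow> circle_prob (M j)" and l: "l \<in> circle"
  shows circle_prob_row_boolean_conv: "circle_prob (row_conv boolean_conv l M k)"
    and B_transform_row_boolean_conv: "norm z < 1 \<Longrightarrow>
      B_transform (row_conv boolean_conv l M k) z = l * (\<Prod>j=1..k. B_transform (M j) z)"
proof -
  have "circle_prob (row_conv boolean_conv l M k) \<and>
    (norm z < 1 \<longrightarrow> B_transform (row_conv boolean_conv l M k) z = l * (\<Prod>j=1..k. B_transform (M j) z))"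
    using assms(1)
  proof (induction k)
    case 0
    then show ?case using l by (simp add: row_conv_0 circle_prob_point_mass B_transform_point_mass)
  next
    case (Suc k)
    then have "circle_prob (M (Suc k))" by simp
    then show ?case
      using Suc by (simp add: row_conv_Suc circle_prob_boolean_conv B_transform_boolean_conv mult.assoc)
  qed
  then show "circle_prob (row_conv boolean_conv l M k)"
    "norm z < 1 \<Longrightarrow> B_transform (row_conv boolean_conv l M k) z = l * (\<Prod>j=1..k. B_transform (M j) z)"
    by auto
qed

text \<open>Logarithmic derivative of the B-transform at \<open>0\<close>; it is additive because B-transforms multiply under
  boolean convolution.\<close>

definition B_log_derivative :: "complex measure \<Rightarrow> complex" where
  "B_log_derivative M = (circle_moment M 2 - (circle_moment M 1)\<^sup>2) / circle_moment M 1"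

lemma
  assumes M: "circle_prob M" and N: "circle_prob N"
  shows circle_moment_1_boolean_conv:
      "circle_moment (boolean_conv M N) 1 = circle_moment M 1 * circle_moment N 1"
    and B_log_derivative_boolean_conv:
      "circle_moment M 1 \<noteq> 0 \<Longrightarrow> circle_moment N 1 \<noteq> 0 \<Longrightarrow>
       B_log_derivative (boolean_conv M N) = B_log_derivative M + B_log_derivative N"
proof -
  let ?P = "boolean_conv M N"
  let ?v = "\<lambda>M. circle_moment M 2 - (circle_moment M 1)\<^sup>2"
  note P = circle_prob_boolean_conv[OF M N]
  show m1: "circle_moment ?P 1 = circle_moment M 1 * circle_moment N 1"
    using B_transform_boolean_conv[OF M N, of 0] by (simp add: B_transform_0 M N P)
  have "((\<lambda>z. B_transform M z * B_transform N z) has_field_derivative ?v ?P) (at 0)"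
    by (rule DERIV_cong_ev[THEN iffD1, OF _ _ _ B_transform_has_field_derivative_0[OF P]])
      (use B_transform_boolean_conv[OF M N] in \<open>auto simp: eventually_nhds intro!: exI[of _ "ball 0 1"]\<close>)
  moreover have "((\<lambda>z. B_transform M z * B_transform N z) has_field_derivative
      ?v M * circle_moment N 1 + ?v N * circle_moment M 1) (at 0)"
    using DERIV_mult[OF B_transform_has_field_derivative_0[OF M] B_transform_has_field_derivative_0[OF N]]
    by (simp add: B_transform_0 M N)
  ultimately have v: "?v ?P = ?v M * circle_moment N 1 + ?v N * circle_moment M 1"
    by (rule DERIV_unique)
  assume "circle_moment M 1 \<noteq> 0" "circle_moment N 1 \<noteq> 0"
  then show "B_log_derivative ?P = B_log_derivative M + B_log_derivative N"
    unfolding B_log_derivative_def v unfolding m1 by (simp add: add_divide_distrib)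
qed

lemma
  assumes "\<And>j. 1 \<le> j \<Longrightarrow> j \<le> k \<Longrightarrow> circle_prob (M j)" and l: "l \<in> circle"
    and "\<And>j. 1 \<le> j \<Longrightarrow> j \<le> k \<Longrightarrow> circle_moment (M j) 1 \<noteq> 0"
  shows circle_moment_1_row_boolean_conv:
      "circle_moment (row_conv boolean_conv l M k) 1 = l * (\<Prod>j=1..k. circle_moment (M j) 1)"
    and B_log_derivative_row_boolean_conv:
      "B_log_derivative (row_conv boolean_conv l M k) = (\<Sum>j=1..k. B_log_derivative (M j))"
proof -
  have nz: "l \<noteq> 0" using l by auto
  have "circle_moment (row_conv boolean_conv l M k) 1 = l * (\<Prod>j=1..k. circle_moment (M j) 1) \<and>
      B_log_derivative (row_conv boolean_conv l M k) = (\<Sum>j=1..k. B_log_derivative (M j))"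
    using assms(1,3)
  proof (induction k)
    case 0
    then show ?case using l by (simp add: row_conv_0 circle_moment_point_mass B_log_derivative_def)
  next
    case (Suc k)
    have IH: "circle_moment (row_conv boolean_conv l M k) 1 = l * (\<Prod>j=1..k. circle_moment (M j) 1)"
      "B_log_derivative (row_conv boolean_conv l M k) = (\<Sum>j=1..k. B_log_derivative (M j))"
      using Suc by auto
    have 1: "circle_prob (row_conv boolean_conv l M k)"
      using Suc.prems l by (intro circle_prob_row_boolean_conv) auto
    have 2: "circle_moment (row_conv boolean_conv l M k) 1 \<noteq> 0"
      unfolding IH using nz Suc.prems(2) by (auto simp: prod_zero_iff)
    show ?case
      using Suc.prems(1)[of "Suc k"] Suc.prems(2)[of "Suc k"] 1 2 IH
      by (simp add: row_conv_Suc circle_moment_1_boolean_conv B_log_derivative_boolean_conv del: One_nat_def)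
  qed
  then show "circle_moment (row_conv boolean_conv l M k) 1 = l * (\<Prod>j=1..k. circle_moment (M j) 1)"
    "B_log_derivative (row_conv boolean_conv l M k) = (\<Sum>j=1..k. B_log_derivative (M j))" by auto
qed

lemma integral_scale_point_mass:
  fixes f :: "complex \<Rightarrow> complex"
  assumes f: "continuous_on circle f" and t: "t \<ge> 0"
  shows "(LINT \<zeta>|scale_measure (ennreal t) (point_mass 1). f \<zeta>) = of_real t * f 1"
proof -
  have "scale_measure (ennreal t) (point_mass 1) = density (point_mass 1) (\<lambda>_. ennreal t)"
    by (rule measure_eqI) (auto simp: emeasure_density nn_integral_cmult_indicator)
  then have "(LINT \<zeta>|scale_measure (ennreal t) (point_mass 1). f \<zeta>) = (LINT \<zeta>|density (point_mass 1) (\<lambda>_. ennreal t). f \<zeta>)"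
    by simp
  also have "\<dots> = (LINT \<zeta>|point_mass 1. t *\<^sub>R f \<zeta>)"
    by (rule integral_density)
      (use t continuous_imp_measurable_circle[OF circle_prob_point_mass f] in auto)
  also have "\<dots> = t *\<^sub>R f 1"
    unfolding point_mass_def
    by (rule integral_return)
      (use f in \<open>auto intro!: continuous_imp_measurable_circle_borel continuous_intros\<close>)
  finally show ?thesis by (simp add: scaleR_conv_of_real)
qed

text \<open>Cayley map of the unit disk onto the right half plane: the exponent of the boolean analogue of a
  Gaussian law.\<close>

definition half_plane_map :: "complex \<Rightarrow> complex" where
  "half_plane_map z = (1 + z) / (1 - z)"

lemma Re_half_plane_map_pos:
  assumes "norm z < 1"
  shows "Re (half_plane_map z) > 0"
proof -
  have "norm z ^ 2 < 1" using assms by (simp add: power_less_one_iff)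
  then have *: "0 < (1 + Re z) * (1 - Re z) - Im z * Im z"
    unfolding cmod_power2 by (simp add: power2_eq_square algebra_simps)
  have "(norm (1 - z))\<^sup>2 > 0" using assms by auto
  then have "(1 - Re z)\<^sup>2 + (Im z)\<^sup>2 > 0" unfolding cmod_power2 by simp
  then show ?thesis using * by (simp add: half_plane_map_def Re_divide)
qed

lemma half_plane_map_holomorphic: "half_plane_map holomorphic_on ball 0 1"
  unfolding half_plane_map_def by (intro holomorphic_intros) auto

definition boolean_gaussian :: "complex \<Rightarrow> real \<Rightarrow> complex measure" where
  "boolean_gaussian \<gamma> t = boolean_law \<gamma> (scale_measure (ennreal t) (point_mass 1))"

lemma
  assumes \<gamma>: "\<gamma> \<in> circle" and t: "t \<ge> 0"
  shows circle_prob_boolean_gaussian: "circle_prob (boolean_gaussian \<gamma> t)"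
    and B_transform_boolean_gaussian: "norm z < 1 \<Longrightarrow>
      B_transform (boolean_gaussian \<gamma> t) z = \<gamma> * exp (- of_real t * half_plane_map z)"
proof -
  let ?\<sigma> = "scale_measure (ennreal t) (point_mass 1)"
  have int: "- (LINT \<zeta>|?\<sigma>. (1 + \<zeta> * z) / (1 - \<zeta> * z)) = - of_real t * half_plane_map z" if "norm z < 1" for z
    unfolding half_plane_map_def
    by (subst integral_scale_point_mass) (auto intro!: continuous_intros t dest: one_minus_mult_neq_0[OF _ that])
  obtain P where P: "circle_prob P" "\<And>z. norm z < 1 \<Longrightarrow> B_transform P z = \<gamma> * exp (- of_real t * half_plane_map z)"
  proof (rule ex_circle_prob_B_transform[of "\<lambda>z. \<gamma> * exp (- of_real t * half_plane_map z)"])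
    show "norm (\<gamma> * exp (- of_real t * half_plane_map z)) \<le> 1" if "norm z < 1" for z
      using \<gamma> t Re_half_plane_map_pos[OF that] by (simp add: norm_mult)
  qed (intro holomorphic_intros half_plane_map_holomorphic, blast)
  have "\<exists>!N. circle_prob N \<and> (\<forall>z\<in>ball 0 1. B_transform N z =
      \<gamma> * exp (- (LINT \<zeta>|?\<sigma>. (1 + \<zeta> * z) / (1 - \<zeta> * z))))"
    using P by (auto simp: int intro!: circle_prob_eqI_B_transform)
  from theI'[OF this] have *: "circle_prob (boolean_gaussian \<gamma> t) \<and>
    (\<forall>z\<in>ball 0 1. B_transform (boolean_gaussian \<gamma> t) z = \<gamma> * exp (- (LINT \<zeta>|?\<sigma>. (1 + \<zeta> * z) / (1 - \<zeta> * z))))"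
    unfolding boolean_gaussian_def boolean_law_def .
  then show "circle_prob (boolean_gaussian \<gamma> t)" by blast
  show "B_transform (boolean_gaussian \<gamma> t) z = \<gamma> * exp (- of_real t * half_plane_map z)" if z: "norm z < 1"
    using * z int[OF z] by simp
qed

lemma circle_moment_1_boolean_gaussian:
  assumes \<gamma>: "\<gamma> \<in> circle" and t: "t \<ge> 0"
  shows "circle_moment (boolean_gaussian \<gamma> t) 1 = \<gamma> * exp (- of_real t)"
  using B_transform_boolean_gaussian[OF assms, of 0] B_transform_0[OF circle_prob_boolean_gaussian[OF assms]]
  by (simp add: half_plane_map_def)

lemma B_log_derivative_boolean_gaussian:
  assumes \<gamma>: "\<gamma> \<in> circle" and t: "t \<ge> 0"
  shows "B_log_derivative (boolean_gaussian \<gamma> t) = - 2 * of_real t"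
proof -
  let ?N = "boolean_gaussian \<gamma> t"
  note N = circle_prob_boolean_gaussian[OF assms]
  have "\<gamma> \<noteq> 0" using \<gamma> by auto
  have 1: "((\<lambda>z. \<gamma> * exp (- of_real t * half_plane_map z)) has_field_derivative
      circle_moment ?N 2 - (circle_moment ?N 1)\<^sup>2) (at 0)"
    by (rule DERIV_cong_ev[THEN iffD1, OF _ _ _ B_transform_has_field_derivative_0[OF N]])
      (use B_transform_boolean_gaussian[OF assms] in \<open>auto simp: eventually_nhds intro!: exI[of _ "ball 0 1"]\<close>)
  have 2: "((\<lambda>z. \<gamma> * exp (- of_real t * half_plane_map z)) has_field_derivative
      \<gamma> * exp (- of_real t) * (- 2 * of_real t)) (at 0)"
    unfolding half_plane_map_def by (rule derivative_eq_intros refl | simp)+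
  show ?thesis
    using DERIV_unique[OF 1 2] \<open>\<gamma> \<noteq> 0\<close>
    by (simp add: B_log_derivative_def circle_moment_1_boolean_gaussian[OF assms, simplified])
qed

text \<open>An \<open>n\<close>-th root is obtained from an \<open>n\<close>-th root of \<open>\<gamma>\<close> and the parameter \<open>t / n\<close>.\<close>

lemma boolean_inf_divisible_boolean_gaussian:
  assumes \<gamma>: "\<gamma> \<in> circle" and t: "t \<ge> 0"
  shows "boolean_inf_divisible (boolean_gaussian \<gamma> t)"
  unfolding boolean_inf_divisible_def
proof (intro conjI allI impI circle_prob_boolean_gaussian[OF assms])
  fix n :: nat assume n: "n \<ge> 1"
  define \<beta> where "\<beta> = cis (Arg \<gamma> / n)"
  have \<beta>: "\<beta> \<in> circle" by (simp add: \<beta>_def)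
  have \<beta>n: "\<beta> ^ n = \<gamma>"
  proof -
    have "real n * (Arg \<gamma> / real n) = Arg \<gamma>" using n by simp
    then have "\<beta> ^ n = cis (Arg \<gamma>)" by (simp only: \<beta>_def Complex.DeMoivre)
    also have "\<dots> = \<gamma>" using \<gamma> by (subst cis_Arg) (auto simp: sgn_div_norm)
    finally show ?thesis .
  qed
  define P where "P = boolean_gaussian \<beta> (t / n)"
  have tn: "t / n \<ge> 0" using t by simp
  have P: "circle_prob P" unfolding P_def by (rule circle_prob_boolean_gaussian[OF \<beta> tn])
  have pow: "circle_prob ((boolean_conv P ^^ j) P) \<and>
    (\<forall>z. norm z < 1 \<longrightarrow> B_transform ((boolean_conv P ^^ j) P) z = B_transform P z ^ Suc j)" for j
    by (induction j) (auto simp: P circle_prob_boolean_conv B_transform_boolean_conv)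
  have "boolean_gaussian \<gamma> t = (boolean_conv P ^^ (n - 1)) P"
  proof (rule circle_prob_eqI_B_transform[OF circle_prob_boolean_gaussian[OF assms]])
    fix z :: complex assume z: "norm z < 1"
    have "B_transform ((boolean_conv P ^^ (n - 1)) P) z = B_transform P z ^ n"
      using pow[of "n - 1"] z n by simp
    also have "\<dots> = \<gamma> * exp (of_nat n * (- of_real (t / n) * half_plane_map z))"
      by (simp only: P_def B_transform_boolean_gaussian[OF \<beta> tn z] power_mult_distrib \<beta>n exp_of_nat_mult)
    also have "\<dots> = \<gamma> * exp (- of_real t * half_plane_map z)" using n by simp
    finally show "B_transform (boolean_gaussian \<gamma> t) z = B_transform ((boolean_conv P ^^ (n - 1)) P) z"
      by (simp add: B_transform_boolean_gaussian[OF assms z])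
  qed (use pow in blast)
  then show "\<exists>P. circle_prob P \<and> boolean_gaussian \<gamma> t = (boolean_conv P ^^ (n - 1)) P" using P by blast
qed

lemma boolean_normal_iff:
  "boolean_normal N \<longleftrightarrow> (\<exists>\<gamma> t. \<gamma> \<in> circle \<and> t > 0 \<and> N = boolean_gaussian \<gamma> t)"
proof
  assume "boolean_normal N"
  then obtain \<gamma> \<sigma> where \<gamma>: "\<gamma> \<in> circle" and "finite_measure \<sigma>" and N: "N = boolean_law \<gamma> \<sigma>"
    and \<sigma>: "\<sigma> = scale_measure (emeasure \<sigma> circle) (point_mass 1)" and pos: "emeasure \<sigma> circle > 0"
    unfolding boolean_normal_def by blast
  interpret finite_measure \<sigma> by fact
  define t where "t = measure \<sigma> circle"
  have t: "emeasure \<sigma> circle = ennreal t" by (simp add: t_def emeasure_eq_measure)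
  have "\<sigma> = scale_measure (ennreal t) (point_mass 1)" using \<sigma> unfolding t .
  moreover have "t > 0" using pos t by (simp add: ennreal_less_zero_iff)
  ultimately show "\<exists>\<gamma> t. \<gamma> \<in> circle \<and> t > 0 \<and> N = boolean_gaussian \<gamma> t"
    using N \<gamma> by (auto simp: boolean_gaussian_def)
next
  assume "\<exists>\<gamma> t. \<gamma> \<in> circle \<and> t > 0 \<and> N = boolean_gaussian \<gamma> t"
  then obtain \<gamma> t where \<gamma>: "\<gamma> \<in> circle" and t: "t > 0" and N: "N = boolean_gaussian \<gamma> t" by blast
  let ?\<sigma> = "scale_measure (ennreal t) (point_mass 1)"
  interpret pm: prob_space "point_mass 1"
    using circle_prob_point_mass[of 1] prob_space_circle_prob by simp
  have sp: "space (point_mass 1) = circle" by (simp add: point_mass_def)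
  have em: "emeasure ?\<sigma> circle = ennreal t"
    using pm.emeasure_space_1 by (simp add: sp)
  have fin: "finite_measure ?\<sigma>"
    by (rule finite_measureI) (use em in \<open>simp add: sp space_scale_measure\<close>)
  have "circle_prob_nonzero_mean N"
    unfolding circle_prob_nonzero_mean_def N
    using circle_prob_boolean_gaussian[OF \<gamma>] circle_moment_1_boolean_gaussian[OF \<gamma>] t \<gamma>
    by (auto simp: circle_moment_def)
  moreover have "sets ?\<sigma> = sets circle_borel" by (simp add: point_mass_def)
  moreover have "boolean_inf_divisible N" unfolding N using \<gamma> t by (intro boolean_inf_divisible_boolean_gaussian) auto
  ultimately show "boolean_normal N"
    unfolding boolean_normal_def using \<gamma> t N em fin
    by (intro conjI exI[of _ \<gamma>] exI[of _ ?\<sigma>]) (auto simp: boolean_gaussian_def)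
qed

section \<open>Classical convolution and wrapped Gaussian laws\<close>

lemma measurable_circle_mult:
  assumes M: "circle_prob M" and N: "circle_prob N"
  shows "(\<lambda>(x, y). x * y) \<in> measurable (M \<Otimes>\<^sub>M N) circle_borel"
proof -
  have id: "(\<lambda>x. x) \<in> borel_measurable L" if "circle_prob L" for L
    by (rule continuous_imp_measurable_circle[OF that]) (intro continuous_intros)
  have [measurable]: "fst \<in> borel_measurable (M \<Otimes>\<^sub>M N)" "snd \<in> borel_measurable (M \<Otimes>\<^sub>M N)"
    using measurable_compose[OF measurable_fst id[OF M]] measurable_compose[OF measurable_snd id[OF N]] by auto
  show ?thesis
    unfolding circle_borel_def case_prod_beta
    by (rule measurable_restrict_space2)
      (auto simp: space_pair_measure space_circle_prob M N norm_mult)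
qed

lemma
  assumes M: "circle_prob M" and N: "circle_prob N"
  shows circle_prob_circle_conv: "circle_prob (circle_conv M N)"
    and circle_moment_circle_conv: "circle_moment (circle_conv M N) p = circle_moment M p * circle_moment N p"
proof -
  interpret M: prob_space M using M by (rule prob_space_circle_prob)
  interpret N: prob_space N using N by (rule prob_space_circle_prob)
  interpret pair_prob_space M N ..
  note meas = measurable_circle_mult[OF M N]
  show "circle_prob (circle_conv M N)"
    unfolding circle_prob_def circle_conv_def using prob_space_distr[OF meas] by simp
  have id: "(\<lambda>x. x) \<in> borel_measurable L" if "circle_prob L" for L
    by (rule continuous_imp_measurable_circle[OF that]) (intro continuous_intros)
  have [measurable]: "fst \<in> borel_measurable (M \<Otimes>\<^sub>M N)" "snd \<in> borel_measurable (M \<Otimes>\<^sub>M N)"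
    using measurable_compose[OF measurable_fst id[OF M]] measurable_compose[OF measurable_snd id[OF N]] by auto
  have int: "integrable (M \<Otimes>\<^sub>M N) (\<lambda>(x, y). (x * y) ^ p)"
    by (rule integrable_const_bound[where B = 1])
      (auto simp: space_pair_measure space_circle_prob M N norm_mult norm_power case_prod_beta intro!: AE_I2)
  have "circle_moment (circle_conv M N) p = (LINT z|(M \<Otimes>\<^sub>M N). (case z of (x, y) \<Rightarrow> x * y) ^ p)"
    unfolding circle_moment_def circle_conv_def
    by (rule integral_distr[OF meas]) (intro continuous_imp_measurable_circle_borel continuous_intros)
  also have "\<dots> = (LINT z|(M \<Otimes>\<^sub>M N). (case z of (x, y) \<Rightarrow> (x * y) ^ p))"
    by (simp add: case_prod_beta)
  also have "\<dots> = (LINT x|M. LINT y|N. (x * y) ^ p)"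
    using integral_fst'[OF int] by simp
  also have "\<dots> = circle_moment M p * circle_moment N p"
    by (simp add: power_mult_distrib circle_moment_def)
  finally show "circle_moment (circle_conv M N) p = circle_moment M p * circle_moment N p" .
qed

lemma
  assumes "\<And>j. 1 \<le> j \<Longrightarrow> j \<le> k \<Longrightarrow> circle_prob (M j)" and l: "l \<in> circle"
  shows circle_prob_row_circle_conv: "circle_prob (row_conv circle_conv l M k)"
    and circle_moment_row_circle_conv:
      "circle_moment (row_conv circle_conv l M k) p = l ^ p * (\<Prod>j=1..k. circle_moment (M j) p)"
proof -
  have "circle_prob (row_conv circle_conv l M k) \<and>
      circle_moment (row_conv circle_conv l M k) p = l ^ p * (\<Prod>j=1..k. circle_moment (M j) p)"
    using assms(1)
  proof (induction k)
    case 0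
    then show ?case using l by (simp add: row_conv_0 circle_prob_point_mass circle_moment_point_mass)
  next
    case (Suc k)
    then have "circle_prob (M (Suc k))" by simp
    then show ?case
      using Suc by (simp add: row_conv_Suc circle_prob_circle_conv circle_moment_circle_conv)
  qed
  then show "circle_prob (row_conv circle_conv l M k)"
    "circle_moment (row_conv circle_conv l M k) p = l ^ p * (\<Prod>j=1..k. circle_moment (M j) p)" by auto
qed

definition wrapped_gaussian :: "real \<Rightarrow> real \<Rightarrow> complex measure" where
  "wrapped_gaussian a t = distr (density lborel (normal_density a (sqrt t))) circle_borel cis"

lemma
  assumes t: "t > 0"
  shows circle_prob_wrapped_gaussian: "circle_prob (wrapped_gaussian a t)"
    and circle_moment_wrapped_gaussian:
      "circle_moment (wrapped_gaussian a t) p = cis a ^ p * exp (- of_real ((real p)\<^sup>2 * t / 2))"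
proof -
  let ?N = "density lborel (normal_density a (sqrt t))"
  define s where "s = sqrt t"
  have s: "s > 0" "s\<^sup>2 = t" using t by (auto simp: s_def)
  have meas: "cis \<in> measurable ?N circle_borel"
    unfolding circle_borel_def
    by (intro measurable_restrict_space2) (auto intro!: borel_measurable_continuous_onI continuous_intros)
  interpret prob_space ?N by (rule prob_space_normal_density) (use t in auto)
  show "circle_prob (wrapped_gaussian a t)"
    unfolding circle_prob_def wrapped_gaussian_def using prob_space_distr[OF meas] by simp
  have m: "(\<lambda>x. cis x ^ p) \<in> borel_measurable lborel" "(\<lambda>x. iexp (real p * s * x)) \<in> borel_measurable lborel"
  proof -
    have "(\<lambda>x. cis x ^ p) \<in> borel_measurable borel" "(\<lambda>x. iexp (real p * s * x)) \<in> borel_measurable borel"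
      by (rule borel_measurable_continuous_onI, intro continuous_intros)+
    then show "(\<lambda>x. cis x ^ p) \<in> borel_measurable lborel" "(\<lambda>x. iexp (real p * s * x)) \<in> borel_measurable lborel"
      by simp_all
  qed
  have "circle_moment (wrapped_gaussian a t) p = (LINT x|?N. cis x ^ p)"
    unfolding circle_moment_def wrapped_gaussian_def
    by (rule integral_distr[OF meas]) (intro continuous_imp_measurable_circle_borel continuous_intros)
  also have "\<dots> = (LINT x|lborel. normal_density a s x *\<^sub>R cis x ^ p)"
    unfolding s_def by (rule integral_density) (use m in auto)
  also have "\<dots> = \<bar>s\<bar> *\<^sub>R (LINT x|lborel. normal_density a s (a + s * x) *\<^sub>R cis (a + s * x) ^ p)"
    by (rule lborel_integral_real_affine) (use s in auto)
  also have "\<dots> = (LINT x|lborel. s *\<^sub>R (normal_density a s (a + s * x) *\<^sub>R cis (a + s * x) ^ p))"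
    by (subst integral_scaleR_right) (use s in simp)
  also have "\<dots> = (LINT x|lborel. cis a ^ p * (std_normal_density x *\<^sub>R iexp (real p * s * x)))"
  proof (rule Bochner_Integration.integral_cong[OF refl])
    fix x
    have "s * normal_density a s (a + s * x) = std_normal_density x"
      using s(1) by (simp add: normal_density_def real_sqrt_mult power_mult_distrib)
    moreover have "cis (a + s * x) ^ p = cis a ^ p * iexp (real p * s * x)"
      unfolding cis_mult[symmetric] power_mult_distrib Complex.DeMoivre by (simp add: cis_conv_exp mult_ac)
    ultimately show "s *\<^sub>R (normal_density a s (a + s * x) *\<^sub>R cis (a + s * x) ^ p) =
        cis a ^ p * (std_normal_density x *\<^sub>R iexp (real p * s * x))"
      by (simp add: scaleR_conv_of_real mult_ac flip: of_real_mult)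
  qed
  also have "\<dots> = cis a ^ p * (LINT x|lborel. std_normal_density x *\<^sub>R iexp (real p * s * x))"
    by (rule integral_mult_right_zero)
  also have "(LINT x|lborel. std_normal_density x *\<^sub>R iexp (real p * s * x)) = char std_normal_distribution (real p * s)"
    unfolding char_def by (rule integral_density[symmetric]) (use m in \<open>auto simp: mult.assoc\<close>)
  also have "\<dots> = exp (- of_real ((real p)\<^sup>2 * t / 2))"
    by (simp add: char_std_normal_distribution power_mult_distrib exp_of_real[symmetric] flip: s(2))
  finally show "circle_moment (wrapped_gaussian a t) p = cis a ^ p * exp (- of_real ((real p)\<^sup>2 * t / 2))" .
qed

lemma circle_normal_iff: "circle_normal N \<longleftrightarrow> (\<exists>a t. t > 0 \<and> N = wrapped_gaussian a t)"
  by (simp add: circle_normal_def wrapped_gaussian_def)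

section \<open>Measures close to the point mass at 1\<close>

definition rotate :: "complex \<Rightarrow> complex measure \<Rightarrow> complex measure" where
  "rotate c M = distr M circle_borel (\<lambda>\<zeta>. c * \<zeta>)"

lemma
  fixes f :: "complex \<Rightarrow> 'b::{banach, second_countable_topology}"
  assumes M: "circle_prob M" and c: "c \<in> circle"
  shows circle_prob_rotate: "circle_prob (rotate c M)"
    and integral_rotate: "continuous_on circle f \<Longrightarrow> (LINT \<zeta>|rotate c M. f \<zeta>) = (LINT \<zeta>|M. f (c * \<zeta>))"
proof -
  have meas: "(\<lambda>\<zeta>. c * \<zeta>) \<in> measurable M circle_borel"
    unfolding circle_borel_def
    by (rule measurable_restrict_space2)
      (use c in \<open>auto simp: space_circle_prob[OF M] norm_mult intro!: continuous_imp_measurable_circle[OF M] continuous_intros\<close>)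
  show "circle_prob (rotate c M)"
    unfolding circle_prob_def rotate_def
    using prob_space.prob_space_distr[OF prob_space_circle_prob[OF M] meas] by simp
  assume "continuous_on circle f"
  then show "(LINT \<zeta>|rotate c M. f \<zeta>) = (LINT \<zeta>|M. f (c * \<zeta>))"
    unfolding rotate_def by (intro integral_distr[OF meas] continuous_imp_measurable_circle_borel)
qed

lemma circle_moment_rotate:
  assumes "circle_prob M" "c \<in> circle"
  shows "circle_moment (rotate c M) p = c ^ p * circle_moment M p"
  unfolding circle_moment_def
  by (subst integral_rotate[OF assms]) (auto intro!: continuous_intros simp: power_mult_distrib)

lemma B_transform_rotate:
  assumes M: "circle_prob M" and c: "c \<in> circle" and z: "norm z < 1"
  shows "B_transform (rotate c M) z = c * B_transform M (c * z)"
proof -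
  have "circle_cauchy (rotate c M) z = (LINT \<zeta>|M. c * \<zeta> / (1 - c * \<zeta> * z))"
    unfolding circle_cauchy_def
    by (rule integral_rotate[OF M c]) (intro continuous_intros ballI one_minus_mult_neq_0 z)
  also have "\<dots> = (LINT \<zeta>|M. c * (\<zeta> / (1 - \<zeta> * (c * z))))" by (simp add: mult_ac)
  also have "\<dots> = c * circle_cauchy M (c * z)"
    by (simp only: integral_mult_right_zero circle_cauchy_def)
  finally have *: "circle_cauchy (rotate c M) z = c * circle_cauchy M (c * z)" .
  have "norm (c * z) < 1" using c z by (simp add: norm_mult)
  then show ?thesis
    by (simp add: B_transform_eq M circle_prob_rotate[OF M c] z * mult_ac)
qed

text \<open>On the circle \<open>(norm (\<zeta> - 1))\<^sup>2 = 2 * (1 - Re \<zeta>)\<close>, so the next four quantities are, up to constants, the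
  absolute moments of \<open>\<zeta> - 1\<close> of order two, four, one and three.\<close>

definition mean_defect :: "complex measure \<Rightarrow> real" where
  "mean_defect M = (LINT \<zeta>|M. 1 - Re \<zeta>)"

definition square_defect :: "complex measure \<Rightarrow> real" where
  "square_defect M = (LINT \<zeta>|M. (1 - Re \<zeta>)\<^sup>2)"

definition mean_deviation :: "complex measure \<Rightarrow> real" where
  "mean_deviation M = (LINT \<zeta>|M. norm (\<zeta> - 1))"

definition cubic_deviation :: "complex measure \<Rightarrow> real" where
  "cubic_deviation M = (LINT \<zeta>|M. norm (\<zeta> - 1) ^ 3)"

lemma Re_le_1_circle: "\<zeta> \<in> circle \<Longrightarrow> Re \<zeta> \<le> 1"
  using complex_Re_le_cmod[of \<zeta>] by simp

lemma Re_ge_minus_1_circle: "\<zeta> \<in> circle \<Longrightarrow> - 1 \<le> Re \<zeta>"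
  using abs_Re_le_cmod[of \<zeta>] by simp

lemma norm_diff_1_square_circle: "\<zeta> \<in> circle \<Longrightarrow> (norm (\<zeta> - 1))\<^sup>2 = 2 * (1 - Re \<zeta>)"
proof -
  assume "\<zeta> \<in> circle"
  then have "(Re \<zeta>)\<^sup>2 + (Im \<zeta>)\<^sup>2 = 1" by (simp add: cmod_power2[symmetric])
  then show ?thesis unfolding cmod_power2 by (simp add: power2_eq_square algebra_simps)
qed

context
  fixes M assumes M: "circle_prob M"
begin

interpretation prob_space M using M by (rule prob_space_circle_prob)

lemma integral_circle_mono:
  fixes f g :: "complex \<Rightarrow> real"
  assumes "continuous_on circle f" "continuous_on circle g" "\<And>\<zeta>. \<zeta> \<in> circle \<Longrightarrow> f \<zeta> \<le> g \<zeta>"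
  shows "(LINT \<zeta>|M. f \<zeta>) \<le> (LINT \<zeta>|M. g \<zeta>)"
  by (rule integral_mono) (use assms M in \<open>auto intro: continuous_imp_integrable_circle simp: space_circle_prob\<close>)

lemma norm_integral_circle_le_integral:
  fixes f :: "complex \<Rightarrow> complex" and g :: "complex \<Rightarrow> real"
  assumes "continuous_on circle f" "continuous_on circle g" "\<And>\<zeta>. \<zeta> \<in> circle \<Longrightarrow> norm (f \<zeta>) \<le> g \<zeta>"
  shows "norm (LINT \<zeta>|M. f \<zeta>) \<le> (LINT \<zeta>|M. g \<zeta>)"
  by (rule order_trans[OF integral_norm_bound integral_circle_mono]) (intro continuous_intros assms)+

lemma mean_defect_nonneg: "mean_defect M \<ge> 0"
proof -
  have "(LINT \<zeta>|M. 0) \<le> (LINT \<zeta>|M. 1 - Re \<zeta>)"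
    by (rule integral_circle_mono) (auto intro!: continuous_intros simp: Re_le_1_circle)
  then show ?thesis by (simp only: mean_defect_def integral_zero)
qed

lemma square_defect_nonneg: "square_defect M \<ge> 0"
  using integral_circle_mono[of "\<lambda>_. 0" "\<lambda>\<zeta>. (1 - Re \<zeta>)\<^sup>2"]
  by (auto simp: square_defect_def intro!: continuous_intros)

lemma cubic_deviation_nonneg: "cubic_deviation M \<ge> 0"
  using integral_circle_mono[of "\<lambda>_. 0" "\<lambda>\<zeta>. norm (\<zeta> - 1) ^ 3"]
  by (auto simp: cubic_deviation_def intro!: continuous_intros)

lemma mean_deviation_nonneg: "mean_deviation M \<ge> 0"
  using integral_circle_mono[of "\<lambda>_. 0" "\<lambda>\<zeta>. norm (\<zeta> - 1)"]
  by (auto simp: mean_deviation_def intro!: continuous_intros)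

lemma square_defect_le: "square_defect M \<le> 2 * mean_defect M"
proof -
  have "square_defect M \<le> (LINT \<zeta>|M. 2 * (1 - Re \<zeta>))"
    unfolding square_defect_def
  proof (rule integral_circle_mono)
    fix \<zeta> assume \<zeta>: "\<zeta> \<in> circle"
    show "(1 - Re \<zeta>)\<^sup>2 \<le> 2 * (1 - Re \<zeta>)"
      unfolding power2_eq_square
      using Re_le_1_circle[OF \<zeta>] Re_ge_minus_1_circle[OF \<zeta>] by (intro mult_right_mono) auto
  qed (auto intro!: continuous_intros)
  then show ?thesis by (simp only: mean_defect_def integral_mult_right_zero)
qed

text \<open>The inequality of arithmetic and geometric means with a weight \<open>\<eta>\<close>: \<open>2 * u ^ 3 \<le> \<eta> * u\<^sup>2 + u ^ 4 / \<eta>\<close>.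
  A small \<open>\<eta>\<close> makes the cubic deviation negligible against the mean defect once the square defect is.\<close>

lemma cubic_deviation_le:
  assumes \<eta>: "\<eta> > 0"
  shows "cubic_deviation M \<le> \<eta> * mean_defect M + 2 / \<eta> * square_defect M"
proof -
  have "cubic_deviation M \<le> (LINT \<zeta>|M. \<eta> * (1 - Re \<zeta>) + 2 / \<eta> * (1 - Re \<zeta>)\<^sup>2)"
    unfolding cubic_deviation_def
  proof (rule integral_circle_mono)
    fix \<zeta> assume \<zeta>: "\<zeta> \<in> circle"
    define u where "u = norm (\<zeta> - 1)"
    have u: "u \<ge> 0" "1 - Re \<zeta> = u\<^sup>2 / 2" using norm_diff_1_square_circle[OF \<zeta>] by (auto simp: u_def)
    have "0 \<le> u\<^sup>2 * (\<eta> - u)\<^sup>2" by simp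
    then have "2 * \<eta> * u ^ 3 \<le> \<eta>\<^sup>2 * u\<^sup>2 + u ^ 4"
      by (simp add: power2_eq_square power3_eq_cube power4_eq_xxxx algebra_simps)
    then have "u ^ 3 \<le> (\<eta>\<^sup>2 * u\<^sup>2 + u ^ 4) / (2 * \<eta>)" using \<eta> by (simp add: field_simps)
    also have "\<dots> = \<eta> * (1 - Re \<zeta>) + 2 / \<eta> * (1 - Re \<zeta>)\<^sup>2"
      unfolding u(2) using \<eta> by (simp add: field_simps power2_eq_square power4_eq_xxxx)
    finally show "norm (\<zeta> - 1) ^ 3 \<le> \<eta> * (1 - Re \<zeta>) + 2 / \<eta> * (1 - Re \<zeta>)\<^sup>2"
      by (simp add: u_def)
  qed (use \<eta> in \<open>auto intro!: continuous_intros\<close>)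
  also have "\<dots> = \<eta> * mean_defect M + 2 / \<eta> * square_defect M"
  proof -
    have "integrable M (\<lambda>\<zeta>. 1 - Re \<zeta>)" "integrable M (\<lambda>\<zeta>. (1 - Re \<zeta>)\<^sup>2)"
      by (intro continuous_imp_integrable_circle M continuous_intros)+
    then show ?thesis unfolding mean_defect_def square_defect_def
      by (subst Bochner_Integration.integral_add) auto
  qed
  finally show ?thesis .
qed

lemma integrable_circle_power: "integrable M (\<lambda>\<zeta>. \<zeta> ^ p)"
  by (intro continuous_imp_integrable_circle M continuous_intros)

lemma mean_defect_eq: "mean_defect M = 1 - Re (circle_moment M 1)"
proof -
  have "integrable M (\<lambda>\<zeta>. Re \<zeta>)" by (intro continuous_imp_integrable_circle M continuous_intros)
  moreover have "integrable M (\<lambda>\<zeta>. \<zeta>)" using integrable_circle_power[of 1] by simp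
  ultimately show ?thesis by (simp add: mean_defect_def circle_moment_def prob_space)
qed

lemma Re_circle_moment_2: "Re (circle_moment M 2) = 1 - 4 * mean_defect M + 2 * square_defect M"
proof -
  have int: "integrable M (\<lambda>\<zeta>. 1 - Re \<zeta>)" "integrable M (\<lambda>\<zeta>. (1 - Re \<zeta>)\<^sup>2)"
    by (intro continuous_imp_integrable_circle M continuous_intros)+
  have "Re (circle_moment M 2) = (LINT \<zeta>|M. Re (\<zeta>\<^sup>2))"
    by (simp add: circle_moment_def integrable_circle_power)
  also have "\<dots> = (LINT \<zeta>|M. 1 - 4 * (1 - Re \<zeta>) + 2 * (1 - Re \<zeta>)\<^sup>2)"
  proof (rule Bochner_Integration.integral_cong[OF refl])
    fix \<zeta> assume "\<zeta> \<in> space M"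
    then have "(Re \<zeta>)\<^sup>2 + (Im \<zeta>)\<^sup>2 = 1" using M by (simp add: space_circle_prob cmod_power2[symmetric])
    then show "Re (\<zeta>\<^sup>2) = 1 - 4 * (1 - Re \<zeta>) + 2 * (1 - Re \<zeta>)\<^sup>2"
      by (simp add: power2_eq_square algebra_simps)
  qed
  also have "\<dots> = 1 - 4 * mean_defect M + 2 * square_defect M"
    by (simp only: Bochner_Integration.integral_add Bochner_Integration.integral_diff integral_mult_right_zero Bochner_Integration.integrable_add Bochner_Integration.integrable_diff integrable_mult_right integrable_const
        int mean_defect_def square_defect_def) (simp add: prob_space)
  finally show ?thesis .
qed

text \<open>The left hand side is \<open>E (\<zeta> - m)\<^sup>2\<close>, the right hand side \<open>E (norm (\<zeta> - m))\<^sup>2\<close>, where \<open>m\<close> is the mean.\<close>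

lemma norm_circle_moment_2_minus_square:
  "norm (circle_moment M 2 - (circle_moment M 1)\<^sup>2) \<le> 1 - (norm (circle_moment M 1))\<^sup>2"
proof -
  define m where "m = circle_moment M 1"
  have int: "integrable M (\<lambda>\<zeta>. \<zeta>)" "integrable M (\<lambda>\<zeta>. \<zeta>\<^sup>2)"
    using integrable_circle_power[of 1] integrable_circle_power[of 2] by auto
  have m: "(LINT \<zeta>|M. \<zeta>) = m" by (simp add: m_def circle_moment_def)
  have eq: "circle_moment M 2 - m\<^sup>2 = (LINT \<zeta>|M. (\<zeta> - m)\<^sup>2)"
  proof -
    have "(LINT \<zeta>|M. (\<zeta> - m)\<^sup>2) = (LINT \<zeta>|M. \<zeta>\<^sup>2 - 2 * m * \<zeta> + m\<^sup>2)"
      by (intro Bochner_Integration.integral_cong refl) (simp add: power2_diff algebra_simps)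
    also have "\<dots> = circle_moment M 2 - 2 * m * m + m\<^sup>2"
      using int m by (simp add: circle_moment_def prob_space)
    finally show ?thesis by (simp add: power2_eq_square)
  qed
  have "norm (LINT \<zeta>|M. (\<zeta> - m)\<^sup>2) \<le> (LINT \<zeta>|M. (norm (\<zeta> - m))\<^sup>2)"
    by (rule norm_integral_circle_le_integral) (auto intro!: continuous_intros simp: norm_power)
  also have "\<dots> = (LINT \<zeta>|M. 1 + (norm m)\<^sup>2 - 2 * Re (cnj m * \<zeta>))"
  proof (rule Bochner_Integration.integral_cong[OF refl])
    fix \<zeta> assume "\<zeta> \<in> space M"
    then have "(Re \<zeta>)\<^sup>2 + (Im \<zeta>)\<^sup>2 = 1" using M by (simp add: space_circle_prob cmod_power2[symmetric])
    then show "(norm (\<zeta> - m))\<^sup>2 = 1 + (norm m)\<^sup>2 - 2 * Re (cnj m * \<zeta>)"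
      unfolding cmod_power2 by (simp add: power2_eq_square algebra_simps)
  qed
  also have "\<dots> = 1 + (norm m)\<^sup>2 - 2 * Re (LINT \<zeta>|M. cnj m * \<zeta>)"
    using int by (simp add: prob_space del: integral_mult_right_zero)
  also have "(LINT \<zeta>|M. cnj m * \<zeta>) = cnj m * m" using m by simp
  also have "1 + (norm m)\<^sup>2 - 2 * Re (cnj m * m) = 1 - (norm m)\<^sup>2"
    unfolding cmod_power2 by (simp add: power2_eq_square)
  finally show ?thesis unfolding m_def[symmetric] eq .
qed

text \<open>\<open>(\<zeta> - 1)\<^sup>2 = - 2 * \<zeta> * (1 - Re \<zeta>)\<close> on the circle, and replacing the factor \<open>\<zeta>\<close> by \<open>1\<close> costs exactly
  \<open>norm (\<zeta> - 1) ^ 3\<close>.\<close>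

lemma integral_diff_1_square: "norm ((LINT \<zeta>|M. (\<zeta> - 1)\<^sup>2) + 2 * of_real (mean_defect M)) \<le> cubic_deviation M"
proof -
  have int: "integrable M (\<lambda>\<zeta>. (\<zeta> - 1)\<^sup>2)" "integrable M (\<lambda>\<zeta>. 2 * of_real (1 - Re \<zeta>) :: complex)"
    by (intro continuous_imp_integrable_circle M continuous_intros)+
  have "(LINT \<zeta>|M. (\<zeta> - 1)\<^sup>2) + 2 * of_real (mean_defect M) = (LINT \<zeta>|M. (\<zeta> - 1)\<^sup>2 + 2 * of_real (1 - Re \<zeta>))"
    by (subst Bochner_Integration.integral_add[OF int]) (simp add: mean_defect_def del: of_real_diff)
  also have "norm \<dots> \<le> cubic_deviation M"
    unfolding cubic_deviation_def
  proof (rule norm_integral_circle_le_integral)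
    fix \<zeta> assume \<zeta>: "\<zeta> \<in> circle"
    then have "(Re \<zeta>)\<^sup>2 + (Im \<zeta>)\<^sup>2 = 1" by (simp add: cmod_power2[symmetric])
    then have "(\<zeta> - 1)\<^sup>2 + 2 * of_real (1 - Re \<zeta>) = of_real (2 * (1 - Re \<zeta>)) * (1 - \<zeta>)"
      by (simp add: complex_eq_iff power2_eq_square algebra_simps)
    also have "norm \<dots> = norm (\<zeta> - 1) ^ 3"
      unfolding norm_mult norm_diff_1_square_circle[OF \<zeta>, symmetric]
      by (simp only: norm_of_real abs_power2 norm_minus_commute[of 1 \<zeta>])
        (simp add: power2_eq_square power3_eq_cube)
    finally show "norm ((\<zeta> - 1)\<^sup>2 + 2 * of_real (1 - Re \<zeta>)) \<le> norm (\<zeta> - 1) ^ 3" by simp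
  qed (intro continuous_intros)+
  finally show ?thesis .
qed

end

lemma norm_power_taylor_2:
  fixes \<zeta> :: complex
  assumes "norm \<zeta> \<le> 1"
  shows "norm (\<zeta> ^ p - 1 - of_nat p * (\<zeta> - 1) - of_nat (p choose 2) * (\<zeta> - 1)\<^sup>2) \<le> real p ^ 3 * norm (\<zeta> - 1) ^ 3"
proof (induction p)
  case (Suc p)
  define u where "u = \<zeta> - 1"
  define D where "D = (\<lambda>p::nat. \<zeta> ^ p - 1 - of_nat p * u - of_nat (p choose 2) * u\<^sup>2)"
  have ch: "Suc p choose 2 = (p choose 2) + p" by (simp add: numeral_2_eq_2)
  have \<zeta>: "\<zeta> = 1 + u" by (simp add: u_def)
  have "D (Suc p) = \<zeta> * D p + of_nat (p choose 2) * u ^ 3"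
  proof -
    have "\<zeta> * D p = \<zeta> ^ Suc p - \<zeta> - of_nat p * (\<zeta> * u) - of_nat (p choose 2) * (\<zeta> * u\<^sup>2)"
      by (simp add: D_def algebra_simps)
    also have "\<dots> + of_nat (p choose 2) * u ^ 3 = \<zeta> ^ Suc p - (1 + u) - of_nat p * ((1 + u) * u) - of_nat (p choose 2) * ((1 + u) * u\<^sup>2)
        + of_nat (p choose 2) * u ^ 3" using \<zeta> by simp
    also have "\<dots> = D (Suc p)"
      unfolding D_def ch by (simp add: algebra_simps power2_eq_square power3_eq_cube)
    finally show ?thesis by simp
  qed
  then have "norm (D (Suc p)) \<le> norm (\<zeta> * D p) + norm (of_nat (p choose 2) * u ^ 3)"
    using norm_triangle_ineq by metis
  also have "norm (\<zeta> * D p) \<le> real p ^ 3 * norm u ^ 3"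
    using Suc.IH assms mult_mono[of "norm \<zeta>" 1 "norm (D p)" "real p ^ 3 * norm u ^ 3"]
    by (simp add: norm_mult D_def u_def)
  also have "norm (of_nat (p choose 2) * u ^ 3) \<le> real p ^ 2 * norm u ^ 3"
  proof -
    have "p choose 2 \<le> p ^ 2" by (simp add: choose_two power2_eq_square algebra_simps le_diff_conv div_le_dividend order_trans[OF div_le_dividend])
    then have "real (p choose 2) \<le> real p ^ 2" by (metis of_nat_le_iff of_nat_power)
    then show ?thesis by (simp add: norm_mult norm_power mult_right_mono)
  qed
  also have "real p ^ 3 * norm u ^ 3 + real p ^ 2 * norm u ^ 3 \<le> real (Suc p) ^ 3 * norm u ^ 3"
  proof -
    have "real p ^ 3 + real p ^ 2 \<le> real (Suc p) ^ 3"
      by (simp add: power2_eq_square power3_eq_cube algebra_simps)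
    from mult_right_mono[OF this, of "norm u ^ 3"] show ?thesis by (simp add: distrib_right)
  qed
  finally show ?case by (simp add: D_def u_def)
qed simp

text \<open>A measure with real mean that is close to \<open>1\<close> has moments like those of a Gaussian law. In the expansion of
  \<open>\<zeta> ^ p\<close> at \<open>1\<close> the linear term contributes \<open>- p * a\<close> and the quadratic one \<open>- p * (p - 1) * a\<close>, where \<open>a\<close> is the
  mean defect; together \<open>- p\<^sup>2 * a\<close>.\<close>

lemma circle_moment_approx:
  assumes M: "circle_prob M" and centred: "circle_moment M 1 = of_real (1 - mean_defect M)"
  shows "norm (circle_moment M p - 1 + of_real ((real p)\<^sup>2 * mean_defect M)) \<le> (real p ^ 3 + (real p)\<^sup>2) * cubic_deviation M"
proof -
  interpret prob_space M using M by (rule prob_space_circle_prob)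
  let ?a = "mean_defect M" and ?t = "cubic_deviation M"
  let ?I2 = "LINT \<zeta>|M. (\<zeta> - 1)\<^sup>2"
  define C where "C = real (p choose 2)"
  have C: "C = real p * (real p - 1) / 2"
  proof -
    have "even (p * (p - 1))" by (cases p) auto
    then have "2 * (p choose 2) = p * (p - 1)" unfolding choose_two by (rule dvd_mult_div_cancel)
    then have "2 * C = real p * real (p - 1)" unfolding C_def by (metis of_nat_mult of_nat_numeral)
    then show ?thesis by (cases p) auto
  qed
  have int: "integrable M (\<lambda>\<zeta>. \<zeta> ^ p)" "integrable M (\<lambda>\<zeta>. (\<zeta> - 1)\<^sup>2)" "integrable M (\<lambda>\<zeta>. \<zeta> - 1)" "integrable M (\<lambda>\<zeta>. \<zeta>)"
    by (intro continuous_imp_integrable_circle M continuous_intros)+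
  have I1: "(LINT \<zeta>|M. \<zeta> - 1) = - of_real ?a"
    using centred int by (simp add: circle_moment_def prob_space)
  have "(LINT \<zeta>|M. \<zeta> ^ p - 1 - of_nat p * (\<zeta> - 1) - of_nat (p choose 2) * (\<zeta> - 1)\<^sup>2)
     = circle_moment M p - 1 - of_nat p * (LINT \<zeta>|M. \<zeta> - 1) - of_nat (p choose 2) * ?I2"
    using int by (simp add: circle_moment_def prob_space)
  also have "\<dots> = circle_moment M p - 1 + of_nat p * of_real ?a - of_real C * ?I2"
    by (simp add: I1 C_def)
  finally have 1: "(LINT \<zeta>|M. \<zeta> ^ p - 1 - of_nat p * (\<zeta> - 1) - of_nat (p choose 2) * (\<zeta> - 1)\<^sup>2)
     = circle_moment M p - 1 + of_nat p * of_real ?a - of_real C * ?I2" .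
  have "norm (LINT \<zeta>|M. \<zeta> ^ p - 1 - of_nat p * (\<zeta> - 1) - of_nat (p choose 2) * (\<zeta> - 1)\<^sup>2)
      \<le> (LINT \<zeta>|M. real p ^ 3 * norm (\<zeta> - 1) ^ 3)"
    by (rule norm_integral_circle_le_integral[OF M]) (auto intro!: continuous_intros norm_power_taylor_2)
  then have 2: "norm (circle_moment M p - 1 + of_nat p * of_real ?a - of_real C * ?I2) \<le> real p ^ 3 * ?t"
    unfolding 1 by (simp add: cubic_deviation_def)
  have "norm (of_real C * (?I2 + 2 * of_real ?a)) \<le> C * ?t"
    unfolding norm_mult using integral_diff_1_square[OF M] by (simp add: C_def mult_left_mono)
  also have "\<dots> \<le> (real p)\<^sup>2 * ?t"
    using cubic_deviation_nonneg[OF M]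
    by (intro mult_right_mono) (simp_all add: C power2_eq_square algebra_simps)
  finally have 3: "norm (of_real C * (?I2 + 2 * of_real ?a)) \<le> (real p)\<^sup>2 * ?t" .
  have "circle_moment M p - 1 + of_real ((real p)\<^sup>2 * ?a)
      = (circle_moment M p - 1 + of_nat p * of_real ?a - of_real C * ?I2) + of_real C * (?I2 + 2 * of_real ?a)"
    unfolding C by (simp add: power2_eq_square field_simps)
  then have "norm (circle_moment M p - 1 + of_real ((real p)\<^sup>2 * ?a)) \<le> real p ^ 3 * ?t + (real p)\<^sup>2 * ?t"
    using norm_triangle_le[OF add_mono[OF 2 3]] by (simp only:)
  then show ?thesis by (simp add: distrib_right)
qed

text \<open>Both \<open>B / (1 - z * B)\<close> and \<open>1 / (1 - z * B)\<close> are integrals against the measure, of \<open>\<zeta> / (1 - \<zeta> * z)\<close> and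
  \<open>1 / (1 - \<zeta> * z)\<close>; subtract them.\<close>

lemma B_transform_minus_1:
  assumes M: "circle_prob M" and z: "norm z < 1"
  shows "B_transform M z - 1 = (1 - z * B_transform M z) * (LINT \<zeta>|M. (\<zeta> - 1) / (1 - \<zeta> * z))"
    and "norm (B_transform M z - 1) \<le> 2 * mean_deviation M / (1 - norm z)"
proof -
  interpret prob_space M using M by (rule prob_space_circle_prob)
  let ?G = "LINT \<zeta>|M. (\<zeta> - 1) / (1 - \<zeta> * z)"
  have cont: "continuous_on circle (\<lambda>\<zeta>. f \<zeta> / (1 - \<zeta> * z))" if "continuous_on circle f" for f
    using that by (intro continuous_intros) (auto dest: one_minus_mult_neq_0[OF _ z])
  have int: "integrable M (\<lambda>\<zeta>. \<zeta> / (1 - \<zeta> * z))" "integrable M (\<lambda>\<zeta>. 1 / (1 - \<zeta> * z))"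
    by (intro continuous_imp_integrable_circle M cont continuous_intros)+
  have "(LINT \<zeta>|M. 1 / (1 - \<zeta> * z)) = (LINT \<zeta>|M. 1 + z * (\<zeta> / (1 - \<zeta> * z)))"
  proof (rule Bochner_Integration.integral_cong[OF refl])
    fix \<zeta> assume "\<zeta> \<in> space M"
    then have "1 - \<zeta> * z \<noteq> 0" by (intro one_minus_mult_neq_0 z) (simp add: space_circle_prob[OF M])
    then show "1 / (1 - \<zeta> * z) = 1 + z * (\<zeta> / (1 - \<zeta> * z))" by (simp add: field_simps)
  qed
  also have "\<dots> = 1 + z * circle_cauchy M z"
    by (simp only: Bochner_Integration.integral_add Bochner_Integration.integral_diff integral_mult_right_zero Bochner_Integration.integrable_add Bochner_Integration.integrable_diff integrable_mult_right integrable_const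
        int(1) circle_cauchy_def) (simp add: prob_space)
  finally have "?G = circle_cauchy M z - (1 + z * circle_cauchy M z)"
    using int by (simp add: diff_divide_distrib circle_cauchy_def)
  then show eq: "B_transform M z - 1 = (1 - z * B_transform M z) * ?G"
    using one_minus_mult_B_transform(1,2)[OF M z] by (simp add: right_diff_distrib mult.commute)
  have d: "1 - norm z > 0" using z by simp
  have "norm ?G \<le> (LINT \<zeta>|M. norm (\<zeta> - 1) / (1 - norm z))"
  proof (rule norm_integral_circle_le_integral[OF M])
    show "norm ((\<zeta> - 1) / (1 - \<zeta> * z)) \<le> norm (\<zeta> - 1) / (1 - norm z)" if "\<zeta> \<in> circle" for \<zeta>
      unfolding norm_divide using norm_one_minus_mult_ge[OF that, of z] d by (intro divide_left_mono mult_pos_pos) auto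
  qed (use d in \<open>auto intro!: cont continuous_intros\<close>)
  then have G: "norm ?G \<le> mean_deviation M / (1 - norm z)" by (simp add: mean_deviation_def)
  have "norm (1 - z * B_transform M z) \<le> 2"
    using norm_triangle_ineq4[of 1 "z * B_transform M z"] norm_mult_B_transform_less_1[OF M z] by simp
  then have "norm (B_transform M z - 1) \<le> 2 * (mean_deviation M / (1 - norm z))"
    unfolding eq norm_mult using G by (intro mult_mono) auto
  then show "norm (B_transform M z - 1) \<le> 2 * mean_deviation M / (1 - norm z)" by simp
qed

text \<open>The counterpart of the previous moment expansion for B-transforms: the same two leading terms
  of an expansion in powers of \<open>\<zeta> - 1\<close> produce the exponent of the boolean Gaussian law.\<close>

lemma B_transform_approx:
  assumes M: "circle_prob M" and centred: "circle_moment M 1 = of_real (1 - mean_defect M)" and z: "norm z < 1"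
  shows "norm (B_transform M z - 1 + of_real (mean_defect M) * half_plane_map z)
    \<le> 4 * (cubic_deviation M + mean_defect M * mean_deviation M) / (1 - norm z) ^ 3"
proof -
  interpret prob_space M using M by (rule prob_space_circle_prob)
  let ?a = "mean_defect M" and ?t = "cubic_deviation M" and ?e = "mean_deviation M"
  let ?G = "LINT \<zeta>|M. (\<zeta> - 1) / (1 - \<zeta> * z)" and ?I2 = "LINT \<zeta>|M. (\<zeta> - 1)\<^sup>2"
  let ?I3 = "LINT \<zeta>|M. (\<zeta> - 1) ^ 3 / (1 - \<zeta> * z)"
  define \<delta> where "\<delta> = 1 - norm z"
  define b where "b = B_transform M z"
  have \<delta>: "0 < \<delta>" "\<delta> \<le> 1" using z by (auto simp: \<delta>_def)
  have nz: "norm (1 - z) \<ge> \<delta>" "1 - z \<noteq> 0"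
    using norm_one_minus_mult_ge[of 1 z] z by (auto simp: \<delta>_def)
  have cont: "continuous_on circle (\<lambda>\<zeta>. f \<zeta> / (1 - \<zeta> * z))" if "continuous_on circle f" for f
    using that by (intro continuous_intros) (auto dest: one_minus_mult_neq_0[OF _ z])
  have int: "integrable M (\<lambda>\<zeta>. \<zeta> - 1)" "integrable M (\<lambda>\<zeta>. \<zeta>)" "integrable M (\<lambda>\<zeta>. (\<zeta> - 1)\<^sup>2)"
    "integrable M (\<lambda>\<zeta>. (\<zeta> - 1) ^ 3 / (1 - \<zeta> * z))"
    by (intro continuous_imp_integrable_circle M cont continuous_intros)+
  have I1: "(LINT \<zeta>|M. \<zeta> - 1) = - of_real ?a"
    using centred int by (simp add: circle_moment_def prob_space)
  \<comment> \<open>with a name for the inverse, the algebra below only needs \<open>\<kappa> * (1 - z) = 1\<close>\<close>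
  define \<kappa> where "\<kappa> = 1 / (1 - z)"
  have \<kappa>: "norm \<kappa> \<le> 1 / \<delta>"
    unfolding \<kappa>_def norm_divide using nz \<delta> by (simp add: frac_le)
  have \<kappa>z: "\<kappa> * (1 - z) = 1" using nz by (simp add: \<kappa>_def)
  have G: "?G = \<kappa> * (- of_real ?a) + z * \<kappa>\<^sup>2 * ?I2 + z\<^sup>2 * \<kappa>\<^sup>2 * ?I3"
  proof -
    \<comment> \<open>expansion of \<open>(\<zeta> - 1) / (1 - \<zeta> * z)\<close> at \<open>\<zeta> = 1\<close> with exact remainder of third order\<close>
    have "?G = (LINT \<zeta>|M. \<kappa> * (\<zeta> - 1) + z * \<kappa>\<^sup>2 * (\<zeta> - 1)\<^sup>2 + z\<^sup>2 * \<kappa>\<^sup>2 * ((\<zeta> - 1) ^ 3 / (1 - \<zeta> * z)))"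
    proof (rule Bochner_Integration.integral_cong[OF refl])
      fix \<zeta> assume "\<zeta> \<in> space M"
      then have nz': "1 - \<zeta> * z \<noteq> 0" by (intro one_minus_mult_neq_0 z) (simp add: space_circle_prob[OF M])
      define u where "u = \<zeta> - 1"
      have d: "1 - \<zeta> * z = (1 - z) - z * u" by (simp add: u_def algebra_simps)
      have "(\<kappa> * u + z * \<kappa>\<^sup>2 * u\<^sup>2) * (1 - \<zeta> * z) + z\<^sup>2 * \<kappa>\<^sup>2 * u ^ 3
         = (\<kappa> * (1 - z)) * u + z * \<kappa> * u\<^sup>2 * (\<kappa> * (1 - z) - 1)"
        unfolding d by (simp add: power2_eq_square power3_eq_cube algebra_simps)
      also have "\<dots> = u" by (simp add: \<kappa>z)
      finally show "(\<zeta> - 1) / (1 - \<zeta> * z) = \<kappa> * (\<zeta> - 1) + z * \<kappa>\<^sup>2 * (\<zeta> - 1)\<^sup>2 + z\<^sup>2 * \<kappa>\<^sup>2 * ((\<zeta> - 1) ^ 3 / (1 - \<zeta> * z))"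
        using nz' unfolding u_def[symmetric] by (simp add: field_simps)
    qed
    also have "\<dots> = \<kappa> * (LINT \<zeta>|M. \<zeta> - 1) + z * \<kappa>\<^sup>2 * ?I2 + z\<^sup>2 * \<kappa>\<^sup>2 * ?I3"
      by (simp only: Bochner_Integration.integral_add Bochner_Integration.integral_diff integral_mult_right_zero Bochner_Integration.integrable_add Bochner_Integration.integrable_diff integrable_mult_right integrable_const int)
    finally show ?thesis by (simp add: I1)
  qed
  define err where "err = z * \<kappa>\<^sup>2 * (?I2 + 2 * of_real ?a) + z\<^sup>2 * \<kappa>\<^sup>2 * ?I3"
  have G': "?G = - of_real ?a * (1 + z) * \<kappa>\<^sup>2 + err"
  proof -
    have "?G = - of_real ?a * (\<kappa> + 2 * z * \<kappa>\<^sup>2) + err"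
      unfolding G err_def by (simp add: algebra_simps)
    also have "\<kappa> + 2 * z * \<kappa>\<^sup>2 = \<kappa> * (\<kappa> * (1 - z)) + 2 * z * \<kappa>\<^sup>2" by (simp add: \<kappa>z)
    also have "\<dots> = (1 + z) * \<kappa>\<^sup>2" by (simp add: power2_eq_square algebra_simps)
    finally show ?thesis by (simp add: mult.assoc)
  qed
  have t0: "?t \<ge> 0" and a0: "?a \<ge> 0" and e0: "?e \<ge> 0"
    using cubic_deviation_nonneg[OF M] mean_defect_nonneg[OF M] mean_deviation_nonneg[OF M] by auto
  have \<kappa>2: "norm (\<kappa>\<^sup>2) \<le> 1 / \<delta>\<^sup>2"
    using power_mono[OF \<kappa> norm_ge_zero, of 2] by (simp add: norm_power power_divide)
  have err: "norm err \<le> 2 * ?t / \<delta> ^ 3"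
  proof -
    have "norm ?I3 \<le> (LINT \<zeta>|M. norm (\<zeta> - 1) ^ 3 / \<delta>)"
    proof (rule norm_integral_circle_le_integral[OF M])
      show "norm ((\<zeta> - 1) ^ 3 / (1 - \<zeta> * z)) \<le> norm (\<zeta> - 1) ^ 3 / \<delta>" if "\<zeta> \<in> circle" for \<zeta>
        unfolding norm_divide norm_power using norm_one_minus_mult_ge[OF that, of z] \<delta>
        by (intro divide_left_mono mult_pos_pos) (auto simp: \<delta>_def)
    qed (use \<delta> in \<open>auto intro!: cont continuous_intros\<close>)
    then have I3: "norm ?I3 \<le> ?t / \<delta>" by (simp add: cubic_deviation_def)
    have z1: "norm z \<le> 1" "norm (z\<^sup>2) \<le> 1" using z by (auto simp: norm_power power_le_one)
    have "norm (z * \<kappa>\<^sup>2 * (?I2 + 2 * of_real ?a)) \<le> 1 * (1 / \<delta>\<^sup>2) * ?t"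
      unfolding norm_mult using integral_diff_1_square[OF M] \<kappa>2 z1 \<delta>
      by (intro mult_mono) (auto simp: norm_power norm_mult)
    also have "\<dots> \<le> ?t / \<delta> ^ 3"
      using t0 \<delta> by (simp add: divide_simps power2_eq_square power3_eq_cube mult_left_le mult_left_le_one_le)
    finally have 1: "norm (z * \<kappa>\<^sup>2 * (?I2 + 2 * of_real ?a)) \<le> ?t / \<delta> ^ 3" .
    have "norm (z\<^sup>2 * \<kappa>\<^sup>2 * ?I3) \<le> 1 * (1 / \<delta>\<^sup>2) * (?t / \<delta>)"
      unfolding norm_mult using I3 \<kappa>2 z1 \<delta>
      by (intro mult_mono) (auto simp: norm_power norm_mult)
    then have 2: "norm (z\<^sup>2 * \<kappa>\<^sup>2 * ?I3) \<le> ?t / \<delta> ^ 3" by (simp add: power2_eq_square power3_eq_cube mult.commute mult.left_commute)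
    show ?thesis using norm_triangle_le[OF add_mono[OF 1 2]] by (simp add: err_def)
  qed
  have b2: "norm (1 - z * b) \<le> 2"
    using norm_triangle_ineq4[of 1 "z * b"] norm_mult_B_transform_less_1[OF M z] by (simp add: b_def)
  have eq: "b - 1 + of_real ?a * half_plane_map z = (1 - z * b) * err + of_real ?a * ((1 + z) * \<kappa>\<^sup>2 * (z * (b - 1)))"
  proof -
    have h: "half_plane_map z = (1 + z) * \<kappa>\<^sup>2 * (1 - z)"
    proof -
      have "(1 + z) * \<kappa>\<^sup>2 * (1 - z) = (1 + z) * \<kappa> * (\<kappa> * (1 - z))" by (simp add: power2_eq_square)
      also have "\<dots> = half_plane_map z" unfolding \<kappa>z by (simp add: half_plane_map_def \<kappa>_def)
      finally show ?thesis by simp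
    qed
    have "b - 1 = (1 - z * b) * (- of_real ?a * (1 + z) * \<kappa>\<^sup>2 + err)"
      using B_transform_minus_1(1)[OF M z] by (simp only: b_def G')
    then show ?thesis unfolding h by (simp add: algebra_simps)
  qed
  have "norm ((1 - z * b) * err) \<le> 2 * (2 * ?t / \<delta> ^ 3)"
    unfolding norm_mult using b2 err by (intro mult_mono) auto
  moreover have "norm (of_real ?a * ((1 + z) * \<kappa>\<^sup>2 * (z * (b - 1)))) \<le> ?a * (2 * (1 / \<delta>\<^sup>2) * (1 * (2 * ?e / \<delta>)))"
    unfolding norm_mult[of "of_real ?a"] norm_mult[of "(1 + z) * \<kappa>\<^sup>2"] norm_mult[of "1 + z"] norm_mult[of z]
    using \<kappa>2 z B_transform_minus_1(2)[OF M z] a0 \<delta> e0 norm_triangle_ineq[of 1 z]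
    by (intro mult_mono) (auto simp: b_def \<delta>_def)
  moreover have "?a * (2 * (1 / \<delta>\<^sup>2) * (1 * (2 * ?e / \<delta>))) = 4 * (?a * ?e) / \<delta> ^ 3"
    by (simp add: power2_eq_square power3_eq_cube)
  ultimately have "norm (b - 1 + of_real ?a * half_plane_map z) \<le> 2 * (2 * ?t / \<delta> ^ 3) + 4 * (?a * ?e) / \<delta> ^ 3"
    unfolding eq using norm_triangle_le add_mono by metis
  also have "\<dots> = 4 * (?t + ?a * ?e) / \<delta> ^ 3" by (simp add: add_divide_distrib[symmetric])
  finally show ?thesis by (simp add: b_def \<delta>_def)
qed

lemma half_plane_map_diff_le:
  assumes "norm w = norm z" "norm z < 1"
  shows "norm (half_plane_map w - half_plane_map z) \<le> 2 * norm (w - z) / (1 - norm z)\<^sup>2"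
proof -
  have nz: "norm (1 - w) \<ge> 1 - norm z" "norm (1 - z) \<ge> 1 - norm z"
    using norm_one_minus_mult_ge[of 1] assms by (metis dist_0_norm mem_sphere mult_1 norm_one)+
  then have "1 - w \<noteq> 0" "1 - z \<noteq> 0" using assms by auto
  then have "half_plane_map w - half_plane_map z = 2 * (w - z) / ((1 - w) * (1 - z))"
    unfolding half_plane_map_def by (simp add: field_simps)
  also have "norm \<dots> \<le> 2 * norm (w - z) / (1 - norm z)\<^sup>2"
    unfolding norm_divide norm_mult power2_eq_square using nz assms
    by (intro frac_le mult_mono) auto
  finally show ?thesis .
qed

section \<open>Row sums of triangular arrays\<close>

lemma norm_exp_minus_1_minus_le:
  fixes w :: complex
  assumes "norm w \<le> 1"
  shows "norm (exp w - 1 - w) \<le> 3 * (norm w)\<^sup>2"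
proof -
  have "norm (exp w - (\<Sum>k\<le>1. w ^ k / fact k)) \<le> exp \<bar>Re w\<bar> * norm w ^ Suc 1 / fact 1"
    by (rule Taylor_exp)
  moreover have "exp \<bar>Re w\<bar> \<le> 3"
    using exp_le[THEN order_trans[rotated]] assms abs_Re_le_cmod[of w]
    by (meson exp_le_cancel_iff order_trans)
  then have "exp \<bar>Re w\<bar> * (norm w)\<^sup>2 \<le> 3 * (norm w)\<^sup>2" by (intro mult_right_mono) auto
  ultimately show ?thesis by (simp add: diff_diff_eq numeral_2_eq_2)
qed

text \<open>Uniform smallness of the entries of the rows; only upper bounds are recorded, as all entries will be
  non-negative.\<close>

definition row_null :: "(nat \<Rightarrow> nat) \<Rightarrow> (nat \<Rightarrow> nat \<Rightarrow> real) \<Rightarrow> bool" where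
  "row_null k g \<longleftrightarrow> (\<forall>e>0. \<forall>\<^sub>F n in sequentially. \<forall>j\<in>{1..k n}. g n j < e)"

lemma row_nullD: "row_null k g \<Longrightarrow> e > 0 \<Longrightarrow> \<forall>\<^sub>F n in sequentially. \<forall>j\<in>{1..k n}. g n j < e"
  by (simp add: row_null_def)

lemma row_null_le:
  assumes "row_null k g" "\<And>n j. j \<in> {1..k n} \<Longrightarrow> f n j \<le> C * g n j" "C > 0"
  shows "row_null k f"
  unfolding row_null_def
proof (intro allI impI)
  fix e :: real assume "e > 0"
  then have "e / C > 0" using assms(3) by simp
  from row_nullD[OF assms(1) this] show "\<forall>\<^sub>F n in sequentially. \<forall>j\<in>{1..k n}. f n j < e"
  proof (rule eventually_mono, intro ballI)
    fix n j assume *: "\<forall>j\<in>{1..k n}. g n j < e / C" and j: "j \<in> {1..k n}"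
    then have "C * g n j < e" using assms(3) by (simp add: field_simps)
    then show "f n j < e" using assms(2)[OF j] by linarith
  qed
qed

lemma sum_row_null:
  assumes g: "row_null k g" and g0: "\<And>n j. j \<in> {1..k n} \<Longrightarrow> 0 \<le> g n j"
    and a0: "\<And>n j. j \<in> {1..k n} \<Longrightarrow> 0 \<le> a n j"
    and bound: "\<forall>\<^sub>F n in sequentially. (\<Sum>j=1..k n. a n j) \<le> C"
  shows "(\<lambda>n. \<Sum>j=1..k n. a n j * g n j) \<longlonglongrightarrow> 0"
proof (rule tendstoI)
  fix e :: real assume e: "e > 0"
  define \<eta> where "\<eta> = e / (\<bar>C\<bar> + 1)"
  have \<eta>: "\<eta> > 0" using e by (simp add: \<eta>_def add_nonneg_pos)
  show "\<forall>\<^sub>F n in sequentially. dist (\<Sum>j=1..k n. a n j * g n j) 0 < e"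
    using row_nullD[OF g \<eta>] bound
  proof eventually_elim
    case (elim n)
    have "(\<Sum>j=1..k n. a n j * g n j) \<le> (\<Sum>j=1..k n. a n j * \<eta>)"
      using elim(1) a0 by (intro sum_mono mult_left_mono) (auto intro: less_imp_le)
    also have "\<dots> = (\<Sum>j=1..k n. a n j) * \<eta>" by (simp add: sum_distrib_right)
    also have "\<dots> \<le> \<bar>C\<bar> * \<eta>" using elim(2) \<eta> by (intro mult_right_mono) auto
    also have "\<dots> < e" using e by (simp add: \<eta>_def field_simps add_nonneg_pos)
    finally have "(\<Sum>j=1..k n. a n j * g n j) < e" .
    moreover have "(\<Sum>j=1..k n. a n j * g n j) \<ge> 0" using a0 g0 by (intro sum_nonneg mult_nonneg_nonneg) auto
    ultimately show ?case by simp
  qed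
qed

lemma tendsto_imp_eventually_le_real:
  fixes f :: "nat \<Rightarrow> real"
  assumes "f \<longlonglongrightarrow> A" shows "\<forall>\<^sub>F n in sequentially. f n \<le> A + 1"
  using order_tendstoD(2)[OF assms, of "A + 1"] by (auto elim: eventually_mono)

text \<open>Take logarithms and use \<open>- ln (1 - a) = a + O(a\<^sup>2)\<close>; the squares sum to something negligible because the rows
  are uniformly small.\<close>

lemma sum_tendsto_if_prod_tendsto:
  assumes a: "row_null k a" and a0: "\<And>n j. j \<in> {1..k n} \<Longrightarrow> 0 \<le> a n j"
    and lim: "(\<lambda>n. \<Prod>j=1..k n. 1 - a n j) \<longlonglongrightarrow> exp (- A)"
  shows "(\<lambda>n. \<Sum>j=1..k n. a n j) \<longlonglongrightarrow> A"
proof -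
  have "((\<lambda>n. - ln (\<Prod>j=1..k n. 1 - a n j)) \<longlongrightarrow> - ln (exp (- A))) sequentially"
    by (intro tendsto_intros lim) simp
  then have L: "(\<lambda>n. - ln (\<Prod>j=1..k n. 1 - a n j)) \<longlonglongrightarrow> A" by simp
  have ev: "\<forall>\<^sub>F n in sequentially. (\<Sum>j=1..k n. a n j) \<le> - ln (\<Prod>j=1..k n. 1 - a n j) \<and>
      - ln (\<Prod>j=1..k n. 1 - a n j) \<le> (\<Sum>j=1..k n. a n j) + 2 * (\<Sum>j=1..k n. a n j * a n j)"
    using row_nullD[OF a, of "1/2", simplified]
  proof eventually_elim
    case (elim n)
    have j: "0 \<le> a n j" "a n j \<le> 1/2" if "j \<in> {1..k n}" for j
      using a0[OF that] elim that by (auto intro: less_imp_le)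
    have ln: "- ln (\<Prod>j=1..k n. 1 - a n j) = (\<Sum>j=1..k n. - ln (1 - a n j))"
      using j by (subst ln_prod) (force simp: sum_negf)+
    have "a n j \<le> - ln (1 - a n j)" "- ln (1 - a n j) \<le> a n j + 2 * (a n j * a n j)" if "j \<in> {1..k n}" for j
      using ln_one_minus_pos_upper_bound[of "a n j"] ln_one_minus_pos_lower_bound[of "a n j"] j[OF that]
      by (auto simp: power2_eq_square)
    then show ?case
      unfolding ln by (auto simp: sum_distrib_left sum.distrib[symmetric] intro!: sum_mono)
  qed
  have "\<forall>\<^sub>F n in sequentially. (\<Sum>j=1..k n. a n j) \<le> A + 1"
    using ev tendsto_imp_eventually_le_real[OF L] by eventually_elim auto
  from sum_row_null[OF a a0 a0 this]
  have sq: "(\<lambda>n. \<Sum>j=1..k n. a n j * a n j) \<longlonglongrightarrow> 0" .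
  have "(\<lambda>n. - ln (\<Prod>j=1..k n. 1 - a n j) - 2 * (\<Sum>j=1..k n. a n j * a n j)) \<longlonglongrightarrow> A - 2 * 0"
    by (intro tendsto_intros L sq)
  then have lower: "(\<lambda>n. - ln (\<Prod>j=1..k n. 1 - a n j) - 2 * (\<Sum>j=1..k n. a n j * a n j)) \<longlonglongrightarrow> A" by simp
  show ?thesis
    by (rule tendsto_sandwich[OF _ _ lower L]; use ev in \<open>rule eventually_mono\<close>; linarith)
qed

section \<open>Infinitesimal arrays of measures\<close>

locale infinitesimal_rows =
  fixes k :: "nat \<Rightarrow> nat" and \<mu> :: "nat \<Rightarrow> nat \<Rightarrow> complex measure" and l :: "nat \<Rightarrow> complex"
  assumes nonzero_mean: "\<And>n j. 1 \<le> j \<Longrightarrow> j \<le> k n \<Longrightarrow> circle_prob_nonzero_mean (\<mu> n j)"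
    and infinitesimal: "infinitesimal_array k \<mu>"
    and l: "\<And>n. l n \<in> circle"
begin

abbreviation mean :: "nat \<Rightarrow> nat \<Rightarrow> complex" where
  "mean n j \<equiv> circle_moment (\<mu> n j) 1"

text \<open>Dividing each measure by the phase of its mean makes its mean real and positive. This centring is needed
  because the phases of a row may be individually small without being summable.\<close>

definition phase :: "nat \<Rightarrow> nat \<Rightarrow> complex" where
  "phase n j = sgn (mean n j)"

definition centred :: "nat \<Rightarrow> nat \<Rightarrow> complex measure" where
  "centred n j = rotate (cnj (phase n j)) (\<mu> n j)"

abbreviation defect :: "nat \<Rightarrow> nat \<Rightarrow> real" where
  "defect n j \<equiv> mean_defect (centred n j)"

context
  fixes n j assumes j: "j \<in> {1..k n}"
begin

lemma circle_prob_\<mu>: "circle_prob (\<mu> n j)"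
  using nonzero_mean[of j n] j by (auto simp: circle_prob_nonzero_mean_def)

lemma mean_neq_0: "mean n j \<noteq> 0"
  using nonzero_mean[of j n] j by (auto simp: circle_prob_nonzero_mean_def circle_moment_def)

lemma phase: "phase n j \<in> circle" "cnj (phase n j) \<in> circle"
  using mean_neq_0 by (auto simp: phase_def norm_sgn)

lemma mean_eq: "mean n j = phase n j * of_real (norm (mean n j))"
  using mean_neq_0 by (simp add: phase_def sgn_eq)

lemma circle_prob_centred: "circle_prob (centred n j)"
  unfolding centred_def by (rule circle_prob_rotate[OF circle_prob_\<mu> phase(2)])

lemma circle_moment_centred: "circle_moment (centred n j) p = cnj (phase n j) ^ p * circle_moment (\<mu> n j) p"
  unfolding centred_def by (rule circle_moment_rotate[OF circle_prob_\<mu> phase(2)])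

lemma circle_moment_eq_centred: "circle_moment (\<mu> n j) p = phase n j ^ p * circle_moment (centred n j) p"
proof -
  have "phase n j ^ p * (cnj (phase n j) ^ p * circle_moment (\<mu> n j) p)
     = (cnj (phase n j) * phase n j) ^ p * circle_moment (\<mu> n j) p"
    by (simp add: power_mult_distrib mult_ac)
  then show ?thesis by (simp add: circle_moment_centred circle_cnj_mult[OF phase(1)])
qed

lemma mean_centred: "circle_moment (centred n j) 1 = of_real (norm (mean n j))"
proof -
  have "circle_moment (centred n j) 1 = cnj (phase n j) * phase n j * of_real (norm (mean n j))"
    unfolding circle_moment_centred power_one_right mult.assoc mean_eq[symmetric] ..
  then show ?thesis by (simp add: circle_cnj_mult[OF phase(1)])
qed

lemma defect_eq: "defect n j = 1 - norm (mean n j)"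
  unfolding mean_defect_eq[OF circle_prob_centred] mean_centred by simp

lemma mean_centred': "circle_moment (centred n j) 1 = of_real (1 - defect n j)"
  unfolding mean_centred defect_eq by simp

lemma norm_mean_minus_1: "norm (mean n j - 1) \<le> mean_deviation (\<mu> n j)"
proof -
  interpret prob_space "\<mu> n j" by (rule prob_space_circle_prob[OF circle_prob_\<mu>])
  have "integrable (\<mu> n j) (\<lambda>\<zeta>. \<zeta>)" using integrable_circle_power[OF circle_prob_\<mu>, of 1] by simp
  then have "mean n j - 1 = (LINT \<zeta>|\<mu> n j. \<zeta> - 1)" by (simp add: circle_moment_def prob_space)
  then show ?thesis unfolding mean_deviation_def by (simp only: integral_norm_bound)
qed

lemma norm_phase_minus_1: "norm (phase n j - 1) \<le> 2 * mean_deviation (\<mu> n j)"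
proof -
  have "norm (phase n j - mean n j) = 1 - norm (mean n j)"
  proof -
    have "phase n j - mean n j = phase n j * of_real (1 - norm (mean n j))"
      using mean_eq by (simp add: algebra_simps)
    then show ?thesis
      using phase(1) norm_circle_moment_le_1[OF circle_prob_\<mu>, of 1] by (simp add: norm_mult del: of_real_diff)
  qed
  also have "\<dots> \<le> norm (mean n j - 1)" using norm_triangle_ineq3[of 1 "mean n j"] by (simp add: norm_minus_commute)
  finally show ?thesis
    using norm_triangle_ineq[of "phase n j - mean n j" "mean n j - 1"] norm_mean_minus_1 by simp
qed

lemma mean_deviation_centred: "mean_deviation (centred n j) \<le> 3 * mean_deviation (\<mu> n j)"
proof -
  interpret prob_space "\<mu> n j" by (rule prob_space_circle_prob[OF circle_prob_\<mu>])
  have "mean_deviation (centred n j) = (LINT \<zeta>|\<mu> n j. norm (cnj (phase n j) * \<zeta> - 1))"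
    unfolding mean_deviation_def centred_def
    by (rule integral_rotate[OF circle_prob_\<mu> phase(2)]) (intro continuous_intros)
  also have "\<dots> \<le> (LINT \<zeta>|\<mu> n j. norm (\<zeta> - 1) + norm (phase n j - 1))"
  proof (rule integral_circle_mono[OF circle_prob_\<mu>])
    fix \<zeta>
    have "cnj (phase n j) * \<zeta> - 1 = cnj (phase n j) * (\<zeta> - phase n j)"
      using circle_cnj_mult[OF phase(1)] by (simp add: algebra_simps)
    then have "norm (cnj (phase n j) * \<zeta> - 1) = norm (\<zeta> - phase n j)"
      using phase(1) by (simp add: norm_mult)
    also have "\<dots> \<le> norm (\<zeta> - 1) + norm (phase n j - 1)"
      using norm_triangle_ineq4[of "\<zeta> - 1" "phase n j - 1"] by simp
    finally show "norm (cnj (phase n j) * \<zeta> - 1) \<le> norm (\<zeta> - 1) + norm (phase n j - 1)" .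
  qed (intro continuous_intros)+
  also have "\<dots> = mean_deviation (\<mu> n j) + norm (phase n j - 1)"
  proof -
    have "integrable (\<mu> n j) (\<lambda>\<zeta>. norm (\<zeta> - 1))"
      by (intro continuous_imp_integrable_circle circle_prob_\<mu> continuous_intros)
    then show ?thesis by (simp add: mean_deviation_def prob_space)
  qed
  finally show ?thesis using norm_phase_minus_1 by simp
qed

text \<open>Split at distance \<open>e\<close> from \<open>1\<close>; no two points of the circle are further apart than \<open>2\<close>.\<close>

lemma mean_deviation_le:
  assumes e: "e > 0"
  shows "mean_deviation (\<mu> n j) \<le> e + 2 * measure (\<mu> n j) {\<zeta>\<in>circle. cmod (\<zeta> - 1) \<ge> e}"
proof -
  interpret prob_space "\<mu> n j" by (rule prob_space_circle_prob[OF circle_prob_\<mu>])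
  let ?S = "{\<zeta>\<in>circle. cmod (\<zeta> - 1) \<ge> e}"
  have S: "?S \<in> sets (\<mu> n j)"
  proof -
    have "?S = circle \<inter> {\<zeta>. cmod (\<zeta> - 1) \<ge> e}" by auto
    moreover have "{\<zeta>. cmod (\<zeta> - 1) \<ge> e} \<in> sets borel" by measurable
    ultimately show ?thesis unfolding sets_circle_prob[OF circle_prob_\<mu>] sets_restrict_space by blast
  qed
  have int: "integrable (\<mu> n j) (indicator ?S :: complex \<Rightarrow> real)"
    using S by (simp add: less_top[symmetric])
  have "mean_deviation (\<mu> n j) \<le> (LINT \<zeta>|\<mu> n j. e + 2 * indicator ?S \<zeta>)"
    unfolding mean_deviation_def
  proof (rule integral_mono)
    show "integrable (\<mu> n j) (\<lambda>\<zeta>. norm (\<zeta> - 1))"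
      by (intro continuous_imp_integrable_circle circle_prob_\<mu> continuous_intros)
    show "integrable (\<mu> n j) (\<lambda>\<zeta>. e + 2 * indicator ?S \<zeta>)" using int by simp
    fix \<zeta> assume "\<zeta> \<in> space (\<mu> n j)"
    then have "\<zeta> \<in> circle" using space_circle_prob[OF circle_prob_\<mu>] by simp
    then show "norm (\<zeta> - 1) \<le> e + 2 * indicator ?S \<zeta>"
      using norm_triangle_ineq4[of \<zeta> 1] e by (auto simp: indicator_def)
  qed
  also have "\<dots> = e + 2 * measure (\<mu> n j) ?S" using int S by (simp add: prob_space)
  finally show ?thesis .
qed

end

lemma row_null_mean_deviation: "row_null k (\<lambda>n j. mean_deviation (\<mu> n j))"
  unfolding row_null_def
proof (intro allI impI)
  fix e :: real assume e: "e > 0"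
  let ?S = "{\<zeta>\<in>circle. cmod (\<zeta> - 1) \<ge> e / 2}"
  have "(\<lambda>n. Max ((\<lambda>j. measure (\<mu> n j) ?S) ` {1..k n})) \<longlonglongrightarrow> 0"
    using infinitesimal e unfolding infinitesimal_array_def by (meson half_gt_zero)
  from order_tendstoD(2)[OF this, of "e / 4"] e
  have "\<forall>\<^sub>F n in sequentially. Max ((\<lambda>j. measure (\<mu> n j) ?S) ` {1..k n}) < e / 4" by simp
  then show "\<forall>\<^sub>F n in sequentially. \<forall>j\<in>{1..k n}. mean_deviation (\<mu> n j) < e"
  proof (rule eventually_mono, intro ballI)
    fix n j assume *: "Max ((\<lambda>j. measure (\<mu> n j) ?S) ` {1..k n}) < e / 4" and j: "j \<in> {1..k n}"
    have "measure (\<mu> n j) ?S \<le> Max ((\<lambda>j. measure (\<mu> n j) ?S) ` {1..k n})"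
      using j by (intro Max_ge) auto
    then show "mean_deviation (\<mu> n j) < e" using * mean_deviation_le[OF j, of "e / 2"] e by linarith
  qed
qed

lemma row_null_mean: "row_null k (\<lambda>n j. norm (mean n j - 1))"
  by (rule row_null_le[OF row_null_mean_deviation, where C = 1]) (use norm_mean_minus_1 in auto)

lemma row_null_phase: "row_null k (\<lambda>n j. norm (phase n j - 1))"
  by (rule row_null_le[OF row_null_mean_deviation, where C = 2]) (use norm_phase_minus_1 in auto)

lemma row_null_centred: "row_null k (\<lambda>n j. mean_deviation (centred n j))"
  by (rule row_null_le[OF row_null_mean_deviation, where C = 3]) (use mean_deviation_centred in auto)

lemma row_null_defect: "row_null k defect"
proof (rule row_null_le[OF row_null_mean, where C = 1])
  fix n j assume j: "j \<in> {1..k n}"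
  show "defect n j \<le> 1 * norm (mean n j - 1)"
    unfolding defect_eq[OF j] using norm_triangle_ineq3[of 1 "mean n j"] by (simp add: norm_minus_commute)
qed simp

lemma defect_nonneg: "j \<in> {1..k n} \<Longrightarrow> 0 \<le> defect n j"
  by (rule mean_defect_nonneg[OF circle_prob_centred])

definition row_mean :: "nat \<Rightarrow> complex" where
  "row_mean n = l n * (\<Prod>j=1..k n. mean n j)"

lemma norm_row_mean: "norm (row_mean n) = (\<Prod>j=1..k n. 1 - defect n j)"
  using l[of n] by (simp add: row_mean_def norm_mult prod_norm[symmetric] defect_eq)

lemma sum_defect_tendsto:
  assumes "(\<lambda>n. norm (row_mean n)) \<longlonglongrightarrow> exp (- A)"
  shows "(\<lambda>n. \<Sum>j=1..k n. defect n j) \<longlonglongrightarrow> A"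
proof (rule sum_tendsto_if_prod_tendsto[OF row_null_defect])
  show "0 \<le> defect n j" if "j \<in> {1..k n}" for n j using that by (rule defect_nonneg)
  show "(\<lambda>n. \<Prod>j=1..k n. 1 - defect n j) \<longlonglongrightarrow> exp (- A)" using assms unfolding norm_row_mean .
qed

context
  fixes A assumes A: "(\<lambda>n. \<Sum>j=1..k n. defect n j) \<longlonglongrightarrow> A"
begin

lemma sum_defect_row_null:
  assumes "row_null k g" "\<And>n j. j \<in> {1..k n} \<Longrightarrow> 0 \<le> g n j"
  shows "(\<lambda>n. \<Sum>j=1..k n. defect n j * g n j) \<longlonglongrightarrow> 0"
  by (rule sum_row_null[OF assms defect_nonneg tendsto_imp_eventually_le_real[OF A]])

lemma sum_defect_square: "(\<lambda>n. \<Sum>j=1..k n. (defect n j)\<^sup>2) \<longlonglongrightarrow> 0"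
  using sum_defect_row_null[OF row_null_defect defect_nonneg] by (simp add: power2_eq_square)

lemma square_defect_tendsto_if_bound:
  assumes u: "u \<longlonglongrightarrow> 0"
    and le: "\<forall>\<^sub>F n in sequentially. (\<Sum>j=1..k n. square_defect (centred n j)) \<le> u n"
  shows "(\<lambda>n. \<Sum>j=1..k n. square_defect (centred n j)) \<longlonglongrightarrow> 0"
  by (rule tendsto_sandwich[OF _ le tendsto_const u])
    (auto intro!: always_eventually sum_nonneg square_defect_nonneg circle_prob_centred)

text \<open>By \<open>Re_circle_moment_2\<close> the real part of \<open>Q = E \<xi>\<^sup>2 - r\<^sup>2\<close>, for a centred measure with mean \<open>r\<close>, equals
  \<open>- 2 * a + 2 * d - a\<^sup>2\<close> with \<open>a\<close> the mean defect and \<open>d\<close> the square defect. The logarithmic derivative differs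
  from \<open>Q\<close> only by \<open>O(a)\<close> times a uniformly small factor. So its row sums tend to \<open>- 2 * A\<close>, the smallest value that
  the mean defects allow, only if the square defects sum to zero.\<close>

lemma square_defect_tendsto_if_B_log_derivative:
  assumes lim: "(\<lambda>n. \<Sum>j=1..k n. B_log_derivative (\<mu> n j)) \<longlonglongrightarrow> of_real (- 2 * A)"
  shows "(\<lambda>n. \<Sum>j=1..k n. square_defect (centred n j)) \<longlonglongrightarrow> 0"
proof (rule square_defect_tendsto_if_bound)
  let ?u = "\<lambda>n. (Re (\<Sum>j=1..k n. B_log_derivative (\<mu> n j)) + 8 * (\<Sum>j=1..k n. defect n j * norm (mean n j - 1))
      + 2 * (\<Sum>j=1..k n. defect n j) + (\<Sum>j=1..k n. (defect n j)\<^sup>2)) / 2"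
  have "?u \<longlonglongrightarrow> (Re (of_real (- 2 * A)) + 8 * 0 + 2 * A + 0) / 2"
    by (intro tendsto_intros lim A sum_defect_square sum_defect_row_null row_null_mean) auto
  then show "?u \<longlonglongrightarrow> 0" by simp
  have "\<forall>\<^sub>F n in sequentially. \<forall>j\<in>{1..k n}. defect n j < 1/2"
    by (rule row_nullD[OF row_null_defect]) simp
  then show "\<forall>\<^sub>F n in sequentially. (\<Sum>j=1..k n. square_defect (centred n j)) \<le> ?u n"
  proof eventually_elim
    case (elim n)
    have "square_defect (centred n j) \<le> (Re (B_log_derivative (\<mu> n j)) + 8 * (defect n j * norm (mean n j - 1))
        + 2 * defect n j + (defect n j)\<^sup>2) / 2" if j: "j \<in> {1..k n}" for j
    proof -
      define r where "r = norm (mean n j)"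
      define c where "c = phase n j"
      have a: "defect n j = 1 - r" using defect_eq[OF j] by (simp add: r_def)
      have r: "r \<ge> 1/2" using elim j a by fastforce
      \<comment> \<open>\<open>Q\<close> is of the order of the defect, so the factor \<open>c / r\<close> may be replaced by \<open>1\<close>\<close>
      define Q where "Q = circle_moment (centred n j) 2 - (of_real r)\<^sup>2"
      have m: "mean n j = c * of_real r" using mean_eq[OF j] by (simp add: c_def r_def)
      have c0: "c \<noteq> 0" "cnj c * c = 1" using phase(1)[OF j] circle_cnj_mult[OF phase(1)[OF j]] by (auto simp: c_def)
      have "circle_moment (\<mu> n j) 2 - (mean n j)\<^sup>2 = c\<^sup>2 * Q"
        unfolding m circle_moment_eq_centred[OF j, of 2] Q_def c_def[symmetric]
        by (simp add: power_mult_distrib algebra_simps)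
      then have q: "B_log_derivative (\<mu> n j) = c * Q / of_real r"
        unfolding B_log_derivative_def m using c0 r by (simp add: field_simps power2_eq_square)
      have 1: "Q - B_log_derivative (\<mu> n j) = Q * (of_real r - c) / of_real r"
        unfolding q using r by (simp add: field_simps)
      have 2: "norm (of_real r - c) = norm (mean n j - of_real (r\<^sup>2)) / r"
      proof -
        have "mean n j - of_real (r\<^sup>2) = of_real r * (c - of_real r)"
          unfolding m by (simp add: power2_eq_square algebra_simps)
        then show ?thesis using r by (simp add: norm_mult norm_minus_commute)
      qed
      have 3: "norm (mean n j - of_real (r\<^sup>2)) \<le> norm (mean n j - 1)"
      proof -
        have "of_real (r\<^sup>2) = mean n j * cnj (mean n j)" unfolding r_def by (rule complex_norm_square)
        then have "mean n j - of_real (r\<^sup>2) = mean n j * cnj (1 - mean n j)" by (simp add: algebra_simps)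
        then show ?thesis
          using norm_circle_moment_le_1[OF circle_prob_\<mu>[OF j], of 1]
          by (simp add: norm_mult norm_minus_commute mult_left_le_one_le del: complex_cnj_diff)
      qed
      have 4: "norm Q \<le> 2 * defect n j"
      proof -
        have "norm Q \<le> 1 - r\<^sup>2"
          using norm_circle_moment_2_minus_square[OF circle_prob_centred[OF j]]
          unfolding mean_centred[OF j] by (simp add: Q_def r_def)
        also have "\<dots> \<le> 2 * (1 - r)" using zero_le_power2[of "1 - r"] by (simp add: power2_eq_square algebra_simps)
        finally show ?thesis by (simp add: a)
      qed
      have "norm (Q - B_log_derivative (\<mu> n j)) = norm Q * (norm (mean n j - of_real (r\<^sup>2)) / r\<^sup>2)"
        unfolding 1 norm_divide norm_mult 2 using r by (simp add: power2_eq_square)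
      also have "\<dots> \<le> 2 * defect n j * (norm (mean n j - 1) / (1 / 4))"
        using 3 4 r defect_nonneg[OF j] power_mono[OF r, of 2] by (intro mult_mono frac_le) (auto simp: power2_eq_square)
      finally have "norm (Q - B_log_derivative (\<mu> n j)) \<le> 8 * (defect n j * norm (mean n j - 1))" by simp
      then have "Re Q \<le> Re (B_log_derivative (\<mu> n j)) + 8 * (defect n j * norm (mean n j - 1))"
        using complex_Re_le_cmod[of "Q - B_log_derivative (\<mu> n j)"] by simp
      moreover have "Re Q = 2 * square_defect (centred n j) - 2 * defect n j - (defect n j)\<^sup>2"
      proof -
        have r: "r = 1 - defect n j" using a by simp
        show ?thesis
          unfolding Q_def r using Re_circle_moment_2[OF circle_prob_centred[OF j]]
          by (simp add: power2_eq_square algebra_simps)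
      qed
      ultimately show ?thesis by simp
    qed
    then have "(\<Sum>j=1..k n. square_defect (centred n j)) \<le> (\<Sum>j=1..k n. (Re (B_log_derivative (\<mu> n j)) + 8 * (defect n j * norm (mean n j - 1))
        + 2 * defect n j + (defect n j)\<^sup>2) / 2)" by (rule sum_mono)
    also have "\<dots> = ?u n" by (simp add: sum.distrib sum_distrib_left sum_divide_distrib[symmetric])
    finally show ?case .
  qed
qed

text \<open>The analogue for classical convolution: \<open>norm (E \<xi>\<^sup>2) \<ge> Re (E \<xi>\<^sup>2) = 1 - (4 * a - 2 * d)\<close>. Only absolute values
  enter, so no choice of a branch of the logarithm is necessary.\<close>

lemma square_defect_tendsto_if_second_moments:
  assumes lim: "(\<lambda>n. \<Prod>j=1..k n. norm (circle_moment (\<mu> n j) 2)) \<longlonglongrightarrow> exp (- 4 * A)"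
  shows "(\<lambda>n. \<Sum>j=1..k n. square_defect (centred n j)) \<longlonglongrightarrow> 0"
proof (rule square_defect_tendsto_if_bound)
  let ?u = "\<lambda>n. (ln (\<Prod>j=1..k n. norm (circle_moment (\<mu> n j) 2)) + 4 * (\<Sum>j=1..k n. defect n j)
      + 32 * (\<Sum>j=1..k n. (defect n j)\<^sup>2)) / 2"
  have "(?u \<longlongrightarrow> (ln (exp (- 4 * A)) + 4 * A + 32 * 0) / 2) sequentially"
    by (intro tendsto_intros lim A sum_defect_square) auto
  then show "?u \<longlonglongrightarrow> 0" by simp
  have "\<forall>\<^sub>F n in sequentially. \<forall>j\<in>{1..k n}. defect n j < 1/8"
    by (rule row_nullD[OF row_null_defect]) simp
  then show "\<forall>\<^sub>F n in sequentially. (\<Sum>j=1..k n. square_defect (centred n j)) \<le> ?u n"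
  proof eventually_elim
    case (elim n)
    have *: "norm (circle_moment (\<mu> n j) 2) > 0 \<and> square_defect (centred n j)
        \<le> (ln (norm (circle_moment (\<mu> n j) 2)) + 4 * defect n j + 32 * (defect n j)\<^sup>2) / 2"
      if j: "j \<in> {1..k n}" for j
    proof -
      define y where "y = 4 * defect n j - 2 * square_defect (centred n j)"
      note R = circle_prob_centred[OF j]
      have a: "0 \<le> defect n j" "defect n j < 1/8" using elim j defect_nonneg by auto
      have y: "0 \<le> y" "y \<le> 4 * defect n j"
        using square_defect_le[OF R] square_defect_nonneg[OF R] by (auto simp: y_def)
      have "norm (circle_moment (\<mu> n j) 2) = norm (circle_moment (centred n j) 2)"
        using phase(1)[OF j] by (simp add: circle_moment_eq_centred[OF j, of 2] norm_mult norm_power)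
      then have ge: "1 - y \<le> norm (circle_moment (\<mu> n j) 2)"
        using complex_Re_le_cmod[of "circle_moment (centred n j) 2"] Re_circle_moment_2[OF R] by (simp add: y_def)
      have pos: "1 - y > 0" using y a by linarith
      have "- y - 2 * y\<^sup>2 \<le> ln (1 - y)" by (rule ln_one_minus_pos_lower_bound) (use y a in auto)
      also have "\<dots> \<le> ln (norm (circle_moment (\<mu> n j) 2))" using ge pos by (simp add: ln_mono)
      finally have "- y - 2 * y\<^sup>2 \<le> ln (norm (circle_moment (\<mu> n j) 2))" .
      moreover have "y\<^sup>2 \<le> 16 * (defect n j)\<^sup>2" using power_mono[OF y(2,1), of 2] by (simp add: power_mult_distrib)
      ultimately show ?thesis using ge pos unfolding y_def by auto
    qed
    then have "(\<Sum>j=1..k n. square_defect (centred n j))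
      \<le> (\<Sum>j=1..k n. (ln (norm (circle_moment (\<mu> n j) 2)) + 4 * defect n j + 32 * (defect n j)\<^sup>2) / 2)"
      by (intro sum_mono) blast
    also have "\<dots> = ((\<Sum>j=1..k n. ln (norm (circle_moment (\<mu> n j) 2))) + 4 * (\<Sum>j=1..k n. defect n j)
      + 32 * (\<Sum>j=1..k n. (defect n j)\<^sup>2)) / 2"
      by (simp add: sum.distrib sum_distrib_left sum_divide_distrib[symmetric])
    also have "(\<Sum>j=1..k n. ln (norm (circle_moment (\<mu> n j) 2))) = ln (\<Prod>j=1..k n. norm (circle_moment (\<mu> n j) 2))"
      using * by (intro ln_prod[symmetric]) auto
    finally show ?case .
  qed
qed

context
  assumes D: "(\<lambda>n. \<Sum>j=1..k n. square_defect (centred n j)) \<longlonglongrightarrow> 0"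
begin

lemma sum_cubic_deviation: "(\<lambda>n. \<Sum>j=1..k n. cubic_deviation (centred n j)) \<longlonglongrightarrow> 0"
proof (rule tendstoI)
  fix e :: real assume e: "e > 0"
  define \<eta> where "\<eta> = e / (2 * (\<bar>A\<bar> + 1))"
  have \<eta>: "\<eta> > 0" using e by (simp add: \<eta>_def add_nonneg_pos)
  have "\<eta> * A \<le> \<eta> * \<bar>A\<bar>" using \<eta> by (intro mult_left_mono) auto
  also have "\<dots> < e" using e by (simp add: \<eta>_def field_simps add_nonneg_pos)
  finally have "\<eta> * A + 2 / \<eta> * 0 < e" by simp
  moreover have "(\<lambda>n. \<eta> * (\<Sum>j=1..k n. defect n j) + 2 / \<eta> * (\<Sum>j=1..k n. square_defect (centred n j)))
      \<longlonglongrightarrow> \<eta> * A + 2 / \<eta> * 0"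
    by (intro tendsto_intros A D)
  ultimately have "\<forall>\<^sub>F n in sequentially. \<eta> * (\<Sum>j=1..k n. defect n j) + 2 / \<eta> * (\<Sum>j=1..k n. square_defect (centred n j)) < e"
    by (rule order_tendstoD(2)[rotated])
  then show "\<forall>\<^sub>F n in sequentially. dist (\<Sum>j=1..k n. cubic_deviation (centred n j)) 0 < e"
  proof eventually_elim
    case (elim n)
    have "(\<Sum>j=1..k n. cubic_deviation (centred n j)) \<le> (\<Sum>j=1..k n. \<eta> * defect n j + 2 / \<eta> * square_defect (centred n j))"
      by (intro sum_mono cubic_deviation_le circle_prob_centred \<eta>)
    also have "\<dots> = \<eta> * (\<Sum>j=1..k n. defect n j) + 2 / \<eta> * (\<Sum>j=1..k n. square_defect (centred n j))"
      by (simp only: sum.distrib sum_distrib_left)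
    finally have "(\<Sum>j=1..k n. cubic_deviation (centred n j)) < e" using elim by linarith
    moreover have "0 \<le> (\<Sum>j=1..k n. cubic_deviation (centred n j))"
      by (intro sum_nonneg cubic_deviation_nonneg circle_prob_centred)
    ultimately show ?case by simp
  qed
qed

text \<open>Compare the product with that of \<open>exp (- a * h)\<close>. All factors lie in the unit disk, so the products differ by
  at most the sum of the differences of the factors.\<close>

lemma prod_tendsto_exp:
  assumes f: "\<And>n j. j \<in> {1..k n} \<Longrightarrow> norm (f n j) \<le> 1" and h: "Re h \<ge> 0"
    and err: "(\<lambda>n. \<Sum>j=1..k n. norm (f n j - 1 + of_real (defect n j) * h)) \<longlonglongrightarrow> 0"
  shows "(\<lambda>n. \<Prod>j=1..k n. f n j) \<longlonglongrightarrow> exp (- of_real A * h)"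
proof -
  \<comment> \<open>the comparison factors, whose product over a row is explicit\<close>
  define w where "w = (\<lambda>n j. exp (- of_real (defect n j) * h))"
  have prod_w: "(\<Prod>j=1..k n. w n j) = exp (- of_real (\<Sum>j=1..k n. defect n j) * h)" for n
    unfolding w_def by (simp add: exp_sum[symmetric] sum_negf sum_distrib_right)
  have w_lim: "(\<lambda>n. \<Prod>j=1..k n. w n j) \<longlonglongrightarrow> exp (- of_real A * h)"
    unfolding prod_w by (intro tendsto_intros A)
  let ?e = "\<lambda>n. (\<Sum>j=1..k n. norm (f n j - 1 + of_real (defect n j) * h))
      + 3 * (norm h)\<^sup>2 * (\<Sum>j=1..k n. (defect n j)\<^sup>2)"
  have "?e \<longlonglongrightarrow> 0 + 3 * (norm h)\<^sup>2 * 0" by (intro tendsto_intros err sum_defect_square)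
  then have e: "?e \<longlonglongrightarrow> 0" by simp
  have "\<forall>\<^sub>F n in sequentially. \<forall>j\<in>{1..k n}. defect n j < 1 / (norm h + 1)"
    by (rule row_nullD[OF row_null_defect]) (simp add: add_nonneg_pos)
  then have "\<forall>\<^sub>F n in sequentially. norm ((\<Prod>j=1..k n. f n j) - (\<Prod>j=1..k n. w n j)) \<le> ?e n"
  proof eventually_elim
    case (elim n)
    have "norm (f n j - w n j) \<le> norm (f n j - 1 + of_real (defect n j) * h) + 3 * (norm h)\<^sup>2 * (defect n j)\<^sup>2"
      if j: "j \<in> {1..k n}" for j
    proof -
      define u where "u = - of_real (defect n j) * h"
      have a: "0 \<le> defect n j" "defect n j < 1 / (norm h + 1)" using elim j defect_nonneg[OF j] by (auto simp: add_nonneg_pos)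
      have "norm u = defect n j * norm h" using a by (simp add: u_def norm_mult)
      also have "\<dots> \<le> 1 / (norm h + 1) * (norm h + 1)" using a by (intro mult_mono) auto
      also have "\<dots> = 1" using norm_ge_zero[of h] by (simp add: add_nonneg_eq_0_iff)
      finally have "norm u \<le> 1" .
      then have "norm (exp u - 1 - u) \<le> 3 * (norm u)\<^sup>2" by (rule norm_exp_minus_1_minus_le)
      also have "\<dots> = 3 * (norm h)\<^sup>2 * (defect n j)\<^sup>2" using a by (simp add: u_def norm_mult power_mult_distrib)
      finally show ?thesis
        using norm_triangle_ineq4[of "f n j - 1 + of_real (defect n j) * h" "exp u - 1 - u"]
        by (simp add: w_def u_def)
    qed
    moreover have "norm (w n j) \<le> 1" if "j \<in> {1..k n}" for j
      using defect_nonneg[OF that] h by (simp add: w_def)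
    ultimately have "norm ((\<Prod>j=1..k n. f n j) - (\<Prod>j=1..k n. w n j))
      \<le> (\<Sum>j=1..k n. norm (f n j - 1 + of_real (defect n j) * h) + 3 * (norm h)\<^sup>2 * (defect n j)\<^sup>2)"
      using f by (intro order_trans[OF norm_prod_diff] sum_mono) auto
    also have "\<dots> = ?e n" by (simp only: sum.distrib sum_distrib_left)
    finally show ?case .
  qed
  then have "(\<lambda>n. (\<Prod>j=1..k n. f n j) - (\<Prod>j=1..k n. w n j)) \<longlonglongrightarrow> 0"
    by (rule Lim_null_comparison[OF _ e])
  from tendsto_add[OF this w_lim] show ?thesis by simp
qed

lemma prod_centred_moment_tendsto:
  "(\<lambda>n. \<Prod>j=1..k n. circle_moment (centred n j) p) \<longlonglongrightarrow> exp (- of_real ((real p)\<^sup>2 * A))"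
proof -
  have "(\<lambda>n. \<Prod>j=1..k n. circle_moment (centred n j) p) \<longlonglongrightarrow> exp (- of_real A * of_real ((real p)\<^sup>2))"
  proof (rule prod_tendsto_exp)
    let ?C = "real p ^ 3 + (real p)\<^sup>2"
    have "(\<lambda>n. ?C * (\<Sum>j=1..k n. cubic_deviation (centred n j))) \<longlonglongrightarrow> ?C * 0"
      by (intro tendsto_intros sum_cubic_deviation)
    then have lim: "(\<lambda>n. ?C * (\<Sum>j=1..k n. cubic_deviation (centred n j))) \<longlonglongrightarrow> 0" by simp
    have le: "(\<Sum>j=1..k n. norm (circle_moment (centred n j) p - 1 + of_real (defect n j) * of_real ((real p)\<^sup>2)))
        \<le> ?C * (\<Sum>j=1..k n. cubic_deviation (centred n j))" for n
      unfolding sum_distrib_left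
    proof (rule sum_mono)
      fix j assume j: "j \<in> {1..k n}"
      show "norm (circle_moment (centred n j) p - 1 + of_real (defect n j) * of_real ((real p)\<^sup>2))
          \<le> ?C * cubic_deviation (centred n j)"
        using circle_moment_approx[OF circle_prob_centred[OF j] mean_centred'[OF j], of p] by (simp add: mult.commute)
    qed
    show "(\<lambda>n. \<Sum>j=1..k n. norm (circle_moment (centred n j) p - 1 + of_real (defect n j) * of_real ((real p)\<^sup>2))) \<longlonglongrightarrow> 0"
      by (rule tendsto_sandwich[OF _ _ tendsto_const lim]) (use le in \<open>auto intro!: always_eventually sum_nonneg\<close>)
  qed (use norm_circle_moment_le_1[OF circle_prob_centred] in auto)
  then show ?thesis by (simp add: mult.commute)
qed

lemma prod_centred_B_transform_tendsto:
  assumes z: "norm z < 1"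
  shows "(\<lambda>n. \<Prod>j=1..k n. B_transform (centred n j) (phase n j * z)) \<longlonglongrightarrow> exp (- of_real A * half_plane_map z)"
proof (rule prod_tendsto_exp)
  define \<delta> where "\<delta> = 1 - norm z"
  have nw: "norm (phase n j * z) = norm z" if "j \<in> {1..k n}" for n j
    using phase(1)[OF that] by (simp add: norm_mult)
  show "norm (B_transform (centred n j) (phase n j * z)) \<le> 1" if "j \<in> {1..k n}" for n j
    by (rule norm_B_transform_le_1[OF circle_prob_centred[OF that]]) (simp add: nw[OF that] z)
  show "Re (half_plane_map z) \<ge> 0" using Re_half_plane_map_pos[OF z] by simp
  let ?T = "\<lambda>n. \<Sum>j=1..k n. cubic_deviation (centred n j)"
  let ?E = "\<lambda>n. \<Sum>j=1..k n. defect n j * mean_deviation (centred n j)"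
  let ?P = "\<lambda>n. \<Sum>j=1..k n. defect n j * norm (phase n j - 1)"
  let ?u = "\<lambda>n. 4 / \<delta> ^ 3 * ?T n + 4 / \<delta> ^ 3 * ?E n + 2 / \<delta>\<^sup>2 * ?P n"
  have "?u \<longlonglongrightarrow> 4 / \<delta> ^ 3 * 0 + 4 / \<delta> ^ 3 * 0 + 2 / \<delta>\<^sup>2 * 0"
    by (intro tendsto_intros sum_cubic_deviation sum_defect_row_null row_null_centred row_null_phase
        mean_deviation_nonneg circle_prob_centred norm_ge_zero)
  then have u: "?u \<longlonglongrightarrow> 0" by simp
  have le: "(\<Sum>j=1..k n. norm (B_transform (centred n j) (phase n j * z) - 1 + of_real (defect n j) * half_plane_map z)) \<le> ?u n" for n
    unfolding sum_distrib_left sum.distrib[symmetric]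
  proof (rule sum_mono)
    fix j assume j: "j \<in> {1..k n}"
    let ?R = "centred n j" and ?w = "phase n j * z"
    note R = circle_prob_centred[OF j]
    have 1: "norm (B_transform ?R ?w - 1 + of_real (defect n j) * half_plane_map ?w)
        \<le> 4 * (cubic_deviation ?R + defect n j * mean_deviation ?R) / \<delta> ^ 3"
      using B_transform_approx[OF R mean_centred'[OF j], of ?w] by (simp add: nw[OF j] z \<delta>_def)
    have "norm (half_plane_map ?w - half_plane_map z) \<le> 2 * norm (phase n j - 1) / \<delta>\<^sup>2"
    proof -
      have "norm (?w - z) \<le> norm (phase n j - 1)"
        using z by (simp add: left_diff_distrib[of _ 1 z, simplified, symmetric] norm_mult mult_right_le_one_le)
      then have "2 * norm (?w - z) / \<delta>\<^sup>2 \<le> 2 * norm (phase n j - 1) / \<delta>\<^sup>2" by (intro divide_right_mono) auto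
      then show ?thesis using half_plane_map_diff_le[OF nw[OF j] z] by (simp add: \<delta>_def)
    qed
    from mult_left_mono[OF this defect_nonneg[OF j]]
    have 2: "norm (of_real (defect n j) * (half_plane_map ?w - half_plane_map z)) \<le> defect n j * (2 * norm (phase n j - 1) / \<delta>\<^sup>2)"
      using defect_nonneg[OF j] by (simp add: norm_mult)
    have "norm (B_transform ?R ?w - 1 + of_real (defect n j) * half_plane_map z)
      \<le> 4 * (cubic_deviation ?R + defect n j * mean_deviation ?R) / \<delta> ^ 3 + defect n j * (2 * norm (phase n j - 1) / \<delta>\<^sup>2)"
      using norm_triangle_ineq4[of "B_transform ?R ?w - 1 + of_real (defect n j) * half_plane_map ?w"
          "of_real (defect n j) * (half_plane_map ?w - half_plane_map z)"] 1 2
      by (simp add: algebra_simps)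
    then show "norm (B_transform ?R ?w - 1 + of_real (defect n j) * half_plane_map z)
      \<le> 4 / \<delta> ^ 3 * cubic_deviation ?R + 4 / \<delta> ^ 3 * (defect n j * mean_deviation ?R) + 2 / \<delta>\<^sup>2 * (defect n j * norm (phase n j - 1))"
      by (simp add: add_divide_distrib distrib_left mult_ac)
  qed
  show "(\<lambda>n. \<Sum>j=1..k n. norm (B_transform (centred n j) (phase n j * z) - 1 + of_real (defect n j) * half_plane_map z)) \<longlonglongrightarrow> 0"
    by (rule tendsto_sandwich[OF _ _ tendsto_const u]) (use le in \<open>auto intro!: always_eventually sum_nonneg\<close>)
qed

end

end

definition row_phase :: "nat \<Rightarrow> complex" where
  "row_phase n = l n * (\<Prod>j=1..k n. phase n j)"

lemma row_phase_eq: "row_phase n = sgn (row_mean n)"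
proof -
  have sgn_prod: "sgn (\<Prod>j\<in>J. f j) = (\<Prod>j\<in>J. sgn (f j))" for J :: "nat set" and f :: "nat \<Rightarrow> complex"
    by (induction J rule: infinite_finite_induct) (auto simp: sgn_mult)
  have "sgn (l n) = l n" using l[of n] by (simp add: sgn_div_norm)
  then show ?thesis by (simp add: row_phase_def row_mean_def sgn_mult phase_def sgn_prod)
qed

text \<open>Here \<open>2 * A\<close> is forced by the means: \<open>norm (E \<zeta>) = exp (- t / 2)\<close> for a wrapped Gaussian law of variance \<open>t\<close>,
  but \<open>exp (- A)\<close> for the boolean one with parameter \<open>A\<close>.\<close>

lemma row_convs_tendsto:
  assumes m: "row_mean \<longlonglongrightarrow> \<gamma> * exp (- of_real A)" and \<gamma>: "\<gamma> \<in> circle" and A: "A > 0"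
    and D: "(\<lambda>n. \<Sum>j=1..k n. square_defect (centred n j)) \<longlonglongrightarrow> 0"
  shows "weak_conv_circle (\<lambda>n. row_conv boolean_conv (l n) (\<mu> n) (k n)) (boolean_gaussian \<gamma> A)"
    and "weak_conv_circle (\<lambda>n. row_conv circle_conv (l n) (\<mu> n) (k n)) (wrapped_gaussian (Arg \<gamma>) (2 * A))"
proof -
  have "(\<lambda>n. norm (row_mean n)) \<longlonglongrightarrow> norm (\<gamma> * exp (- of_real A))" by (intro tendsto_intros m)
  then have "(\<lambda>n. norm (row_mean n)) \<longlonglongrightarrow> exp (- A)" using \<gamma> by (simp add: norm_mult)
  note A' = sum_defect_tendsto[OF this]
  have "(\<lambda>n. sgn (row_mean n)) \<longlonglongrightarrow> sgn (\<gamma> * exp (- of_real A))"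
    by (intro tendsto_sgn m) (use \<gamma> in auto)
  moreover have "sgn (\<gamma> * exp (- of_real A)) = \<gamma>" using \<gamma> by (simp add: sgn_div_norm norm_mult scaleR_conv_of_real exp_of_real[symmetric] flip: of_real_minus)
  ultimately have ph: "row_phase \<longlonglongrightarrow> \<gamma>" by (simp add: row_phase_eq[abs_def])
  have prob: "circle_prob (\<mu> n j)" if "1 \<le> j" "j \<le> k n" for n j
    using that by (intro circle_prob_\<mu>) auto
  show "weak_conv_circle (\<lambda>n. row_conv boolean_conv (l n) (\<mu> n) (k n)) (boolean_gaussian \<gamma> A)"
  proof (rule weak_conv_circle_if_B_transforms)
    show "circle_prob (row_conv boolean_conv (l n) (\<mu> n) (k n))" for n
      by (rule circle_prob_row_boolean_conv[OF prob l])
    show "circle_prob (boolean_gaussian \<gamma> A)" by (rule circle_prob_boolean_gaussian) (use \<gamma> A in auto)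
    fix z :: complex assume z: "norm z < 1"
    have eq: "B_transform (row_conv boolean_conv (l n) (\<mu> n) (k n)) z
      = row_phase n * (\<Prod>j=1..k n. B_transform (centred n j) (phase n j * z))" for n
    proof -
      have "B_transform (\<mu> n j) z = phase n j * B_transform (centred n j) (phase n j * z)" if j: "j \<in> {1..k n}" for j
      proof -
        have "norm (phase n j * z) < 1" using z phase(1)[OF j] by (simp add: norm_mult)
        then have "phase n j * B_transform (centred n j) (phase n j * z)
          = (cnj (phase n j) * phase n j) * B_transform (\<mu> n j) ((cnj (phase n j) * phase n j) * z)"
          unfolding centred_def by (simp add: B_transform_rotate[OF circle_prob_\<mu>[OF j] phase(2)[OF j]] mult_ac)
        then show ?thesis by (simp add: circle_cnj_mult[OF phase(1)[OF j]])
      qed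
      then show ?thesis
        by (simp add: B_transform_row_boolean_conv[OF prob l z] row_phase_def prod.distrib mult.assoc)
    qed
    show "(\<lambda>n. B_transform (row_conv boolean_conv (l n) (\<mu> n) (k n)) z) \<longlonglongrightarrow> B_transform (boolean_gaussian \<gamma> A) z"
      unfolding eq B_transform_boolean_gaussian[OF \<gamma> less_imp_le[OF A] z]
      by (intro tendsto_mult ph prod_centred_B_transform_tendsto[OF A' D z])
  qed
  show "weak_conv_circle (\<lambda>n. row_conv circle_conv (l n) (\<mu> n) (k n)) (wrapped_gaussian (Arg \<gamma>) (2 * A))"
  proof (rule weak_conv_circle_if_moments)
    show "circle_prob (row_conv circle_conv (l n) (\<mu> n) (k n))" for n
      by (rule circle_prob_row_circle_conv[OF prob l])
    show "circle_prob (wrapped_gaussian (Arg \<gamma>) (2 * A))" by (rule circle_prob_wrapped_gaussian) (use A in simp)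
    fix p :: nat
    have eq: "circle_moment (row_conv circle_conv (l n) (\<mu> n) (k n)) p
      = row_phase n ^ p * (\<Prod>j=1..k n. circle_moment (centred n j) p)" for n
      by (simp add: circle_moment_row_circle_conv[OF prob l] circle_moment_eq_centred row_phase_def
          prod.distrib power_mult_distrib prod_power_distrib mult.assoc)
    have "cis (Arg \<gamma>) = \<gamma>" using \<gamma> by (subst cis_Arg) (auto simp: sgn_div_norm)
    then have lim: "circle_moment (wrapped_gaussian (Arg \<gamma>) (2 * A)) p = \<gamma> ^ p * exp (- of_real ((real p)\<^sup>2 * A))"
      using circle_moment_wrapped_gaussian[of "2 * A" "Arg \<gamma>" p] A by simp
    show "(\<lambda>n. circle_moment (row_conv circle_conv (l n) (\<mu> n) (k n)) p) \<longlonglongrightarrow> circle_moment (wrapped_gaussian (Arg \<gamma>) (2 * A)) p"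
      unfolding eq lim by (intro tendsto_mult tendsto_power ph prod_centred_moment_tendsto[OF A' D])
  qed
qed

text \<open>In both directions the limit of the means fixes \<open>\<gamma>\<close> and \<open>A\<close>, and the second piece of information, the logarithmic
  derivative or the second moment, forces the square defects to vanish in the limit.\<close>

theorem boolean_normal_limit_iff_circle_normal_limit:
  "(\<exists>N. boolean_normal N \<and> weak_conv_circle (\<lambda>n. row_conv boolean_conv (l n) (\<mu> n) (k n)) N) \<longleftrightarrow>
   (\<exists>N. circle_normal N \<and> weak_conv_circle (\<lambda>n. row_conv circle_conv (l n) (\<mu> n) (k n)) N)"
proof
  have prob: "circle_prob (\<mu> n j)" if "1 \<le> j" "j \<le> k n" for n j
    using that by (intro circle_prob_\<mu>) auto
  have nz: "mean n j \<noteq> 0" if "1 \<le> j" "j \<le> k n" for n j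
    using that by (intro mean_neq_0) auto
  {
    assume "\<exists>N. boolean_normal N \<and> weak_conv_circle (\<lambda>n. row_conv boolean_conv (l n) (\<mu> n) (k n)) N"
    then obtain \<gamma> A where \<gamma>: "\<gamma> \<in> circle" and A: "A > 0"
      and conv: "weak_conv_circle (\<lambda>n. row_conv boolean_conv (l n) (\<mu> n) (k n)) (boolean_gaussian \<gamma> A)"
      unfolding boolean_normal_iff by blast
    let ?B = "\<lambda>n. row_conv boolean_conv (l n) (\<mu> n) (k n)" and ?N = "boolean_gaussian \<gamma> A"
    have A0: "A \<ge> 0" using A by simp
    have mom: "(\<lambda>n. circle_moment (?B n) p) \<longlonglongrightarrow> circle_moment ?N p" for p
      by (rule moments_tendsto_if_weak_conv_circle[OF circle_prob_row_boolean_conv[OF prob l] circle_prob_boolean_gaussian[OF \<gamma> A0] conv])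
    have m: "row_mean \<longlonglongrightarrow> \<gamma> * exp (- of_real A)"
    proof -
      have "circle_moment (?B n) 1 = row_mean n" for n
        unfolding row_mean_def by (rule circle_moment_1_row_boolean_conv[OF prob l nz])
      then show ?thesis using mom[of 1] unfolding circle_moment_1_boolean_gaussian[OF \<gamma> A0] by (simp only:)
    qed
    have "(\<lambda>n. norm (row_mean n)) \<longlonglongrightarrow> norm (\<gamma> * exp (- of_real A))" by (intro tendsto_intros m)
    then have "(\<lambda>n. norm (row_mean n)) \<longlonglongrightarrow> exp (- A)" using \<gamma> by (simp add: norm_mult)
    note A' = sum_defect_tendsto[OF this]
    have "(\<lambda>n. B_log_derivative (?B n)) \<longlonglongrightarrow> B_log_derivative ?N"
      unfolding B_log_derivative_def
      by (intro tendsto_intros mom) (use \<gamma> circle_moment_1_boolean_gaussian[OF \<gamma> A0] in auto)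
    moreover have "B_log_derivative (?B n) = (\<Sum>j=1..k n. B_log_derivative (\<mu> n j))" for n
      by (rule B_log_derivative_row_boolean_conv[OF prob l nz])
    ultimately have "(\<lambda>n. \<Sum>j=1..k n. B_log_derivative (\<mu> n j)) \<longlonglongrightarrow> of_real (- 2 * A)"
      unfolding B_log_derivative_boolean_gaussian[OF \<gamma> A0] by simp
    note D = square_defect_tendsto_if_B_log_derivative[OF A' this]
    show "\<exists>N. circle_normal N \<and> weak_conv_circle (\<lambda>n. row_conv circle_conv (l n) (\<mu> n) (k n)) N"
    proof (intro exI conjI)
      show "circle_normal (wrapped_gaussian (Arg \<gamma>) (2 * A))"
        unfolding circle_normal_iff using A by (intro exI[of _ "Arg \<gamma>"] exI[of _ "2 * A"]) simp
    qed (rule row_convs_tendsto(2)[OF m \<gamma> A D])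
  }
  {
    assume "\<exists>N. circle_normal N \<and> weak_conv_circle (\<lambda>n. row_conv circle_conv (l n) (\<mu> n) (k n)) N"
    then obtain a t where t: "t > 0"
      and conv: "weak_conv_circle (\<lambda>n. row_conv circle_conv (l n) (\<mu> n) (k n)) (wrapped_gaussian a t)"
      unfolding circle_normal_iff by blast
    let ?C = "\<lambda>n. row_conv circle_conv (l n) (\<mu> n) (k n)" and ?N = "wrapped_gaussian a t"
    \<comment> \<open>the mean of the Gaussian law has modulus \<open>exp (- t / 2)\<close>, that of the boolean one \<open>exp (- A)\<close>\<close>
    define A where "A = t / 2"
    have A: "A > 0" using t by (simp add: A_def)
    have mom: "(\<lambda>n. l n ^ p * (\<Prod>j=1..k n. circle_moment (\<mu> n j) p)) \<longlonglongrightarrow> cis a ^ p * exp (- of_real ((real p)\<^sup>2 * t / 2))" for p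
    proof -
      have eq: "circle_moment (?C n) p = l n ^ p * (\<Prod>j=1..k n. circle_moment (\<mu> n j) p)" for n
        by (rule circle_moment_row_circle_conv[OF prob l])
      have "(\<lambda>n. circle_moment (?C n) p) \<longlonglongrightarrow> circle_moment ?N p"
        by (rule moments_tendsto_if_weak_conv_circle[OF circle_prob_row_circle_conv[OF prob l] circle_prob_wrapped_gaussian[OF t] conv])
      then show ?thesis unfolding eq circle_moment_wrapped_gaussian[OF t] .
    qed
    have \<gamma>: "cis a \<in> circle" by simp
    have m: "row_mean \<longlonglongrightarrow> cis a * exp (- of_real A)"
      using mom[of 1] by (simp add: row_mean_def[abs_def] A_def)
    have "(\<lambda>n. norm (row_mean n)) \<longlonglongrightarrow> norm (cis a * exp (- of_real A))" by (intro tendsto_intros m)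
    then have "(\<lambda>n. norm (row_mean n)) \<longlonglongrightarrow> exp (- A)" by (simp add: norm_mult)
    note A' = sum_defect_tendsto[OF this]
    have "(\<lambda>n. norm (l n ^ 2 * (\<Prod>j=1..k n. circle_moment (\<mu> n j) 2)))
        \<longlonglongrightarrow> norm (cis a ^ 2 * exp (- of_real ((real 2)\<^sup>2 * t / 2)))"
      by (intro tendsto_norm mom)
    then have "(\<lambda>n. \<Prod>j=1..k n. norm (circle_moment (\<mu> n j) 2)) \<longlonglongrightarrow> exp (- 4 * A)"
      using l by (simp add: norm_mult norm_power A_def prod_norm)
    note D = square_defect_tendsto_if_second_moments[OF A' this]
    show "\<exists>N. boolean_normal N \<and> weak_conv_circle (\<lambda>n. row_conv boolean_conv (l n) (\<mu> n) (k n)) N"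
      using row_convs_tendsto(1)[OF m \<gamma> A D] A \<gamma> unfolding boolean_normal_iff by blast
  }
qed

end

theorem corollary4p2:
  fixes k :: "nat \<Rightarrow> nat" and \<mu> :: "nat \<Rightarrow> nat \<Rightarrow> complex measure" and l :: "nat \<Rightarrow> complex"
  assumes "\<And>n. k n \<ge> 1"
    and "\<And>n j. 1 \<le> j \<Longrightarrow> j \<le> k n \<Longrightarrow> circle_prob_nonzero_mean (\<mu> n j)"
    and "infinitesimal_array k \<mu>"
    and "\<And>n. l n \<in> circle"
  shows "(\<exists>N. boolean_normal N \<and>
            weak_conv_circle (\<lambda>n. row_conv boolean_conv (l n) (\<mu> n) (k n)) N) \<longleftrightarrow>
         (\<exists>N. circle_normal N \<and>
            weak_conv_circle (\<lambda>n. row_conv circle_conv (l n) (\<mu> n) (k n)) N)"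
proof -
  interpret infinitesimal_rows k \<mu> l
    using assms by unfold_locales auto
  show ?thesis by (rule boolean_normal_limit_iff_circle_normal_limit)
qed

end
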